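(* Let $n \ge 3$ and $m\ge 1$ be integers. Let $A = (A_{ij})$ be a constant, symmetric, positive definite real $m\times m$ matrix. Suppose $f^1,\dots,f^m : \mathbb{R}^m\to\mathbb{R}$ are homogeneous functions of degree $\frac{n+2}{n-2}$ satisfying, with $q=\frac{n+2}{n-2}$ and some constant $C$, the structure conditions $|f^i(v)|\le C|v|^{q}$ and $|\nabla f^i(v)|\le C|v|^{q-1}$ for $i=1,\dots,m$. Let $B_1\subset\mathbb{R}^n$ be the unit ball centered at the origin, and let $V=(V_1,\dots,V_m)\in L^{\frac{2n}{n-2}}(B_1)$ be a solution of $$\sum_{j=1}^m A_{ij}\,\Delta V_j = f^i(V),\qquad i=1,\dots,m,$$ in $B_1\setminus\{0\}$. Then $V$ can be extended to a smooth solution of the same system in $B_1$.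
   Context: $\Delta$ is the Euclidean Laplacian on $\mathbb{R}^n$, applied to each component $V_j$ of the $\mathbb{R}^m$-valued function $V$. A function $f:\mathbb{R}^m\to\mathbb{R}$ is homogeneous of degree $d$ if $f(tv)=t^d f(v)$ for all $t>0$ and $v\in\mathbb{R}^m$. No sign condition is imposed on $V_i$ or $f^i$. Smooth means $C^\infty$.
   Formalization: As the f^i need not be smooth, the C^∞ claim can fail; proved instead: V extends to a C^2 solution in B_1, and it is C^∞ at the points whose values lie in any open set where all f^i are C^∞ (so on all of B_1 if the f^i are smooth). "Solution" means classical C^2 solution. *)

theory Defs
  imports "HOL-Analysis.Analysis"
begin

definition partial_deriv ::
  "'a::euclidean_space \<Rightarrow> ('a \<Rightarrow> 'b::real_normed_vector) \<Rightarrow> 'a \<Rightarrow> 'b" where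
  "partial_deriv b g x = frechet_derivative g (at x) b"

(* Meant for open S, where it is the usual class of k times continuously differentiable maps:
   a map with continuous partial derivatives is Frechet differentiable, so asking for
   differentiability at every level adds nothing.  It only ensures that the value
   of frechet_derivative is meaningful. *)
fun C_k_on :: "nat \<Rightarrow> 'a::euclidean_space set \<Rightarrow> ('a \<Rightarrow> 'b::real_normed_vector) \<Rightarrow> bool" where
  "C_k_on 0 S g \<longleftrightarrow> continuous_on S g"
| "C_k_on (Suc k) S g \<longleftrightarrow>
     (\<forall>x\<in>S. g differentiable (at x)) \<and> (\<forall>b\<in>Basis. C_k_on k S (partial_deriv b g))"

definition smooth_on :: "'a::euclidean_space set \<Rightarrow> ('a \<Rightarrow> 'b::real_normed_vector) \<Rightarrow> bool" where
  "smooth_on S g \<longleftrightarrow> (\<forall>k. C_k_on k S g)"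

definition laplacian :: "('a::euclidean_space \<Rightarrow> real) \<Rightarrow> 'a \<Rightarrow> real" where
  "laplacian g x = (\<Sum>b\<in>Basis. partial_deriv b (partial_deriv b g) x)"

definition symmetric_positive_definite :: "real^'m^'m \<Rightarrow> bool" where
  "symmetric_positive_definite A \<longleftrightarrow> transpose A = A \<and> (\<forall>v. v \<noteq> 0 \<longrightarrow> v \<bullet> (A *v v) > 0)"

definition in_Lp :: "real \<Rightarrow> 'a::euclidean_space set \<Rightarrow> ('a \<Rightarrow> 'b::real_normed_vector) \<Rightarrow> bool" where
  "in_Lp p S g \<longleftrightarrow> set_borel_measurable lebesgue S g \<and>
     set_integrable lebesgue S (\<lambda>x. norm (g x) powr p)"

definition homogeneous_of_degree :: "real \<Rightarrow> ('a::real_vector \<Rightarrow> real) \<Rightarrow> bool" where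
  "homogeneous_of_degree d g \<longleftrightarrow> (\<forall>t>0. \<forall>v. g (t *\<^sub>R v) = t powr d * g v)"

(* The gradient of g at v is the vector D with GDERIV g v :> D, so g is in particular
   differentiable everywhere; no further regularity is imposed. *)
definition structure_conditions :: "real \<Rightarrow> real \<Rightarrow> ('a::real_inner \<Rightarrow> real) \<Rightarrow> bool" where
  "structure_conditions q C g \<longleftrightarrow>
     (\<forall>v. \<bar>g v\<bar> \<le> C * norm v powr q \<and>
          (\<exists>D. (GDERIV g v :> D) \<and> norm D \<le> C * norm v powr (q - 1)))"

definition solution_on ::
  "real^'m^'m \<Rightarrow> ('m \<Rightarrow> real^'m \<Rightarrow> real) \<Rightarrow> (real^'n) set \<Rightarrow> (real^'n \<Rightarrow> real^'m) \<Rightarrow> bool" where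
  "solution_on A f S V \<longleftrightarrow> C_k_on 2 S V \<and>
     (\<forall>x\<in>S. \<forall>i. (\<Sum>j\<in>UNIV. A $ i $ j * laplacian (\<lambda>y. V y $ j) x) = f i (V x))"

end

theory Submission
  imports Defs
begin

text \<open>
  Inverting the matrix turns the system into \<open>\<Delta>V = \<Phi>(V)\<close> with \<open>|\<Phi>(v)| \<le> C|v|\<^sup>q\<close> and \<open>\<Phi>\<close> differentiable
  with locally bounded derivative.  Let \<open>m = (n - 2)/2\<close>, so that \<open>q - 1 = 2/m\<close>.  Everything rests on one
  identity, obtained by integrating by parts against a truncated Newton kernel:
  \<open>c u(x) = \<integral> R(y - x) u(y) dy - \<integral> K(y - x) \<Delta>u(y) dy\<close>, where \<open>K\<close> and \<open>R\<close> are supported in a ball and are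
  \<open>O(|z|\<^bsup>2-n\<^esup>)\<close> with gradient \<open>O(|z|\<^bsup>1-n\<^esup>)\<close>.  It holds across an isolated singularity near which
  \<open>u\<close> and \<open>\<Delta>u\<close> are bounded, because points have zero capacity when \<open>n \<ge> 3\<close>.

  The identity implies a mean value inequality.  Maximising \<open>(r - |y - x|)\<^sup>m |V(y)|\<close> over a ball then shows
  that small energy \<open>\<integral>|V|\<^bsup>2n/(n-2)\<^esup>\<close> forces \<open>|x|\<^sup>m |V(x)| \<rightarrow> 0\<close>.  Hence \<open>|\<Delta>V| \<le> \<epsilon>|x|\<^bsup>-2\<^esup>|V|\<close>, and comparison
  with sums of powers of \<open>|x|\<close> gives first \<open>V = O(|x|\<^bsup>-m/2\<^esup>)\<close> and then boundedness.  For bounded \<open>V\<close> the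
  identity defines a \<open>C\<^sup>1\<close> extension \<open>W\<close>; now \<open>\<Phi>(W)\<close> is differentiable with bounded derivatives, so one
  derivative in \<open>K * \<Phi>(W)\<close> can be moved onto \<open>\<Phi>(W)\<close> and the other onto \<open>K\<close>, whence \<open>W\<close> is \<open>C\<^sup>2\<close>.  The same gain of
  one derivative, iterated, gives smoothness wherever \<open>\<Phi>\<close> is smooth.
\<close>

section \<open>Calculus of \<open>C_k_on\<close>\<close>

text \<open>The exponents are critical: the equation and the energy are both invariant under u(x) ->
  s^m u(s x). Scaling suggests only the rate |x|^(-m), at which the potential |V|^(2/m) is as strong
  as |x|^(-2), that is, as the Laplacian itself. The little-o is therefore essential: a small
  multiple of |x|^(-2) is beaten by superharmonic powers of |x|. Without sign conditions and with
  coupled components there is no maximum principle for a single V_j, so |V| is compared, tested in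
  the direction of V at the extremal point. A kernel supported in a ball, smoothed as (|z|^2 +
  e)^(-m) and cut off by polynomials, makes every integration by parts one against a compactly
  supported C^2 function: no boundary integrals, polar coordinates or normalising constants are
  computed. Finally the f^i are only differentiable, so the derivative of Phi(W) is bounded but
  perhaps discontinuous; being a limit of difference quotients, it is measurable and can still be
  convolved with the kernel.\<close>

lemma partial_deriv_eq:
  "(g has_derivative g') (at x) \<Longrightarrow> partial_deriv b g x = g' b"
  unfolding partial_deriv_def by (metis frechet_derivative_at)

lemma has_derivative_partial_deriv:
  fixes g :: "'a::euclidean_space \<Rightarrow> 'b::real_normed_vector"
  assumes "g differentiable (at x)"
  shows "(g has_derivative (\<lambda>h. \<Sum>b\<in>Basis. (h \<bullet> b) *\<^sub>R partial_deriv b g x)) (at x)"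
proof -
  obtain D where D: "(g has_derivative D) (at x)" using assms unfolding differentiable_def by blast
  have "D h = (\<Sum>b\<in>Basis. (h \<bullet> b) *\<^sub>R partial_deriv b g x)" for h
  proof -
    have "D h = D (\<Sum>b\<in>Basis. (h \<bullet> b) *\<^sub>R b)" by (simp add: euclidean_representation)
    also have "\<dots> = (\<Sum>b\<in>Basis. (h \<bullet> b) *\<^sub>R D b)"
      using has_derivative_linear[OF D] by (simp add: linear_sum linear_scale)
    finally show ?thesis using partial_deriv_eq[OF D] by simp
  qed
  then show ?thesis using D by (metis (no_types, lifting) ext)
qed

lemma partial_deriv_cong:
  assumes "open S" "x \<in> S" "\<And>y. y \<in> S \<Longrightarrow> g y = h y"
  shows "partial_deriv b g x = partial_deriv b h x"
proof -
  have "(g has_derivative D) (at x) \<longleftrightarrow> (h has_derivative D) (at x)" for D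
    using has_derivative_transform_within_open[of g D x UNIV S h]
      has_derivative_transform_within_open[of h D x UNIV S g] assms by auto
  then show ?thesis unfolding partial_deriv_def frechet_derivative_def by simp
qed

lemma differentiable_cong_open:
  assumes "open S" "x \<in> S" "\<And>y. y \<in> S \<Longrightarrow> g y = h y"
  shows "g differentiable (at x) \<longleftrightarrow> h differentiable (at x)"
  using has_derivative_transform_within_open[of g _ x UNIV S h]
    has_derivative_transform_within_open[of h _ x UNIV S g] assms
  unfolding differentiable_def by metis

lemma C_k_on_subset: "C_k_on k S g \<Longrightarrow> T \<subseteq> S \<Longrightarrow> C_k_on k T g"
  by (induction k arbitrary: g) (auto intro: continuous_on_subset)

lemma C_k_on_imp_continuous_on: "C_k_on k S g \<Longrightarrow> continuous_on S g"
  by (cases k) (auto intro!: continuous_at_imp_continuous_on differentiable_imp_continuous_within)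

lemma C_k_on_SucD: "C_k_on (Suc k) S g \<Longrightarrow> C_k_on k S g"
proof (induction k arbitrary: g)
  case 0 then show ?case using C_k_on_imp_continuous_on by fastforce
next
  case (Suc k)
  then show ?case by (metis C_k_on.simps(2))
qed

lemma C_k_on_mono: "C_k_on k S g \<Longrightarrow> j \<le> k \<Longrightarrow> C_k_on j S g"
  by (induction k) (auto simp: le_Suc_eq dest: C_k_on_SucD simp del: C_k_on.simps)

lemma C_k_on_local:
  assumes "\<And>x. x \<in> S \<Longrightarrow> \<exists>T. open T \<and> x \<in> T \<and> C_k_on k T g"
  shows "C_k_on k S g"
  using assms
proof (induction k arbitrary: g)
  case 0
  then show ?case
    by (metis C_k_on.simps(1) continuous_at_imp_continuous_on continuous_on_eq_continuous_at)
next
  case (Suc k)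
  have "C_k_on k S (partial_deriv b g)" if "b \<in> Basis" for b
    using Suc that by (metis C_k_on.simps(2))
  moreover have "g differentiable (at x)" if "x \<in> S" for x
    using Suc.prems that by (metis C_k_on.simps(2))
  ultimately show ?case by simp
qed

lemma C_k_on_cong:
  assumes "open S" "\<And>x. x \<in> S \<Longrightarrow> g x = h x" "C_k_on k S g"
  shows "C_k_on k S h"
  using assms(2,3)
proof (induction k arbitrary: g h)
  case 0
  then show ?case by (metis C_k_on.simps(1) continuous_on_cong)
next
  case (Suc k)
  have "C_k_on k S (partial_deriv b h)" if "b \<in> Basis" for b
  proof (rule Suc.IH)
    show "C_k_on k S (partial_deriv b g)" using Suc.prems that by simp
    show "partial_deriv b g x = partial_deriv b h x" if "x \<in> S" for x
      by (rule partial_deriv_cong[OF assms(1) that]) (use Suc.prems in auto)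
  qed
  moreover have "h differentiable (at x)" if "x \<in> S" for x
    using Suc.prems that differentiable_cong_open[OF assms(1) that, of g h] by auto
  ultimately show ?case by simp
qed

text \<open>Lets the derivative be supplied in any closed form, so that later computations need not
  mention \<open>frechet_derivative\<close>.\<close>

lemma C_k_on_SucI:
  assumes "open S" "\<And>x. x \<in> S \<Longrightarrow> (g has_derivative g' x) (at x)"
    and "\<And>b. b \<in> Basis \<Longrightarrow> C_k_on k S (\<lambda>x. g' x b)"
  shows "C_k_on (Suc k) S g"
proof -
  have "C_k_on k S (partial_deriv b g)" if "b \<in> Basis" for b
    by (rule C_k_on_cong[OF assms(1) _ assms(3)[OF that]]) (use assms partial_deriv_eq in metis)
  then show ?thesis using assms(2) differentiable_def by (auto simp del: split_paired_All) blast
qed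

lemma C_k_on_Suc_has_derivative:
  "C_k_on (Suc k) S g \<Longrightarrow> x \<in> S \<Longrightarrow>
    (g has_derivative (\<lambda>h. \<Sum>b\<in>Basis. (h \<bullet> b) *\<^sub>R partial_deriv b g x)) (at x)"
  by (auto intro: has_derivative_partial_deriv)

lemma C_k_on_Suc_partial_deriv:
  "C_k_on (Suc k) S g \<Longrightarrow> b \<in> Basis \<Longrightarrow> C_k_on k S (partial_deriv b g)"
  by simp

lemma C_k_on_const: "open S \<Longrightarrow> C_k_on k S (\<lambda>x. c)"
proof (induction k arbitrary: c)
  case (Suc k)
  then show ?case by (intro C_k_on_SucI[where g' = "\<lambda>x h. 0"]) auto
qed simp

lemma sum_Basis_partial_deriv:
  "b \<in> Basis \<Longrightarrow> (\<Sum>c\<in>Basis. (b \<bullet> c) *\<^sub>R F c) = (F b :: 'b::real_vector)" for b :: "'a::euclidean_space"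
  by (simp add: inner_Basis if_distrib[of "\<lambda>t. t *\<^sub>R _"] sum.delta cong: if_cong)

lemma C_k_on_bounded_linear:
  assumes "bounded_linear L" "open S" "C_k_on k S g"
  shows "C_k_on k S (\<lambda>x. L (g x))"
  using assms(3)
proof (induction k arbitrary: g)
  case 0
  then show ?case
    using assms(1) by (simp add: bounded_linear.continuous_on)
next
  case (Suc k)
  show ?case
  proof (rule C_k_on_SucI[OF assms(2)])
    show "((\<lambda>x. L (g x)) has_derivative (\<lambda>h. L (\<Sum>b\<in>Basis. (h \<bullet> b) *\<^sub>R partial_deriv b g x))) (at x)"
      if "x \<in> S" for x
      using bounded_linear.has_derivative[OF assms(1) C_k_on_Suc_has_derivative[OF Suc.prems that]] .
    show "C_k_on k S (\<lambda>x. L (\<Sum>c\<in>Basis. (b \<bullet> c) *\<^sub>R partial_deriv c g x))"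
      if "b \<in> Basis" for b
      using Suc that by (simp add: sum_Basis_partial_deriv)
  qed
qed

lemma C_k_on_add:
  assumes "open S" "C_k_on k S g" "C_k_on k S h"
  shows "C_k_on k S (\<lambda>x. g x + h x)"
  using assms(2,3)
proof (induction k arbitrary: g h)
  case 0
  then show ?case by (simp add: continuous_on_add)
next
  case (Suc k)
  show ?case
  proof (rule C_k_on_SucI[OF assms(1)])
    show "((\<lambda>x. g x + h x) has_derivative (\<lambda>h'. (\<Sum>b\<in>Basis. (h' \<bullet> b) *\<^sub>R partial_deriv b g x)
        + (\<Sum>b\<in>Basis. (h' \<bullet> b) *\<^sub>R partial_deriv b h x))) (at x)" if "x \<in> S" for x
      by (intro has_derivative_add C_k_on_Suc_has_derivative[OF Suc.prems(1) that]
          C_k_on_Suc_has_derivative[OF Suc.prems(2) that])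
    show "C_k_on k S (\<lambda>x. (\<Sum>c\<in>Basis. (b \<bullet> c) *\<^sub>R partial_deriv c g x)
        + (\<Sum>c\<in>Basis. (b \<bullet> c) *\<^sub>R partial_deriv c h x))" if "b \<in> Basis" for b
      using Suc that by (simp add: sum_Basis_partial_deriv)
  qed
qed

lemma C_k_on_sum:
  assumes "open S" "\<And>i. i \<in> I \<Longrightarrow> C_k_on k S (g i)"
  shows "C_k_on k S (\<lambda>x. \<Sum>i\<in>I. g i x)"
  using assms(2)
  by (induction I rule: infinite_finite_induct) (auto intro!: C_k_on_const C_k_on_add assms(1))

lemma C_k_on_scaleR:
  fixes g :: "'a::euclidean_space \<Rightarrow> real"
  assumes "open S" "C_k_on k S g" "C_k_on k S h"
  shows "C_k_on k S (\<lambda>x. g x *\<^sub>R h x)"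
  using assms(2,3)
proof (induction k arbitrary: g h)
  case 0
  then show ?case by (simp add: continuous_on_scaleR)
next
  case (Suc k)
  show ?case
  proof (rule C_k_on_SucI[OF assms(1)])
    show "((\<lambda>x. g x *\<^sub>R h x) has_derivative (\<lambda>h'. g x *\<^sub>R (\<Sum>b\<in>Basis. (h' \<bullet> b) *\<^sub>R partial_deriv b h x)
        + (\<Sum>b\<in>Basis. (h' \<bullet> b) *\<^sub>R partial_deriv b g x) *\<^sub>R h x)) (at x)" if "x \<in> S" for x
      by (intro has_derivative_scaleR C_k_on_Suc_has_derivative[OF Suc.prems(1) that]
          C_k_on_Suc_has_derivative[OF Suc.prems(2) that])
    show "C_k_on k S (\<lambda>x. g x *\<^sub>R (\<Sum>c\<in>Basis. (b \<bullet> c) *\<^sub>R partial_deriv c h x)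
        + (\<Sum>c\<in>Basis. (b \<bullet> c) *\<^sub>R partial_deriv c g x) *\<^sub>R h x)" if "b \<in> Basis" for b
      unfolding sum_Basis_partial_deriv[OF that]
      using Suc.prems that
      by (intro C_k_on_add assms(1) Suc.IH)
         (auto intro: C_k_on_Suc_partial_deriv C_k_on_SucD simp del: C_k_on.simps)
  qed
qed

text \<open>Induction over \<open>g\<close> with \<open>W\<close> fixed: the chain rule produces
  products of derivatives of \<open>W\<close> with partial derivatives of \<open>g\<close> composed
  with the same \<open>W\<close>, and the induction hypothesis applies to the latter.\<close>

lemma C_k_on_compose:
  fixes g :: "'b::euclidean_space \<Rightarrow> 'c::real_normed_vector" and W :: "'a::euclidean_space \<Rightarrow> 'b"
  assumes "open S" "open T" "\<And>x. x \<in> S \<Longrightarrow> W x \<in> T" "C_k_on k S W" "C_k_on k T g"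
  shows "C_k_on k S (\<lambda>x. g (W x))"
  using assms(4,5)
proof (induction k arbitrary: g)
  case 0
  then show ?case using continuous_on_compose2[of T g S W] assms(3) by auto
next
  case (Suc k)
  show ?case
  proof (rule C_k_on_SucI[OF assms(1)])
    show "((\<lambda>x. g (W x)) has_derivative (\<lambda>h. \<Sum>c\<in>Basis.
         ((\<Sum>b\<in>Basis. (h \<bullet> b) *\<^sub>R partial_deriv b W x) \<bullet> c) *\<^sub>R partial_deriv c g (W x))) (at x)"
      if "x \<in> S" for x
      using has_derivative_compose[OF C_k_on_Suc_has_derivative[OF Suc.prems(1) that]
          C_k_on_Suc_has_derivative[OF Suc.prems(2) assms(3)[OF that]]] by simp
    show "C_k_on k S (\<lambda>x. \<Sum>c\<in>Basis.
         ((\<Sum>b'\<in>Basis. (b \<bullet> b') *\<^sub>R partial_deriv b' W x) \<bullet> c) *\<^sub>R partial_deriv c g (W x))"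
      if b: "b \<in> Basis" for b
      unfolding sum_Basis_partial_deriv[OF b]
    proof (intro C_k_on_sum assms(1) C_k_on_scaleR)
      fix c :: 'b assume c: "c \<in> Basis"
      show "C_k_on k S (\<lambda>x. partial_deriv b W x \<bullet> c)"
        by (intro C_k_on_bounded_linear[OF bounded_linear_inner_left assms(1)]
            C_k_on_Suc_partial_deriv[OF Suc.prems(1) b])
      show "C_k_on k S (\<lambda>x. partial_deriv c g (W x))"
        by (intro Suc.IH C_k_on_SucD[OF Suc.prems(1)] C_k_on_Suc_partial_deriv[OF Suc.prems(2) c])
    qed
  qed
qed

section \<open>The Laplacian of vector-valued functions\<close>

text \<open>\<open>laplacian\<close> takes real-valued functions only. The vector-valued operator
  turns the system into one equation; \<open>laplacian_component\<close> relates the two.\<close>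

definition vlaplacian :: "('a::euclidean_space \<Rightarrow> 'b::real_normed_vector) \<Rightarrow> 'a \<Rightarrow> 'b" where
  "vlaplacian u x = (\<Sum>b\<in>Basis. partial_deriv b (partial_deriv b u) x)"

lemma has_vector_derivative_line:
  assumes "g differentiable (at (x + t *\<^sub>R b))"
  shows "((\<lambda>t. g (x + t *\<^sub>R b)) has_vector_derivative partial_deriv b g (x + t *\<^sub>R b)) (at t)"
proof -
  have 1: "(g has_derivative frechet_derivative g (at (x + t *\<^sub>R b))) (at (x + t *\<^sub>R b))"
    using assms frechet_derivative_works by blast
  have 2: "((\<lambda>t. x + t *\<^sub>R b) has_derivative (\<lambda>s. s *\<^sub>R b)) (at t)"
    by (auto intro!: derivative_eq_intros)
  show ?thesis
    using has_derivative_compose[OF 2 1] linear_frechet_derivative[OF assms]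
    unfolding has_vector_derivative_def partial_deriv_def by (simp add: linear_scale)
qed

lemma vlaplacian_cong:
  assumes "open S" "x \<in> S" "\<And>y. y \<in> S \<Longrightarrow> g y = h y"
  shows "vlaplacian g x = vlaplacian h x"
  unfolding vlaplacian_def
  by (intro sum.cong refl partial_deriv_cong[OF assms(1,2)] partial_deriv_cong[OF assms(1)] assms(3))

lemma vlaplacian_eqI:
  assumes "open S" "x \<in> S" "\<And>y. y \<in> S \<Longrightarrow> (u has_derivative D y) (at y)"
    and "\<And>b. b \<in> Basis \<Longrightarrow> ((\<lambda>y. D y b) has_derivative E b) (at x)"
  shows "vlaplacian u x = (\<Sum>b\<in>Basis. E b b)"
  unfolding vlaplacian_def
proof (rule sum.cong)
  fix b :: 'a assume b: "b \<in> Basis"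
  have "partial_deriv b (partial_deriv b u) x = partial_deriv b (\<lambda>y. D y b) x"
    by (rule partial_deriv_cong[OF assms(1,2)]) (use assms(3) partial_deriv_eq in metis)
  also have "\<dots> = E b b" by (rule partial_deriv_eq) (use assms b in auto)
  finally show "partial_deriv b (partial_deriv b u) x = E b b" .
qed simp

lemma C_2_derivatives:
  assumes "C_k_on 2 S u" "x \<in> S"
  shows "(u has_derivative (\<lambda>h. \<Sum>b\<in>Basis. (h \<bullet> b) *\<^sub>R partial_deriv b u x)) (at x)"
    and "b \<in> Basis \<Longrightarrow> (partial_deriv b u has_derivative
      (\<lambda>h. \<Sum>c\<in>Basis. (h \<bullet> c) *\<^sub>R partial_deriv c (partial_deriv b u) x)) (at x)"
  using assms by (auto simp: numeral_2_eq_2 intro: has_derivative_partial_deriv)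

lemma vlaplacian_continuous_on: "C_k_on 2 S u \<Longrightarrow> continuous_on S (vlaplacian u)"
  unfolding vlaplacian_def[abs_def] by (auto simp: numeral_2_eq_2 intro!: continuous_on_sum)

lemma vlaplacian_bounded_linear:
  assumes "bounded_linear L" "open S" "x \<in> S" "C_k_on 2 S u"
  shows "vlaplacian (\<lambda>x. L (u x)) x = L (vlaplacian u x)"
proof -
  have "vlaplacian (\<lambda>x. L (u x)) x =
    (\<Sum>b\<in>Basis. L (\<Sum>c\<in>Basis. (b \<bullet> c) *\<^sub>R partial_deriv c (partial_deriv b u) x))"
  proof (rule vlaplacian_eqI[OF assms(2,3), where E = "\<lambda>b h. L (\<Sum>c\<in>Basis. (h \<bullet> c) *\<^sub>R partial_deriv c (partial_deriv b u) x)"])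
    show "((\<lambda>x. L (u x)) has_derivative (\<lambda>h. L (\<Sum>b\<in>Basis. (h \<bullet> b) *\<^sub>R partial_deriv b u y))) (at y)"
      if "y \<in> S" for y
      by (rule bounded_linear.has_derivative[OF assms(1) C_2_derivatives(1)[OF assms(4) that]])
    show "((\<lambda>y. L (\<Sum>c\<in>Basis. (b \<bullet> c) *\<^sub>R partial_deriv c u y)) has_derivative
       (\<lambda>h. L (\<Sum>c\<in>Basis. (h \<bullet> c) *\<^sub>R partial_deriv c (partial_deriv b u) x))) (at x)"
      if "b \<in> Basis" for b
      unfolding sum_Basis_partial_deriv[OF that]
      by (rule bounded_linear.has_derivative[OF assms(1) C_2_derivatives(2)[OF assms(4,3) that]])
  qed
  also have "\<dots> = (\<Sum>b\<in>Basis. L (partial_deriv b (partial_deriv b u) x))"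
    by (intro sum.cong refl) (simp add: sum_Basis_partial_deriv)
  also have "\<dots> = L (vlaplacian u x)"
    unfolding vlaplacian_def using assms(1) by (simp add: bounded_linear.linear linear_sum)
  finally show ?thesis .
qed

lemma vlaplacian_add:
  assumes "open S" "x \<in> S" "C_k_on 2 S u" "C_k_on 2 S v"
  shows "vlaplacian (\<lambda>x. u x + v x) x = vlaplacian u x + vlaplacian v x"
proof -
  have "vlaplacian (\<lambda>x. u x + v x) x =
    (\<Sum>b\<in>Basis. (\<Sum>c\<in>Basis. (b \<bullet> c) *\<^sub>R partial_deriv c (partial_deriv b u) x)
       + (\<Sum>c\<in>Basis. (b \<bullet> c) *\<^sub>R partial_deriv c (partial_deriv b v) x))"
  proof (rule vlaplacian_eqI[OF assms(1,2), where E = "\<lambda>b h. (\<Sum>c\<in>Basis. (h \<bullet> c) *\<^sub>R partial_deriv c (partial_deriv b u) x)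
          + (\<Sum>c\<in>Basis. (h \<bullet> c) *\<^sub>R partial_deriv c (partial_deriv b v) x)"])
    show "((\<lambda>x. u x + v x) has_derivative (\<lambda>h. (\<Sum>b\<in>Basis. (h \<bullet> b) *\<^sub>R partial_deriv b u y)
        + (\<Sum>b\<in>Basis. (h \<bullet> b) *\<^sub>R partial_deriv b v y))) (at y)"
      if "y \<in> S" for y
      by (intro has_derivative_add C_2_derivatives(1)[OF _ that] assms)
    show "((\<lambda>y. (\<Sum>c\<in>Basis. (b \<bullet> c) *\<^sub>R partial_deriv c u y)
         + (\<Sum>c\<in>Basis. (b \<bullet> c) *\<^sub>R partial_deriv c v y)) has_derivative
       (\<lambda>h. (\<Sum>c\<in>Basis. (h \<bullet> c) *\<^sub>R partial_deriv c (partial_deriv b u) x)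
          + (\<Sum>c\<in>Basis. (h \<bullet> c) *\<^sub>R partial_deriv c (partial_deriv b v) x))) (at x)"
      if "b \<in> Basis" for b
      unfolding sum_Basis_partial_deriv[OF that]
      by (intro has_derivative_add C_2_derivatives(2)[OF _ assms(2) that] assms)
  qed
  also have "\<dots> = vlaplacian u x + vlaplacian v x"
    unfolding vlaplacian_def sum.distrib[symmetric, of "\<lambda>b. partial_deriv b (partial_deriv b u) x"]
    by (intro sum.cong refl) (simp only: sum_Basis_partial_deriv)
  finally show ?thesis .
qed

lemma vlaplacian_scaleR:
  fixes g :: "'a::euclidean_space \<Rightarrow> real"
  assumes "open S" "x \<in> S" "C_k_on 2 S g" "C_k_on 2 S u"
  shows "vlaplacian (\<lambda>x. g x *\<^sub>R u x) x = g x *\<^sub>R vlaplacian u x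
    + (2::real) *\<^sub>R (\<Sum>b\<in>Basis. partial_deriv b g x *\<^sub>R partial_deriv b u x) + vlaplacian g x *\<^sub>R u x"
proof -
  have "vlaplacian (\<lambda>x. g x *\<^sub>R u x) x =
    (\<Sum>b\<in>Basis. (g x *\<^sub>R (\<Sum>c\<in>Basis. (b \<bullet> c) *\<^sub>R partial_deriv c (partial_deriv b u) x)
       + (\<Sum>c\<in>Basis. (b \<bullet> c) *\<^sub>R partial_deriv c g x) *\<^sub>R partial_deriv b u x)
      + (partial_deriv b g x *\<^sub>R (\<Sum>c\<in>Basis. (b \<bullet> c) *\<^sub>R partial_deriv c u x)
       + (\<Sum>c\<in>Basis. (b \<bullet> c) *\<^sub>R partial_deriv c (partial_deriv b g) x) *\<^sub>R u x))"
  proof (rule vlaplacian_eqI[OF assms(1,2), where E = "\<lambda>b h. (g x *\<^sub>R (\<Sum>c\<in>Basis. (h \<bullet> c) *\<^sub>R partial_deriv c (partial_deriv b u) x)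
       + (\<Sum>c\<in>Basis. (h \<bullet> c) *\<^sub>R partial_deriv c g x) *\<^sub>R partial_deriv b u x)
      + (partial_deriv b g x *\<^sub>R (\<Sum>c\<in>Basis. (h \<bullet> c) *\<^sub>R partial_deriv c u x)
       + (\<Sum>c\<in>Basis. (h \<bullet> c) *\<^sub>R partial_deriv c (partial_deriv b g) x) *\<^sub>R u x)"])
    show "((\<lambda>x. g x *\<^sub>R u x) has_derivative (\<lambda>h. g y *\<^sub>R (\<Sum>b\<in>Basis. (h \<bullet> b) *\<^sub>R partial_deriv b u y)
        + (\<Sum>b\<in>Basis. (h \<bullet> b) *\<^sub>R partial_deriv b g y) *\<^sub>R u y)) (at y)"
      if "y \<in> S" for y
      by (intro has_derivative_scaleR C_2_derivatives(1)[OF _ that] assms)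
    show "((\<lambda>y. g y *\<^sub>R (\<Sum>c\<in>Basis. (b \<bullet> c) *\<^sub>R partial_deriv c u y)
         + (\<Sum>c\<in>Basis. (b \<bullet> c) *\<^sub>R partial_deriv c g y) *\<^sub>R u y) has_derivative
       (\<lambda>h. (g x *\<^sub>R (\<Sum>c\<in>Basis. (h \<bullet> c) *\<^sub>R partial_deriv c (partial_deriv b u) x)
       + (\<Sum>c\<in>Basis. (h \<bullet> c) *\<^sub>R partial_deriv c g x) *\<^sub>R partial_deriv b u x)
      + (partial_deriv b g x *\<^sub>R (\<Sum>c\<in>Basis. (h \<bullet> c) *\<^sub>R partial_deriv c u x)
       + (\<Sum>c\<in>Basis. (h \<bullet> c) *\<^sub>R partial_deriv c (partial_deriv b g) x) *\<^sub>R u x))) (at x)"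
      if "b \<in> Basis" for b
      unfolding sum_Basis_partial_deriv[OF that]
      by (intro has_derivative_add has_derivative_scaleR C_2_derivatives(1)[OF _ assms(2)]
           C_2_derivatives(2)[OF _ assms(2) that] assms)
  qed
  also have "\<dots> = (\<Sum>b\<in>Basis. (g x *\<^sub>R partial_deriv b (partial_deriv b u) x
       + partial_deriv b g x *\<^sub>R partial_deriv b u x)
      + (partial_deriv b g x *\<^sub>R partial_deriv b u x
       + partial_deriv b (partial_deriv b g) x *\<^sub>R u x))"
    by (intro sum.cong refl) (simp only: sum_Basis_partial_deriv)
  also have "\<dots> = g x *\<^sub>R vlaplacian u x
    + (2::real) *\<^sub>R (\<Sum>b\<in>Basis. partial_deriv b g x *\<^sub>R partial_deriv b u x) + vlaplacian g x *\<^sub>R u x"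
    unfolding vlaplacian_def by (simp add: sum.distrib scaleR_sum_left scaleR_2 flip: scaleR_sum_right)
  finally show ?thesis .
qed

text \<open>The profile is a function of the squared distance, which is smooth also at the centre p;
  so p needs no separate treatment when 0 lies in \<open>I\<close>, and is excluded when it does
  not.\<close>

lemma radial_derivatives:
  fixes p :: "'a::euclidean_space" and k k1 k2 :: "real \<Rightarrow> real"
  assumes "open I" and k1: "\<And>s. s \<in> I \<Longrightarrow> (k has_real_derivative k1 s) (at s)"
    and k2: "\<And>s. s \<in> I \<Longrightarrow> (k1 has_real_derivative k2 s) (at s)" and cont: "continuous_on I k2"
  defines "S \<equiv> {y. (y - p) \<bullet> (y - p) \<in> I}"
  shows "open S" and "C_k_on 2 S (\<lambda>y. k ((y - p) \<bullet> (y - p)))"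
    and "x \<in> S \<Longrightarrow> partial_deriv b (\<lambda>y. k ((y - p) \<bullet> (y - p))) x
      = k1 ((x - p) \<bullet> (x - p)) * (2 * ((x - p) \<bullet> b))"
    and "x \<in> S \<Longrightarrow> vlaplacian (\<lambda>y. k ((y - p) \<bullet> (y - p))) x
      = 4 * ((x - p) \<bullet> (x - p)) * k2 ((x - p) \<bullet> (x - p)) + 2 * real DIM('a) * k1 ((x - p) \<bullet> (x - p))"
proof -
  let ?q = "\<lambda>y. (y - p) \<bullet> (y - p)"
  show S: "open S" unfolding S_def
    using open_vimage[OF assms(1), of ?q] by (simp add: vimage_def continuous_intros)
  have q: "(?q has_derivative (\<lambda>h. 2 * ((y - p) \<bullet> h))) (at y)" for y
    by (auto intro!: derivative_eq_intros simp: inner_commute)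
  have D1: "((\<lambda>y. k (?q y)) has_derivative (\<lambda>h. k1 (?q y) * (2 * ((y - p) \<bullet> h)))) (at y)" if "y \<in> S" for y
    using has_derivative_compose[OF q, of k "\<lambda>h. k1 (?q y) * h"] k1[of "?q y"] that
    by (auto simp: S_def has_field_derivative_def)
  have D2': "((\<lambda>y. k1 (?q y)) has_derivative (\<lambda>h. k2 (?q y) * (2 * ((y - p) \<bullet> h)))) (at y)" if "y \<in> S" for y
    using has_derivative_compose[OF q, of k1 "\<lambda>h. k2 (?q y) * h"] k2[of "?q y"] that
    by (auto simp: S_def has_field_derivative_def)
  have D2: "((\<lambda>y. k1 (?q y) * (2 * ((y - p) \<bullet> b))) has_derivative
    (\<lambda>h. k1 (?q y) * (2 * (h \<bullet> b)) + k2 (?q y) * (2 * ((y - p) \<bullet> h)) * (2 * ((y - p) \<bullet> b)))) (at y)"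
    if "y \<in> S" for y b
    by (rule has_derivative_mult[OF D2'[OF that]]) (auto intro!: derivative_eq_intros)
  have ck: "continuous_on S (\<lambda>y. k2 (?q y))"
    by (rule continuous_on_compose2[OF cont]) (auto intro!: continuous_intros simp: S_def)
  have ck1: "continuous_on S (\<lambda>y. k1 (?q y))"
    using D2' by (meson continuous_at_imp_continuous_on has_derivative_continuous)
  show "C_k_on 2 S (\<lambda>y. k (?q y))" unfolding numeral_2_eq_2
    by (intro C_k_on_SucI[OF S D1] C_k_on_SucI[OF S D2])
       (auto intro!: continuous_intros ck ck1)
  show "partial_deriv b (\<lambda>y. k (?q y)) x = k1 (?q x) * (2 * ((x - p) \<bullet> b))" if "x \<in> S"
    using partial_deriv_eq[OF D1[OF that]] by simp
  assume x: "x \<in> S"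
  have "vlaplacian (\<lambda>y. k (?q y)) x =
    (\<Sum>b\<in>Basis. k1 (?q x) * (2 * (b \<bullet> b)) + k2 (?q x) * (2 * ((x - p) \<bullet> b)) * (2 * ((x - p) \<bullet> b)))"
    by (rule vlaplacian_eqI[OF S x D1 D2[OF x]])
  also have "\<dots> = (\<Sum>b\<in>(Basis::'a set). k1 (?q x) * 2) + 4 * k2 (?q x) * (\<Sum>b\<in>Basis. ((x - p) \<bullet> b) * ((x - p) \<bullet> b))"
    unfolding sum_distrib_left sum.distrib[symmetric] by (intro sum.cong) auto
  also have "(\<Sum>b\<in>Basis. ((x - p) \<bullet> b) * ((x - p) \<bullet> b)) = ?q x"
    by (rule euclidean_inner[symmetric])
  finally show "vlaplacian (\<lambda>y. k (?q y)) x = 4 * ?q x * k2 (?q x) + 2 * real DIM('a) * k1 (?q x)"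
    by simp
qed

text \<open>Second derivative test on each coordinate line separately: if the first derivative
  vanishes at x and the second is positive, the function increases just to the right of x, against
  maximality.\<close>

lemma vlaplacian_nonpos_at_max:
  fixes g :: "'a::euclidean_space \<Rightarrow> real"
  assumes S: "open S" "x \<in> S" and C: "C_k_on 2 S g" and max: "\<And>y. y \<in> S \<Longrightarrow> g y \<le> g x"
  shows "vlaplacian g x \<le> 0"
  unfolding vlaplacian_def
proof (rule sum_nonpos, rule ccontr)
  fix b :: 'a assume b: "b \<in> Basis" and neg: "\<not> partial_deriv b (partial_deriv b g) x \<le> 0"
  obtain r where r: "r > 0" "ball x r \<subseteq> S" using S openE by blast
  have in_S: "x + t *\<^sub>R b \<in> S" if "\<bar>t\<bar> < r" for t
    using r that b by (intro subsetD[OF r(2)]) (simp add: dist_norm)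
  have dg: "((\<lambda>t. g (x + t *\<^sub>R b)) has_real_derivative partial_deriv b g (x + t *\<^sub>R b)) (at t)"
    if "\<bar>t\<bar> < r" for t
    using has_vector_derivative_line[of g x t b] C in_S[OF that]
    by (simp add: numeral_2_eq_2 has_real_derivative_iff_has_vector_derivative)
  have ddg: "((\<lambda>t. partial_deriv b g (x + t *\<^sub>R b)) has_real_derivative partial_deriv b (partial_deriv b g) x) (at 0)"
    using has_vector_derivative_line[of "partial_deriv b g" x 0 b] C S b
    by (simp add: numeral_2_eq_2 has_real_derivative_iff_has_vector_derivative)
  have "partial_deriv b g (x + 0 *\<^sub>R b) = 0"
    by (rule DERIV_local_max[OF dg[of 0] r(1)]) (use r max in_S in auto)
  with DERIV_pos_inc_right[OF ddg] neg obtain d where d: "d > 0"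
    "\<And>h. 0 < h \<Longrightarrow> h < d \<Longrightarrow> partial_deriv b g (x + h *\<^sub>R b) > 0" by auto
  define h where "h = min d r / 2"
  have h: "0 < h" "h < d" "h < r" using d r by (auto simp: h_def min_def)
  obtain z where z: "0 < z" "z < h" "g (x + h *\<^sub>R b) - g (x + 0 *\<^sub>R b) = (h - 0) * partial_deriv b g (x + z *\<^sub>R b)"
    using MVT2[OF h(1), of "\<lambda>t. g (x + t *\<^sub>R b)" "\<lambda>t. partial_deriv b g (x + t *\<^sub>R b)"] dg h by auto
  have "g (x + h *\<^sub>R b) > g x" using z d(2)[of z] h by (simp add: algebra_simps)
  with max[OF in_S[of h]] h show False by simp
qed

section \<open>Integration by parts\<close>

lemma integral_lborel_translate:
  fixes f :: "'a::euclidean_space \<Rightarrow> 'b::{banach, second_countable_topology}"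
  assumes "f \<in> borel_measurable borel"
  shows "(LBINT y. f (c + y)) = integral\<^sup>L lborel f"
  using integral_distr[of "(+) c" lborel borel f] assms by (simp add: lborel_distr_plus)

lemma integrable_lborel_translate:
  fixes f :: "'a::euclidean_space \<Rightarrow> 'b::{banach, second_countable_topology}"
  assumes "integrable lborel f"
  shows "integrable lborel (\<lambda>y. f (c + y))"
  using integrable_distr_eq[of "(+) c" lborel borel f] assms borel_measurable_integrable[OF assms]
  by (simp add: lborel_distr_plus)

lemma integrable_compact_support:
  fixes f :: "'a::euclidean_space \<Rightarrow> 'b::euclidean_space"
  assumes "continuous_on UNIV f" "compact Q" "\<And>y. y \<notin> Q \<Longrightarrow> f y = 0"
  shows "integrable lborel f"
proof -
  have "integrable lborel (\<lambda>x. indicator Q x *\<^sub>R f x)"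
    using assms continuous_on_subset[OF assms(1)] by (intro borel_integrable_compact) auto
  moreover have "indicator Q x *\<^sub>R f x = f x" for x using assms(3) by (auto simp: indicator_def)
  ultimately show ?thesis by simp
qed

lemma bounded_compact_support:
  fixes f :: "'a::euclidean_space \<Rightarrow> 'b::real_normed_vector"
  assumes "continuous_on UNIV f" "compact Q" "\<And>y. y \<notin> Q \<Longrightarrow> f y = 0"
  obtains B where "B \<ge> 0" "\<And>y. norm (f y) \<le> B"
proof -
  have "bounded (f ` Q)"
    using assms by (intro compact_imp_bounded compact_continuous_image) (auto intro: continuous_on_subset)
  then obtain B where B: "\<And>y. y \<in> Q \<Longrightarrow> norm (f y) \<le> B" "B > 0" by (auto simp: bounded_pos)
  then have "norm (f y) \<le> B" for y using assms(3)[of y] by (cases "y \<in> Q") auto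
  with B(2) that[of B] show thesis by auto
qed

lemma norm_line_diff_le:
  fixes h :: "'a::euclidean_space \<Rightarrow> 'b::euclidean_space"
  assumes "\<And>s. 0 \<le> s \<Longrightarrow> s \<le> t \<Longrightarrow> h differentiable (at (y + s *\<^sub>R b))"
    and "\<And>s. 0 \<le> s \<Longrightarrow> s \<le> t \<Longrightarrow> norm (partial_deriv b h (y + s *\<^sub>R b)) \<le> B" and "t \<ge> 0"
  shows "norm (h (y + t *\<^sub>R b) - h y) \<le> B * t"
proof (cases "t = 0")
  case False
  have d: "((\<lambda>s. h (y + s *\<^sub>R b)) has_vector_derivative partial_deriv b h (y + s *\<^sub>R b)) (at s)"
    if "0 \<le> s" "s \<le> t" for s
    by (intro has_vector_derivative_line assms that)
  have "norm (h (y + t *\<^sub>R b) - h (y + 0 *\<^sub>R b)) \<le> B * t - B * 0"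
  proof (rule differentiable_bound_general[where f' = "\<lambda>s. partial_deriv b h (y + s *\<^sub>R b)" and \<phi>' = "\<lambda>s. B"])
    show "0 < t" using False assms by simp
    show "continuous_on {0..t} (\<lambda>s. h (y + s *\<^sub>R b))"
      using d by (auto intro!: continuous_at_imp_continuous_on has_vector_derivative_continuous)
    show "((\<lambda>t. B * t) has_vector_derivative B) (at x)" for x
      by (auto intro!: derivative_eq_intros simp: has_real_derivative_iff_has_vector_derivative[symmetric])
  qed (use d assms in \<open>auto intro!: continuous_intros\<close>)
  then show ?thesis by simp
qed simp

lemma difference_quotient_tendsto:
  fixes h :: "'a::euclidean_space \<Rightarrow> 'b::real_normed_vector"
  assumes "h differentiable (at y)"
  shows "(\<lambda>n. real (Suc n) *\<^sub>R (h (y + (1 / real (Suc n)) *\<^sub>R b) - h y)) \<longlonglongrightarrow> partial_deriv b h y"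
proof -
  have "((\<lambda>t. h (y + t *\<^sub>R b)) has_vector_derivative partial_deriv b h y) (at 0)"
    using has_vector_derivative_line[of h y 0 b] assms by simp
  then have D: "((\<lambda>t. h (y + t *\<^sub>R b)) has_derivative (\<lambda>t. t *\<^sub>R partial_deriv b h y)) (at 0)"
    by (simp only: has_vector_derivative_def)
  have L: "(\<lambda>t. norm (h (y + t *\<^sub>R b) - h y - t *\<^sub>R partial_deriv b h y) / norm t) \<midarrow>0\<rightarrow> 0"
    using conjunct2[OF D[unfolded has_derivative_at]] by simp
  have S: "filterlim (\<lambda>n. 1 / real (Suc n)) (at 0) sequentially"
    using LIMSEQ_inverse_real_of_nat unfolding filterlim_at by (simp add: inverse_eq_divide)
  have *: "(\<lambda>n. norm (h (y + (1 / real (Suc n)) *\<^sub>R b) - h y - (1 / real (Suc n)) *\<^sub>R partial_deriv b h y)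
      / norm (1 / real (Suc n))) \<longlonglongrightarrow> 0"
    by (rule filterlim_compose[OF L S])
  have eq: "norm (z - (1 / real (Suc n)) *\<^sub>R w) / norm (1 / real (Suc n)) = norm (real (Suc n) *\<^sub>R z - w)"
    for n and z w :: 'b
  proof -
    define k where "k = real (Suc n)"
    have k: "k > 0" by (simp add: k_def)
    have "norm (k *\<^sub>R z - w) = norm (k *\<^sub>R (z - (1 / k) *\<^sub>R w))"
      using k by (simp add: scaleR_diff_right)
    also have "\<dots> = norm (z - (1 / k) *\<^sub>R w) / norm (1 / k)"
      using k by simp
    finally show ?thesis by (simp add: k_def)
  qed
  show ?thesis
    using * unfolding eq by (rule LIM_zero_cancel[OF tendsto_norm_zero_cancel])
qed

lemma partial_deriv_outside:
  assumes "closed Q" "\<And>y. y \<notin> Q \<Longrightarrow> h y = 0" "y \<notin> Q"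
  shows "partial_deriv b h y = 0"
  using partial_deriv_cong[of "- Q" y h "\<lambda>y. 0" b] assms
  by (auto simp: open_Compl partial_deriv_eq[OF has_derivative_const])

text \<open>Translation invariance: a difference quotient of an integrable function has integral 0,
  and dominated convergence carries this over to the derivative, without iterated integrals.\<close>

lemma integral_partial_deriv_eq_0:
  fixes h :: "'a::euclidean_space \<Rightarrow> 'b::euclidean_space"
  assumes diff: "\<And>y. h differentiable (at y)" and cont: "continuous_on UNIV (partial_deriv b h)"
    and Q: "compact Q" "\<And>y. y \<notin> Q \<Longrightarrow> h y = 0" and b: "b \<in> Basis"
  shows "integral\<^sup>L lborel (partial_deriv b h) = 0"
proof -
  have h'0: "partial_deriv b h y = 0" if "y \<notin> Q" for y
    by (rule partial_deriv_outside) (use Q that compact_imp_closed in auto)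
  have hc: "continuous_on UNIV h"
    using diff by (simp add: continuous_at_imp_continuous_on differentiable_imp_continuous_within)
  obtain B where B: "B \<ge> 0" "\<And>y. norm (partial_deriv b h y) \<le> B"
    using bounded_compact_support[OF cont Q(1) h'0] by blast
  obtain R where R: "R > 0" "\<And>y. y \<in> Q \<Longrightarrow> norm y \<le> R"
    using compact_imp_bounded[OF Q(1)] by (auto simp: bounded_pos)
  define F where "F n y = real (Suc n) *\<^sub>R (h (y + (1 / real (Suc n)) *\<^sub>R b) - h y)" for n y
  have ih: "integrable lborel h" by (rule integrable_compact_support[OF hc Q])
  have hm: "h \<in> borel_measurable borel" using hc by (rule borel_measurable_continuous_onI)
  have iF: "integral\<^sup>L lborel (F n) = 0" for n
    using integrable_lborel_translate[OF ih, of "(1 / real (Suc n)) *\<^sub>R b"] ih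
      integral_lborel_translate[OF hm, of "(1 / real (Suc n)) *\<^sub>R b"]
    unfolding F_def by (simp add: add.commute[of _ "(1 / _) *\<^sub>R b"])
  have "(\<lambda>n. integral\<^sup>L lborel (F n)) \<longlonglongrightarrow> integral\<^sup>L lborel (partial_deriv b h)"
  \<comment> \<open>The steps are at most 1, so all quotients live in the ball of radius
    \<open>R + 1\<close>, where the mean value inequality bounds them by \<open>B\<close>.\<close>
  proof (rule integral_dominated_convergence[where w = "\<lambda>y. indicator (cball 0 (R + 1)) y *\<^sub>R B"])
    show "partial_deriv b h \<in> borel_measurable lborel"
      using cont by (simp add: borel_measurable_continuous_onI)
    show "F n \<in> borel_measurable lborel" for n
    proof -
      have "continuous_on UNIV (\<lambda>y. h (y + (1 / real (Suc n)) *\<^sub>R b))"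
        by (rule continuous_on_compose2[OF hc]) (auto intro!: continuous_intros)
      then have "continuous_on UNIV (F n)"
        unfolding F_def by (intro continuous_intros hc)
      then show ?thesis by (simp add: borel_measurable_continuous_onI)
    qed
    show "integrable lborel (\<lambda>y. indicator (cball 0 (R + 1)) y *\<^sub>R B)"
      by (intro borel_integrable_compact) auto
    show "AE y in lborel. (\<lambda>n. F n y) \<longlonglongrightarrow> partial_deriv b h y"
      unfolding F_def using difference_quotient_tendsto[OF diff] by auto
    show "AE y in lborel. norm (F n y) \<le> indicator (cball 0 (R + 1)) y *\<^sub>R B" for n
    proof (rule AE_I2)
      fix y :: 'a
      let ?t = "1 / real (Suc n)"
      have le: "norm (F n y) \<le> B"
      proof -
        have "norm (h (y + ?t *\<^sub>R b) - h y) \<le> B * ?t"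
          by (rule norm_line_diff_le) (use diff B in auto)
        then have "real (Suc n) * norm (h (y + ?t *\<^sub>R b) - h y) \<le> real (Suc n) * (B * ?t)"
          by (intro mult_left_mono) auto
        then show ?thesis unfolding F_def by (simp del: of_nat_Suc)
      qed
      show "norm (F n y) \<le> indicator (cball 0 (R + 1)) y *\<^sub>R B"
      proof (cases "y \<in> cball 0 (R + 1)")
        case False
        then have n: "norm y > R + 1" by simp
        have "norm (?t *\<^sub>R b) \<le> 1" using b by simp
        moreover have "norm y \<le> norm (y + ?t *\<^sub>R b) + norm (?t *\<^sub>R b)"
          using norm_triangle_ineq4[of "y + ?t *\<^sub>R b" "?t *\<^sub>R b"] by (simp only: add_diff_cancel_right')
        ultimately have "norm (y + ?t *\<^sub>R b) > R" using n by linarith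
        then have "y \<notin> Q" "y + ?t *\<^sub>R b \<notin> Q" using R n by fastforce+
        then show ?thesis using Q B False by (simp add: F_def)
      qed (use le in simp)
    qed
  qed
  then show ?thesis unfolding iF by (simp add: LIMSEQ_const_iff)
qed

text \<open>Both integrations by parts are done at once: g D_b u - (D_b g) u has b-derivative g D_b
  D_b u - (D_b D_b g) u, as the mixed terms cancel, and it has compact support, so the integral of
  this derivative vanishes.\<close>

lemma integral_by_parts_vlaplacian:
  fixes u :: "'a::euclidean_space \<Rightarrow> 'b::euclidean_space" and g :: "'a \<Rightarrow> real"
  assumes S: "open S" and u: "C_k_on 2 S u" and g: "C_k_on 2 UNIV g"
    and Q: "compact Q" "Q \<subseteq> S" "\<And>y. y \<notin> Q \<Longrightarrow> g y = 0"
  shows "(LBINT y. g y *\<^sub>R vlaplacian u y) = (LBINT y. vlaplacian g y *\<^sub>R u y)"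
proof -
  have cQ: "closed Q" using Q compact_imp_closed by blast
  have g1: "partial_deriv b g y = 0" if "y \<notin> Q" for y b
    by (rule partial_deriv_outside[OF cQ Q(3) that])
  have g2: "partial_deriv b (partial_deriv b g) y = 0" if "y \<notin> Q" for y b
    by (rule partial_deriv_outside[OF cQ g1 that])
  have u': "continuous_on S u" "b \<in> Basis \<Longrightarrow> continuous_on S (partial_deriv b u)"
    "b \<in> Basis \<Longrightarrow> continuous_on S (partial_deriv b (partial_deriv b u))" for b
    using u C_k_on_imp_continuous_on[OF u] C_k_on_imp_continuous_on[of 1 S "partial_deriv b u"]
    by (auto simp: numeral_2_eq_2)
  have g': "continuous_on UNIV g" "b \<in> Basis \<Longrightarrow> continuous_on UNIV (partial_deriv b g)"
    "b \<in> Basis \<Longrightarrow> continuous_on UNIV (partial_deriv b (partial_deriv b g))" for b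
    using g C_k_on_imp_continuous_on[OF g] C_k_on_imp_continuous_on[of 1 UNIV "partial_deriv b g"]
    by (auto simp: numeral_2_eq_2)
  \<comment> \<open>\<open>v\<close> is uncontrolled off \<open>S\<close>. But \<open>S\<close> and
    the complement of \<open>Q\<close> are open and cover the space, and on the second set the
    product is 0.\<close>
  have glue: "continuous_on UNIV (\<lambda>y. f y *\<^sub>R v y)" if f: "continuous_on UNIV f" "\<And>y. y \<notin> Q \<Longrightarrow> f y = 0"
    and v: "continuous_on S v" for f :: "'a \<Rightarrow> real" and v :: "'a \<Rightarrow> 'b"
  proof -
    have "continuous_on S (\<lambda>y. f y *\<^sub>R v y)"
      by (intro continuous_on_scaleR v continuous_on_subset[OF f(1)]) auto
    moreover have "continuous_on (- Q) (\<lambda>y. f y *\<^sub>R v y)"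
      by (rule continuous_on_eq[of _ "\<lambda>_. 0"]) (use f in auto)
    ultimately have "continuous_on (S \<union> - Q) (\<lambda>y. f y *\<^sub>R v y)"
      using S cQ by (intro continuous_on_open_Un) auto
    moreover have "S \<union> - Q = UNIV" using Q by auto
    ultimately show ?thesis by simp
  qed
  have key: "(LBINT y. g y *\<^sub>R partial_deriv b (partial_deriv b u) y)
      = (LBINT y. partial_deriv b (partial_deriv b g) y *\<^sub>R u y)" 
    and int1: "integrable lborel (\<lambda>y. g y *\<^sub>R partial_deriv b (partial_deriv b u) y)"
    and int2: "integrable lborel (\<lambda>y. partial_deriv b (partial_deriv b g) y *\<^sub>R u y)"
    if b: "b \<in> Basis" for b
  proof -
    define h where "h y = g y *\<^sub>R partial_deriv b u y - partial_deriv b g y *\<^sub>R u y" for y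
    define h' where "h' y = g y *\<^sub>R partial_deriv b (partial_deriv b u) y
       - partial_deriv b (partial_deriv b g) y *\<^sub>R u y" for y
    have hd: "h differentiable (at y) \<and> partial_deriv b h y = h' y" for y
    proof (cases "y \<in> S")
      case True
      have "(h has_derivative (\<lambda>k. (g y *\<^sub>R (\<Sum>c\<in>Basis. (k \<bullet> c) *\<^sub>R partial_deriv c (partial_deriv b u) y)
       + (\<Sum>c\<in>Basis. (k \<bullet> c) *\<^sub>R partial_deriv c g y) *\<^sub>R partial_deriv b u y)
      - (partial_deriv b g y *\<^sub>R (\<Sum>c\<in>Basis. (k \<bullet> c) *\<^sub>R partial_deriv c u y)
       + (\<Sum>c\<in>Basis. (k \<bullet> c) *\<^sub>R partial_deriv c (partial_deriv b g) y) *\<^sub>R u y))) (at y)"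
        unfolding h_def[abs_def]
        by (intro has_derivative_diff has_derivative_scaleR C_2_derivatives(1)[OF u True]
            C_2_derivatives(2)[OF u True b] C_2_derivatives(1)[OF g UNIV_I] C_2_derivatives(2)[OF g UNIV_I b])
      from partial_deriv_eq[OF this, of b] this show ?thesis
        unfolding sum_Basis_partial_deriv[OF b] h'_def differentiable_def by auto
    next
      case False
      have h0: "h y = 0" if "y \<in> - Q" for y using Q(3)[of y] g1[of y] that by (auto simp: h_def)
      have y: "y \<in> - Q" "open (- Q)" using False Q cQ by auto
      have "h differentiable (at y)"
        using differentiable_cong_open[OF y(2,1) h0] by simp
      moreover have "partial_deriv b h y = 0"
        by (rule partial_deriv_outside[OF cQ]) (use h0 y in auto)
      moreover have "h' y = 0" using y Q(3)[of y] g2[of y] by (simp add: h'_def)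
      ultimately show ?thesis by simp
    qed
    show i1: "integrable lborel (\<lambda>y. g y *\<^sub>R partial_deriv b (partial_deriv b u) y)"
      by (rule integrable_compact_support[OF glue[OF g'(1) Q(3) u'(3)[OF b]] Q(1)]) (use Q in auto)
    show i2: "integrable lborel (\<lambda>y. partial_deriv b (partial_deriv b g) y *\<^sub>R u y)"
      by (rule integrable_compact_support[OF glue[OF g'(3)[OF b] g2 u'(1)] Q(1)]) (use g2 in auto)
    have "integral\<^sup>L lborel (partial_deriv b h) = 0"
    proof (rule integral_partial_deriv_eq_0[OF _ _ Q(1) _ b])
      show "continuous_on UNIV (partial_deriv b h)"
        using continuous_on_diff[OF glue[OF g'(1) Q(3) u'(3)[OF b]] glue[OF g'(3)[OF b] g2 u'(1)]] hd
        by (simp add: h'_def)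
      show "h y = 0" if "y \<notin> Q" for y using that Q(3) g1 by (simp add: h_def)
    qed (use hd in blast)
    moreover have "partial_deriv b h = h'" using hd by auto
    ultimately have "integral\<^sup>L lborel h' = 0" by simp
    then show "(LBINT y. g y *\<^sub>R partial_deriv b (partial_deriv b u) y)
      = (LBINT y. partial_deriv b (partial_deriv b g) y *\<^sub>R u y)"
      unfolding h'_def[abs_def] using i1 i2 by simp
  qed
  show ?thesis
    unfolding vlaplacian_def scaleR_sum_left scaleR_sum_right
    using int1 int2 key by (subst (1 2) Bochner_Integration.integral_sum) auto
qed

section \<open>C^2 cutoffs, and integration by parts across a point\<close>

lemma DERIV_max_0_power:
  "((\<lambda>t::real. max 0 t ^ Suc (Suc k)) has_real_derivative real (Suc (Suc k)) * max 0 t ^ Suc k) (at t)"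
proof -
  consider "t < 0" | "t = 0" | "t > 0" by linarith
  then show ?thesis
  proof cases
    case 1
    have "((\<lambda>t::real. 0) has_real_derivative 0) (at t)" by simp
    then have "((\<lambda>t::real. max 0 t ^ Suc (Suc k)) has_real_derivative 0) (at t)"
      by (rule has_field_derivative_transform_within_open[of _ _ _ "{..<0}"]) (use 1 in auto)
    then show ?thesis using 1 by simp
  next
    case 2
    \<comment> \<open>Caratheodory's criterion at the kink t = 0. The slope function is the next
      lower power; it and the claimed derivative are both 0 there.\<close>
    have "\<exists>g. (\<forall>z. max 0 z ^ Suc (Suc k) - max 0 t ^ Suc (Suc k) = g z * (z - t)) \<and> isCont g t
      \<and> g t = real (Suc (Suc k)) * max 0 t ^ Suc k"
      by (rule exI[of _ "\<lambda>z. max 0 z ^ Suc k"]) (use 2 in \<open>auto intro!: continuous_intros\<close>)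
    then show ?thesis by (simp only: CARAT_DERIV)
  next
    case 3
    have "((\<lambda>t::real. t ^ Suc (Suc k)) has_real_derivative real (Suc (Suc k)) * t ^ Suc k) (at t)"
      using DERIV_pow[of "Suc (Suc k)" t] by simp
    then have "((\<lambda>t::real. max 0 t ^ Suc (Suc k)) has_real_derivative real (Suc (Suc k)) * t ^ Suc k) (at t)"
      by (rule has_field_derivative_transform_within_open[of _ _ _ "{0<..}"]) (use 3 in auto)
    then show ?thesis using 3 by simp
  qed
qed

text \<open>The function is 1 - (1 - (t - 1)_+^3)_+^3 with _+ the positive part. Cubes of positive
  parts are C^2, which is all the smoothness that test functions for the Laplacian need.\<close>

lemma cutoff_exists:
  obtains h h1 h2 :: "real \<Rightarrow> real" and E :: real where
    "\<And>t. (h has_real_derivative h1 t) (at t)" "\<And>t. (h1 has_real_derivative h2 t) (at t)"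
    "continuous_on UNIV h2" "\<And>t. t \<le> 1 \<Longrightarrow> h t = 0" "\<And>t. t \<ge> 2 \<Longrightarrow> h t = 1"
    "\<And>t. 0 \<le> h t \<and> h t \<le> 1" "\<And>t. t \<ge> 2 \<Longrightarrow> h1 t = 0 \<and> h2 t = 0"
    "E \<ge> 0" "\<And>t. \<bar>h1 t\<bar> \<le> E" "\<And>t. \<bar>h2 t\<bar> \<le> E"
proof -
  define c where "c k t = max 0 (t::real) ^ k" for k t
  have c3: "(c 3 has_real_derivative 3 * c 2 t) (at t)" for t
    using DERIV_max_0_power[of 1 t] by (simp add: c_def[abs_def] numeral_2_eq_2 numeral_3_eq_3)
  have c2: "(c 2 has_real_derivative 2 * c 1 t) (at t)" for t
    using DERIV_max_0_power[of 0 t] by (simp add: c_def[abs_def] numeral_2_eq_2)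
  have cc: "continuous_on UNIV (\<lambda>t. c k (f t))" if "continuous_on UNIV f" for k and f :: "real \<Rightarrow> real"
    using that unfolding c_def by (intro continuous_intros)
  define h where "h t = 1 - c 3 (1 - c 3 (t - 1))" for t
  define h1 where "h1 t = 9 * (c 2 (1 - c 3 (t - 1)) * c 2 (t - 1))" for t
  define h2 where "h2 t = 9 * (2 * c 1 (1 - c 3 (t - 1)) * (- (3 * c 2 (t - 1))) * c 2 (t - 1)
       + c 2 (1 - c 3 (t - 1)) * (2 * c 1 (t - 1)))" for t
  have sh: "((\<lambda>t. t - 1) has_real_derivative 1) (at t)" for t :: real
    by (auto intro!: derivative_eq_intros)
  have c3': "((\<lambda>t. c 3 (t - 1)) has_real_derivative 3 * c 2 (t - 1)) (at t)" for t
    using DERIV_chain'[OF sh c3] by simp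
  have c2': "((\<lambda>t. c 2 (t - 1)) has_real_derivative 2 * c 1 (t - 1)) (at t)" for t
    using DERIV_chain'[OF sh c2] by simp
  have i: "((\<lambda>t. 1 - c 3 (t - 1)) has_real_derivative - (3 * c 2 (t - 1))) (at t)" for t
    by (auto intro!: derivative_eq_intros c3')
  have d1: "(h has_real_derivative h1 t) (at t)" for t
    using DERIV_diff[OF DERIV_const[of 1] DERIV_chain'[OF i c3]] unfolding h_def[abs_def] h1_def
    by (simp add: algebra_simps)
  have d2: "(h1 has_real_derivative h2 t) (at t)" for t
    unfolding h1_def[abs_def] h2_def
    by (rule DERIV_cong[OF DERIV_cmult[OF DERIV_mult[OF DERIV_chain'[OF i c2] c2']]])
       (simp add: algebra_simps)
  have ch2: "continuous_on UNIV h2" unfolding h2_def[abs_def] by (intro continuous_intros cc)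
  have ch1: "continuous_on UNIV h1" unfolding h1_def[abs_def] by (intro continuous_intros cc)
  have lo: "c 3 (t - 1) = 0" "c 2 (t - 1) = 0" "c 1 (t - 1) = 0" if "t \<le> 1" for t
    using that by (auto simp: c_def)
  have hi: "1 - c 3 (t - 1) \<le> 0" if "t \<ge> 2" for t
    using that one_le_power[of "t - 1" 3] by (simp add: c_def)
  have hi': "c 3 (1 - c 3 (t - 1)) = 0" "c 2 (1 - c 3 (t - 1)) = 0" "c 1 (1 - c 3 (t - 1)) = 0"
    if "t \<ge> 2" for t
    using hi[OF that] by (simp_all add: c_def)
  have h0: "h t = 0" "h1 t = 0" "h2 t = 0" if "t \<le> 1" for t
    using lo[OF that] by (simp_all add: h_def h1_def h2_def) (simp add: c_def)
  have h1': "h t = 1" "h1 t = 0" "h2 t = 0" if "t \<ge> 2" for t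
    using hi'[OF that] by (simp_all add: h_def h1_def h2_def)
  have out: "h1 t = 0" "h2 t = 0" if "t \<notin> {1..2}" for t
    using that h0[of t] h1'[of t] by (cases "t \<le> 1"; simp)+
  obtain E1 where E1: "E1 \<ge> 0" "\<And>t. \<bar>h1 t\<bar> \<le> E1"
    using bounded_compact_support[OF ch1 compact_Icc out(1)] by auto
  obtain E2 where E2: "E2 \<ge> 0" "\<And>t. \<bar>h2 t\<bar> \<le> E2"
    using bounded_compact_support[OF ch2 compact_Icc out(2)] by auto
  show thesis
  proof (rule that[of h h1 h2 "max E1 E2"])
    show "0 \<le> h t \<and> h t \<le> 1" for t
    proof -
      have "0 \<le> c 3 (t - 1)" by (simp add: c_def)
      then have "max 0 (1 - c 3 (t - 1)) \<le> 1" by simp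
      then have "c 3 (1 - c 3 (t - 1)) \<le> 1" unfolding c_def[of 3 "1 - _"] by (intro power_le_one) auto
      moreover have "0 \<le> c 3 (1 - c 3 (t - 1))" by (simp add: c_def)
      ultimately show ?thesis by (simp add: h_def)
    qed
  qed (use d1 d2 ch2 h0 h1' E1 E2 in \<open>auto intro: max.coboundedI1 max.coboundedI2\<close>)
qed

lemma norm_integral_le:
  fixes f :: "'c \<Rightarrow> 'd::{banach, second_countable_topology}"
  assumes "integrable M f" "integrable M g" "\<And>x. norm (f x) \<le> g x"
  shows "norm (integral\<^sup>L M f) \<le> integral\<^sup>L M g"
  using integral_norm_bound[of M f] integral_mono[OF integrable_norm[OF assms(1)] assms(2,3)] by linarith

text \<open>The test function g is multiplied by a cutoff e_n that vanishes within distance r_n of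
  p. All derivatives fall on e_n g, so bounds on u and on its Laplacian suffice, with none on the
  gradient of u. The terms with derivatives of e_n are O(r_n^(-2)) on a ball of volume O(r_n^n),
  hence vanish in the limit for n >= 3.\<close>

lemma integral_by_parts_vlaplacian_punctured:
  fixes u :: "'a::euclidean_space \<Rightarrow> 'b::euclidean_space" and g :: "'a \<Rightarrow> real"
  assumes dim: "DIM('a) \<ge> 3"
    and S: "open S" and u: "C_k_on 2 (S - {p}) u" and g: "C_k_on 2 UNIV g"
    and Q: "compact Q" "Q \<subseteq> S" "\<And>y. y \<notin> Q \<Longrightarrow> g y = 0"
    and M: "\<And>y. y \<in> Q - {p} \<Longrightarrow> norm (u y) \<le> M" "\<And>y. y \<in> Q - {p} \<Longrightarrow> norm (vlaplacian u y) \<le> M"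
  shows "(LBINT y. g y *\<^sub>R (indicator (S - {p}) y *\<^sub>R vlaplacian u y))
    = (LBINT y. vlaplacian g y *\<^sub>R (indicator (S - {p}) y *\<^sub>R u y))"
proof -
  obtain h h1 h2 :: "real \<Rightarrow> real" and E :: real where
    h: "\<And>t. (h has_real_derivative h1 t) (at t)" "\<And>t. (h1 has_real_derivative h2 t) (at t)"
    "continuous_on UNIV h2" "\<And>t. t \<le> 1 \<Longrightarrow> h t = 0" "\<And>t. t \<ge> 2 \<Longrightarrow> h t = 1"
    "\<And>t. 0 \<le> h t \<and> h t \<le> 1" "\<And>t. t \<ge> 2 \<Longrightarrow> h1 t = 0 \<and> h2 t = 0"
    and E: "E \<ge> 0" "\<And>t. \<bar>h1 t\<bar> \<le> E" "\<And>t. \<bar>h2 t\<bar> \<le> E"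
    using cutoff_exists by blast
  have cQ: "closed Q" using Q compact_imp_closed by blast
  have S': "open (S - {p})" using S by auto
  have g1: "partial_deriv b g y = 0" if "y \<notin> Q" for y b
    by (rule partial_deriv_outside[OF cQ Q(3) that])
  have g2: "vlaplacian g y = 0" if "y \<notin> Q" for y
    unfolding vlaplacian_def using partial_deriv_outside[OF cQ g1 that] by simp
  have gc: "continuous_on UNIV g" "continuous_on UNIV (vlaplacian g)"
    "b \<in> Basis \<Longrightarrow> continuous_on UNIV (partial_deriv b g)" for b
    using C_k_on_imp_continuous_on[OF g] vlaplacian_continuous_on[OF g] g
      C_k_on_imp_continuous_on[of 1 UNIV "partial_deriv b g"] by (auto simp: numeral_2_eq_2)
  obtain G0 where G0: "G0 \<ge> 0" "\<And>y. \<bar>g y\<bar> \<le> G0"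
    using bounded_compact_support[OF gc(1) Q(1,3)] by auto
  obtain G2 where G2: "G2 \<ge> 0" "\<And>y. \<bar>vlaplacian g y\<bar> \<le> G2"
    using bounded_compact_support[OF gc(2) Q(1) g2] by auto
  have "\<exists>G. \<forall>y. \<bar>partial_deriv b g y\<bar> \<le> G" if "b \<in> Basis" for b
    using bounded_compact_support[OF gc(3)[OF that] Q(1) g1] by (metis real_norm_def)
  then obtain GG where GG: "\<And>b y. b \<in> Basis \<Longrightarrow> \<bar>partial_deriv b g y\<bar> \<le> GG b" by metis
  define G1 where "G1 = (\<Sum>b\<in>Basis. \<bar>GG b\<bar>)"
  have G1: "\<bar>partial_deriv b g y\<bar> \<le> G1" "G1 \<ge> 0" if "b \<in> Basis" for b y
  proof -
    have "\<bar>GG b\<bar> \<le> G1" unfolding G1_def using that by (intro member_le_sum) auto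
    then show "\<bar>partial_deriv b g y\<bar> \<le> G1" using GG[OF that, of y] by linarith
  qed (simp add: G1_def sum_nonneg)
  have G1': "G1 \<ge> 0" by (simp add: G1_def sum_nonneg)
  define N where "N = real DIM('a)"
  define r where "r n = 1 / real (Suc n)" for n
  have r: "r n > 0" "r n \<le> 1" for n by (auto simp: r_def)
  have r0: "r \<longlonglongrightarrow> 0" unfolding r_def using LIMSEQ_inverse_real_of_nat by (simp add: inverse_eq_divide)
  define q where "q y = (y - p) \<bullet> (y - p)" for y :: 'a
  define e where "e n y = h (q y / (r n)\<^sup>2)" for n y
  have e_C: "C_k_on 2 UNIV (e n)"
    and e_1: "partial_deriv b (e n) y = h1 (q y / (r n)\<^sup>2) / (r n)\<^sup>2 * (2 * ((y - p) \<bullet> b))"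
    and e_2: "vlaplacian (e n) y = 4 * q y * (h2 (q y / (r n)\<^sup>2) / (r n)^4) + 2 * N * (h1 (q y / (r n)\<^sup>2) / (r n)\<^sup>2)"
    for n b y
  proof -
    have sc: "((\<lambda>s. s / (r n)\<^sup>2) has_real_derivative 1 / (r n)\<^sup>2) (at s)" for s
      by (rule DERIV_cdivide[OF DERIV_ident])
    have k1: "((\<lambda>s. h (s / (r n)\<^sup>2)) has_real_derivative h1 (s / (r n)\<^sup>2) / (r n)\<^sup>2) (at s)" for s
      using DERIV_chain'[OF sc h(1)] by simp
    have k2: "((\<lambda>s. h1 (s / (r n)\<^sup>2) / (r n)\<^sup>2) has_real_derivative h2 (s / (r n)\<^sup>2) / (r n)^4) (at s)" for s
    proof -
      have "((\<lambda>s. h1 (s / (r n)\<^sup>2)) has_real_derivative h2 (s / (r n)\<^sup>2) * (1 / (r n)\<^sup>2)) (at s)"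
        using DERIV_chain'[OF sc h(2)] by simp
      from DERIV_cdivide[OF this, of "(r n)\<^sup>2"] show ?thesis
        by (simp add: power2_eq_square power4_eq_xxxx mult.assoc)
    qed
    have k3: "continuous_on UNIV (\<lambda>s. h2 (s / (r n)\<^sup>2) / (r n)^4)"
      using r[of n] by (intro continuous_intros continuous_on_compose2[OF h(3)]) auto
    show "C_k_on 2 UNIV (e n)"
      using radial_derivatives(2)[of UNIV _ _ _ p, OF _ k1 k2 k3] by (simp add: e_def[abs_def] q_def)
    show "partial_deriv b (e n) y = h1 (q y / (r n)\<^sup>2) / (r n)\<^sup>2 * (2 * ((y - p) \<bullet> b))"
      using radial_derivatives(3)[of UNIV _ _ _ y p, OF _ k1 k2 k3] by (simp add: e_def[abs_def] q_def)
    show "vlaplacian (e n) y = 4 * q y * (h2 (q y / (r n)\<^sup>2) / (r n)^4) + 2 * N * (h1 (q y / (r n)\<^sup>2) / (r n)\<^sup>2)"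
      using radial_derivatives(4)[of UNIV _ _ _ y p, OF _ k1 k2 k3] by (simp add: e_def[abs_def] q_def N_def)
  qed
  have e01: "\<bar>e n y\<bar> \<le> 1" for n y using h(6)[of "q y / (r n)\<^sup>2"] by (simp add: e_def)
  have e_lim: "(\<lambda>n. e n y) \<longlonglongrightarrow> 1" if "y \<noteq> p" for y
  proof -
    have q: "q y > 0" using that by (simp add: q_def)
    have "(\<lambda>n. 2 * (r n)\<^sup>2) \<longlonglongrightarrow> 2 * 0\<^sup>2" by (intro tendsto_intros r0)
    then have "\<forall>\<^sub>F n in sequentially. 2 * (r n)\<^sup>2 < q y"
      by (rule order_tendstoD) (use q in simp)
    then have "\<forall>\<^sub>F n in sequentially. e n y = 1"
    proof eventually_elim
      case (elim n)
      have "(r n)\<^sup>2 > 0" using r(1)[of n] by simp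
      then have "q y / (r n)\<^sup>2 \<ge> 2" using elim by (simp add: le_divide_eq)
      then show ?case by (simp add: e_def h(5))
    qed
    then show ?thesis by (rule tendsto_eventually)
  qed
  have far: "partial_deriv b (e n) y = 0" "vlaplacian (e n) y = 0" if "y \<notin> cball p (2 * r n)" for n b y
  proof -
    have "norm (y - p) \<ge> 2 * r n" using that by (simp add: dist_norm norm_minus_commute)
    then have "(norm (y - p))\<^sup>2 \<ge> (2 * r n)\<^sup>2" using r[of n] by (intro power_mono) auto
    moreover have "(r n)\<^sup>2 > 0" using r[of n] by simp
    moreover have "(2 * r n)\<^sup>2 = 4 * (r n)\<^sup>2" by (simp add: power_mult_distrib)
    ultimately have "2 * (r n)\<^sup>2 \<le> q y"
      unfolding q_def power2_norm_eq_inner[symmetric] by linarith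
    then have "q y / (r n)\<^sup>2 \<ge> 2" using r(1)[of n] by (simp add: le_divide_eq)
    then show "partial_deriv b (e n) y = 0" "vlaplacian (e n) y = 0" unfolding e_1 e_2 using h(7) by auto
  qed
  \<comment> \<open>The factor 4 E comes from the gradient of the cutoff, with |y - p| crudely
    estimated by 2; the summands 16 E and 2 N E come from its Laplacian, with |y - p|^2 at most 4
    r^2.\<close>
  define K where "K = 2 * (N * (4 * E * G1)) + (16 + 2 * N) * E * G0"
  have K: "K \<ge> 0" using E G1' G0 by (auto simp: K_def N_def intro!: add_nonneg_nonneg mult_nonneg_nonneg)
  define rest where "rest n y = (2::real) *\<^sub>R (\<Sum>b\<in>Basis. partial_deriv b (e n) y *\<^sub>R partial_deriv b g y)
     + vlaplacian (e n) y *\<^sub>R g y" for n y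
  have rest: "\<bar>rest n y\<bar> \<le> indicator (cball p (2 * r n)) y * (K / (r n)\<^sup>2)" for n y
  proof (cases "y \<in> cball p (2 * r n)")
    case False
    then show ?thesis using far by (simp add: rest_def)
  next
    case True
    let ?r = "r n"
    have rr: "?r > 0" "?r \<le> 1" using r by auto
    have ny: "norm (y - p) \<le> 2 * ?r" using True by (simp add: dist_norm norm_minus_commute)
    have "(norm (y - p))\<^sup>2 \<le> (2 * ?r)\<^sup>2" using ny by (intro power_mono) auto
    then have qy: "q y \<le> 4 * ?r\<^sup>2" "q y \<ge> 0" unfolding q_def power2_norm_eq_inner[symmetric]
      by (auto simp: power_mult_distrib)
    have p1: "\<bar>partial_deriv b (e n) y\<bar> \<le> 4 * E / ?r\<^sup>2" if b: "b \<in> Basis" for b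
    proof -
      have "\<bar>(y - p) \<bullet> b\<bar> \<le> 2" using Basis_le_norm[OF b, of "y - p"] ny rr by linarith
      then have "\<bar>h1 (q y / ?r\<^sup>2)\<bar> * \<bar>2 * ((y - p) \<bullet> b)\<bar> \<le> E * 4"
        using E by (intro mult_mono) auto
      then show ?thesis unfolding e_1 using rr
        by (simp add: abs_mult abs_divide divide_right_mono mult.commute)
    qed
    have "\<bar>\<Sum>b\<in>Basis. partial_deriv b (e n) y *\<^sub>R partial_deriv b g y\<bar> \<le> (\<Sum>b\<in>(Basis::'a set). 4 * E / ?r\<^sup>2 * G1)"
    proof (rule order_trans[OF sum_abs sum_mono])
      fix b :: 'a assume b: "b \<in> Basis"
      show "\<bar>partial_deriv b (e n) y *\<^sub>R partial_deriv b g y\<bar> \<le> 4 * E / ?r\<^sup>2 * G1"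
        unfolding real_scaleR_def abs_mult using p1[OF b] G1(1)[OF b] E by (intro mult_mono) auto
    qed
    then have A: "\<bar>\<Sum>b\<in>Basis. partial_deriv b (e n) y *\<^sub>R partial_deriv b g y\<bar> \<le> N * (4 * E / ?r\<^sup>2 * G1)"
      by (simp add: N_def)
    have "4 * q y * (\<bar>h2 (q y / ?r\<^sup>2)\<bar> / ?r^4) \<le> 4 * (4 * ?r\<^sup>2) * (E / ?r^4)"
      using qy E rr by (intro mult_mono divide_right_mono) auto
    also have "\<dots> = 16 * E / ?r\<^sup>2" using rr by (simp add: power2_eq_square power4_eq_xxxx field_simps)
    finally have B1: "\<bar>4 * q y * (h2 (q y / ?r\<^sup>2) / ?r^4)\<bar> \<le> 16 * E / ?r\<^sup>2"
      using qy by (simp add: abs_mult abs_divide)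
    have B2: "\<bar>2 * N * (h1 (q y / ?r\<^sup>2) / ?r\<^sup>2)\<bar> \<le> 2 * N * (E / ?r\<^sup>2)"
      using E by (auto simp: abs_mult abs_divide N_def intro!: mult_left_mono divide_right_mono)
    have "\<bar>vlaplacian (e n) y\<bar> \<le> 16 * E / ?r\<^sup>2 + 2 * N * (E / ?r\<^sup>2)"
      unfolding e_2 using B1 B2 by linarith
    then have "\<bar>vlaplacian (e n) y\<bar> * \<bar>g y\<bar> \<le> (16 * E / ?r\<^sup>2 + 2 * N * (E / ?r\<^sup>2)) * G0"
      using G0 E by (intro mult_mono) (auto simp: N_def)
    then have B: "\<bar>vlaplacian (e n) y *\<^sub>R g y\<bar> \<le> (16 * E / ?r\<^sup>2 + 2 * N * (E / ?r\<^sup>2)) * G0"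
      by (simp add: abs_mult)
    have "\<bar>rest n y\<bar> \<le> 2 * (N * (4 * E / ?r\<^sup>2 * G1)) + (16 * E / ?r\<^sup>2 + 2 * N * (E / ?r\<^sup>2)) * G0"
      unfolding rest_def using A B unfolding real_scaleR_def by linarith
    also have "\<dots> = K / ?r\<^sup>2" unfolding K_def using rr by (simp add: field_simps)
    finally show ?thesis using True by simp
  qed
  define gn where "gn n y = e n y *\<^sub>R g y" for n y
  have gn_C: "C_k_on 2 UNIV (gn n)" for n unfolding gn_def by (intro C_k_on_scaleR e_C g) auto
  have vgn: "vlaplacian (gn n) y = e n y * vlaplacian g y + rest n y" for n y
    unfolding gn_def rest_def using vlaplacian_scaleR[OF open_UNIV UNIV_I e_C g, of n y] by simp
  have gn_out: "gn n y = 0" if "y \<notin> Q - ball p (r n)" for n y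
  proof (cases "y \<in> Q")
    case True
    then have "norm (y - p) \<le> r n" using that by (simp add: dist_norm norm_minus_commute)
    then have "(norm (y - p))\<^sup>2 \<le> (r n)\<^sup>2" by (intro power_mono) auto
    then have "q y / (r n)\<^sup>2 \<le> 1" using r[of n] by (simp add: q_def power2_norm_eq_inner)
    then show ?thesis by (simp add: gn_def e_def h(4))
  qed (simp add: gn_def Q)
  have pQ: "Q - ball p (r n) \<subseteq> S - {p}" for n using Q r[of n] by auto
  have cQn: "compact (Q - ball p (r n))" for n using Q by (intro compact_diff) auto
  have ibp: "(LBINT y. gn n y *\<^sub>R vlaplacian u y) = (LBINT y. vlaplacian (gn n) y *\<^sub>R u y)" for n
    by (rule integral_by_parts_vlaplacian[OF S' u gn_C cQn pQ gn_out])
  define u0 where "u0 y = indicator (S - {p}) y *\<^sub>R u y" for y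
  define v0 where "v0 y = indicator (S - {p}) y *\<^sub>R vlaplacian u y" for y
  have u0m: "u0 \<in> borel_measurable borel" and v0m: "v0 \<in> borel_measurable borel"
    unfolding u0_def v0_def
    using C_k_on_imp_continuous_on[OF u] vlaplacian_continuous_on[OF u] S'
    by (auto intro!: borel_measurable_continuous_on_indicator)
  have gn_out': "gn n y = 0" "vlaplacian (gn n) y = 0" if "y \<notin> S - {p}" for n y
  proof -
    have y: "y \<notin> Q - ball p (r n)" using that pQ[of n] by blast
    have cl: "closed (Q - ball p (r n))" using cQn compact_imp_closed by blast
    have o: "partial_deriv b (gn n) y = 0" if "y \<notin> Q - ball p (r n)" for y b
      by (rule partial_deriv_outside[OF cl gn_out that])
    show "gn n y = 0" by (rule gn_out[OF y])
    show "vlaplacian (gn n) y = 0" unfolding vlaplacian_def using partial_deriv_outside[OF cl o y] by simp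
  qed
  have e1: "gn n y *\<^sub>R vlaplacian u y = gn n y *\<^sub>R v0 y" "vlaplacian (gn n) y *\<^sub>R u y = vlaplacian (gn n) y *\<^sub>R u0 y" for n y
    using gn_out'[where n=n and y=y] by (cases "y \<in> S - {p}"; simp add: v0_def u0_def)+
  have ibp': "(LBINT y. gn n y *\<^sub>R v0 y) = (LBINT y. vlaplacian (gn n) y *\<^sub>R u0 y)" for n
    using ibp[of n] unfolding e1 .
  have AEp: "AE y in lborel. y \<noteq> p" by (rule AE_lborel_singleton)
  have M0: "norm (u0 y) \<le> \<bar>M\<bar>" "norm (v0 y) \<le> \<bar>M\<bar>" if "y \<in> Q" for y
    using M[of y] that by (auto simp: u0_def v0_def indicator_def)
  have meas: "f \<in> borel_measurable borel" if "continuous_on UNIV f" for f :: "'a \<Rightarrow> real"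
    using that by (rule borel_measurable_continuous_onI)
  have em: "e n \<in> borel_measurable borel" for n by (rule meas[OF C_k_on_imp_continuous_on[OF e_C]])
  have iQ: "integrable lborel (\<lambda>y. indicator Q y *\<^sub>R c)" for c :: real
    by (rule borel_integrable_compact[OF Q(1)]) auto
  have L: "(\<lambda>n. (LBINT y. (e n y * f y) *\<^sub>R w y)) \<longlonglongrightarrow> (LBINT y. f y *\<^sub>R w y)"
    and Li: "integrable lborel (\<lambda>y. (e n y * f y) *\<^sub>R w y)"
    if fm: "f \<in> borel_measurable borel" and wm: "w \<in> borel_measurable borel" and B: "\<And>y. \<bar>f y\<bar> \<le> B"
     and out: "\<And>y. y \<notin> Q \<Longrightarrow> f y = 0" and w: "\<And>y. y \<in> Q \<Longrightarrow> norm (w y) \<le> \<bar>M\<bar>"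
    for f :: "'a \<Rightarrow> real" and w :: "'a \<Rightarrow> 'b" and B n
  proof -
    have bd: "norm ((e n y * f y) *\<^sub>R w y) \<le> indicator Q y *\<^sub>R (B * \<bar>M\<bar>)" for n y
    proof (cases "y \<in> Q")
      case True
      have "\<bar>e n y\<bar> * \<bar>f y\<bar> \<le> 1 * B" using e01 B by (intro mult_mono) auto
      then have "\<bar>e n y * f y\<bar> * norm (w y) \<le> B * \<bar>M\<bar>"
        using w[OF True] by (intro mult_mono) (auto simp: abs_mult order_trans[OF abs_ge_zero B])
      then show ?thesis using True by simp
    qed (simp add: out)
    show "(\<lambda>n. (LBINT y. (e n y * f y) *\<^sub>R w y)) \<longlonglongrightarrow> (LBINT y. f y *\<^sub>R w y)"
    proof (rule integral_dominated_convergence[OF _ _ iQ])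
      show "AE y in lborel. (\<lambda>n. (e n y * f y) *\<^sub>R w y) \<longlonglongrightarrow> f y *\<^sub>R w y"
        using AEp
      proof eventually_elim
        case (elim y)
        have "(\<lambda>n. (e n y * f y) *\<^sub>R w y) \<longlonglongrightarrow> (1 * f y) *\<^sub>R w y"
          by (intro tendsto_intros e_lim elim)
        then show ?case by simp
      qed
    qed (use bd fm wm em in auto)
    show "integrable lborel (\<lambda>y. (e n y * f y) *\<^sub>R w y)"
    proof (rule Bochner_Integration.integrable_bound[OF iQ])
      show "AE y in lborel. norm ((e n y * f y) *\<^sub>R w y) \<le> norm (indicator Q y *\<^sub>R (B * \<bar>M\<bar>))"
        using order_trans[OF bd abs_ge_self] by (intro AE_I2) (simp only: real_norm_def)
    qed (use fm wm em in auto)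
  qed
  have lim1: "(\<lambda>n. (LBINT y. gn n y *\<^sub>R v0 y)) \<longlonglongrightarrow> (LBINT y. g y *\<^sub>R v0 y)"
    using L[OF meas[OF gc(1)] v0m G0(2) Q(3) M0(2)] by (simp add: gn_def)
  note L2 = L[OF meas[OF gc(2)] u0m G2(2) g2 M0(1)]
  note Li2 = Li[OF meas[OF gc(2)] u0m G2(2) g2 M0(1)]
  have cont_rest: "continuous_on UNIV (rest n)" for n
  proof -
    have "rest n = (\<lambda>y. vlaplacian (gn n) y - e n y * vlaplacian g y)" using vgn by auto
    then show ?thesis using vlaplacian_continuous_on[OF gn_C] C_k_on_imp_continuous_on[OF e_C] gc(2)
      by (auto intro!: continuous_intros)
  qed
  have rest_out: "rest n y = 0" if "y \<notin> Q" for n y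
    unfolding rest_def using g1[OF that] Q(3)[OF that] by simp
  have rest_bd: "norm (rest n y *\<^sub>R u0 y) \<le> indicator (cball p (2 * r n)) y *\<^sub>R (K / (r n)\<^sup>2 * \<bar>M\<bar>)" for n y
  proof (cases "y \<in> Q")
    case True
    have "\<bar>rest n y\<bar> * norm (u0 y) \<le> (indicator (cball p (2 * r n)) y * (K / (r n)\<^sup>2)) * \<bar>M\<bar>"
      using rest[of n y] M0(1)[OF True] K by (intro mult_mono) auto
    then show ?thesis by simp
  qed (use rest_out K in auto)
  have ic: "integrable lborel (\<lambda>y. indicator (cball p (2 * r n)) y *\<^sub>R c)" for c :: real and n
    by (rule borel_integrable_compact) auto
  have ri: "integrable lborel (\<lambda>y. rest n y *\<^sub>R u0 y)" for n
  proof (rule Bochner_Integration.integrable_bound[OF ic])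
    show "AE y in lborel. norm (rest n y *\<^sub>R u0 y) \<le> norm (indicator (cball p (2 * r n)) y *\<^sub>R (K / (r n)\<^sup>2 * \<bar>M\<bar>))"
      using order_trans[OF rest_bd abs_ge_self] by (intro AE_I2) (simp only: real_norm_def)
  qed (use meas[OF cont_rest] u0m in auto)
  have "(\<lambda>n. (LBINT y. rest n y *\<^sub>R u0 y)) \<longlonglongrightarrow> 0"
  proof (rule Lim_null_comparison)
    let ?c = "unit_ball_vol N * 2 ^ DIM('a) * (K * \<bar>M\<bar>)"
    have "norm ((LBINT y. rest n y *\<^sub>R u0 y)) \<le> ?c * r n" for n
    proof -
      have "norm ((LBINT y. rest n y *\<^sub>R u0 y))
         \<le> (LBINT y. indicator (cball p (2 * r n)) y *\<^sub>R (K / (r n)\<^sup>2 * \<bar>M\<bar>))"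
        by (rule norm_integral_le[OF ri ic rest_bd])
      also have "\<dots> = measure lborel (cball p (2 * r n)) * (K / (r n)\<^sup>2 * \<bar>M\<bar>)" by simp
      also have "\<dots> = unit_ball_vol N * (2 * r n) ^ DIM('a) * (K / (r n)\<^sup>2 * \<bar>M\<bar>)"
        using r[of n] by (simp add: content_cball N_def)
      also have "\<dots> = ?c * (r n ^ DIM('a) / (r n)\<^sup>2)" by (simp add: power_mult_distrib)
      also have "\<dots> \<le> ?c * r n"
      proof (rule mult_left_mono)
        \<comment> \<open>Volume against r^(-2): dimension at least 3 enters here.\<close>
        have "r n ^ DIM('a) \<le> r n ^ 3" using r[of n] dim by (intro power_decreasing) auto
        then show "r n ^ DIM('a) / (r n)\<^sup>2 \<le> r n"
          using r[of n] by (simp add: field_simps power2_eq_square power3_eq_cube)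
        show "0 \<le> ?c" using K by (simp add: N_def)
      qed
      finally show ?thesis .
    qed
    then show "\<forall>\<^sub>F n in sequentially. norm ((LBINT y. rest n y *\<^sub>R u0 y)) \<le> ?c * r n" by simp
    show "(\<lambda>n. ?c * r n) \<longlonglongrightarrow> 0" by (rule tendsto_mult_right_zero[OF r0])
  qed
  from tendsto_add[OF L2 this]
  have lim2: "(\<lambda>n. (LBINT y. vlaplacian (gn n) y *\<^sub>R u0 y)) \<longlonglongrightarrow> (LBINT y. vlaplacian g y *\<^sub>R u0 y)"
    using Li2 ri by (simp add: vgn scaleR_add_left)
  show ?thesis
    using LIMSEQ_unique[OF lim1[unfolded ibp'] lim2] by (simp add: u0_def v0_def)
qed

section \<open>Convolution with singular kernels\<close>

text \<open>Dyadic shells replace polar coordinates: for r/2^(k+1) < |z| <= r/2^k the integrand is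
  at most (r/2^(k+1))^(-a). With each shell enlarged to its full ball, the integrals form a
  geometric series of ratio 2^(a - N), which is below 1 because a < N.\<close>

lemma norm_powr_integral:
  assumes a: "0 \<le> a" "a < real DIM('a::euclidean_space)"
  shows "\<exists>C\<ge>0. \<forall>r>0. integrable lborel (\<lambda>z::'a. indicator (cball 0 r) z * norm z powr (-a)) \<and>
    (LBINT z::'a. indicator (cball 0 r) z * norm z powr (-a)) \<le> C * r powr (real DIM('a) - a)"
proof -
  define N where "N = real DIM('a)"
  define w where "w = unit_ball_vol N"
  define c where "c = (1 / 2) powr (N - a)"
  have c: "0 < c" "c < 1" using a powr_less_mono2[of "N - a" "1/2" 1] by (auto simp: c_def N_def)
  define C where "C = w * 2 powr a * (1 / (1 - c))"
  have w: "w \<ge> 0" by (simp add: w_def N_def)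
  have C: "C \<ge> 0" using w c by (simp add: C_def)
  have main: "(\<integral>\<^sup>+z. ennreal (indicator (cball 0 r) z * norm (z::'a) powr (-a)) \<partial>lborel) \<le> ennreal (C * r powr (N - a))"
    if r: "r > 0" for r
  proof -
    define t where "t k = (r / 2 ^ Suc k) powr (-a)" for k :: nat
    have pt: "ennreal (indicator (cball 0 r) z * norm z powr (-a))
        \<le> (\<Sum>k. ennreal (t k) * indicator (cball 0 (r / 2 ^ k)) z)" for z :: 'a
    \<comment> \<open>At z = 0 the left side is 0, because \<open>powr\<close> with base 0 is
      0.\<close>
    proof (cases "z \<noteq> 0 \<and> norm z \<le> r")
      case True
      \<comment> \<open>\<open>P k\<close> puts z outside the ball of radius r/2^(k+1); the least
        such k is the index of the shell of z.\<close>
      define P where "P k \<longleftrightarrow> r / 2 ^ Suc k < norm z" for k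
      obtain k where "r / norm z < 2 ^ k" using real_arch_pow[of 2 "r / norm z"] by auto
      then have "r < norm z * 2 ^ k" using True by (simp add: field_simps)
      also have "\<dots> \<le> norm z * 2 ^ Suc k" using True by simp
      finally have "P k" by (simp add: P_def divide_less_eq)
      then have L: "P (LEAST k. P k)" by (rule LeastI)
      define j where "j = (LEAST k. P k)"
      have zj: "norm z \<le> r / 2 ^ j"
      proof (cases j)
        case 0 then show ?thesis using True by simp
      next
        case (Suc i)
        then have "\<not> P i" using not_less_Least[of i P] by (simp add: j_def)
        then show ?thesis by (simp add: P_def Suc)
      qed
      have "norm z powr (-a) \<le> t j" unfolding t_def
        using L r a by (intro powr_mono2') (auto simp: P_def j_def)
      then have "ennreal (indicator (cball 0 r) z * norm z powr (-a)) \<le> ennreal (t j) * indicator (cball 0 (r / 2 ^ j)) z"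
        using True zj by (simp add: ennreal_leI)
      also have "\<dots> \<le> (\<Sum>k. ennreal (t k) * indicator (cball 0 (r / 2 ^ k)) z)"
      proof -
        define F where "F k = ennreal (t k) * indicator (cball 0 (r / 2 ^ k)) z" for k
        have "sum F {j} \<le> suminf F" by (intro sum_le_suminf summableI) auto
        then show ?thesis by (simp add: F_def[symmetric])
      qed
      finally show ?thesis .
    qed auto
    have "(\<integral>\<^sup>+z. ennreal (indicator (cball 0 r) z * norm (z::'a) powr (-a)) \<partial>lborel)
      \<le> (\<integral>\<^sup>+z. (\<Sum>k. ennreal (t k) * indicator (cball 0 (r / 2 ^ k)) (z::'a)) \<partial>lborel)"
      by (intro nn_integral_mono pt)
    also have "\<dots> = (\<Sum>k. \<integral>\<^sup>+z. ennreal (t k) * indicator (cball 0 (r / 2 ^ k)) (z::'a) \<partial>lborel)"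
      by (intro nn_integral_suminf borel_measurable_times_ennreal borel_measurable_indicator) auto
    also have "\<dots> = (\<Sum>k. ennreal (t k * (w * (r / 2 ^ k) ^ DIM('a))))"
      using r by (subst nn_integral_cmult_indicator)
        (auto simp: emeasure_cball w_def N_def ennreal_mult t_def)
    also have "(\<lambda>k. t k * (w * (r / 2 ^ k) ^ DIM('a))) = (\<lambda>k. w * 2 powr a * r powr (N - a) * c ^ k)"
    proof
      fix k
      have "t k = r powr (-a) * 2 powr a * (2 ^ k) powr a"
        using r by (simp add: t_def powr_divide powr_minus powr_mult divide_simps)
      moreover have "(r / 2 ^ k) ^ DIM('a) = r powr N * (2 ^ k) powr (- N)"
        using r by (simp add: N_def powr_minus powr_realpow power_divide divide_simps)
      moreover have "c ^ k = (2 ^ k) powr (a - N)"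
      proof -
        have "c = 1 / 2 powr (N - a)" by (simp add: c_def powr_divide)
        then have "c = 2 powr (a - N)" using powr_minus_divide[of 2 "N - a"] by simp
        then have "c ^ k = (2 powr (a - N)) powr real k" by (simp add: powr_realpow)
        also have "\<dots> = (2 powr real k) powr (a - N)" by (simp add: powr_powr mult.commute)
        finally show ?thesis by (simp add: powr_realpow)
      qed
      moreover have "r powr (N - a) = r powr (-a) * r powr N" by (simp flip: powr_add)
      moreover have "(2 ^ k) powr (a - N) = (2 ^ k) powr a * (2 ^ k) powr (- N)" by (simp flip: powr_add)
      ultimately show "t k * (w * (r / 2 ^ k) ^ DIM('a)) = w * 2 powr a * r powr (N - a) * c ^ k"
        by (simp only: mult_ac)
    qed
    also have "(\<Sum>k. ennreal (w * 2 powr a * r powr (N - a) * c ^ k)) = ennreal (C * r powr (N - a))"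
    proof (rule suminf_ennreal_eq)
      have "(\<lambda>k. c ^ k) sums (1 / (1 - c))" using c by (intro geometric_sums) auto
      from sums_mult[OF this, of "w * 2 powr a * r powr (N - a)"]
      show "(\<lambda>k. w * 2 powr a * r powr (N - a) * c ^ k) sums (C * r powr (N - a))"
        by (simp add: C_def mult.commute mult.left_commute)
    qed (use w c in auto)
    finally show ?thesis .
  qed
  have m: "(\<lambda>z::'a. indicator (cball 0 r) z * norm z powr (-a)) \<in> borel_measurable lborel" for r
    unfolding measurable_lborel1
    by (intro borel_measurable_times borel_measurable_indicator powr_real_measurable borel_measurable_norm) auto
  show ?thesis
  proof (rule exI[of _ C], intro conjI allI impI)
    fix r :: real assume r: "r > 0"
    show "integrable lborel (\<lambda>z::'a. indicator (cball 0 r) z * norm z powr (-a))"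
      by (intro integrableI_nonneg m AE_I2 le_less_trans[OF main[OF r]]) auto
    show "(LBINT z::'a. indicator (cball 0 r) z * norm z powr (-a)) \<le> C * r powr (real DIM('a) - a)"
      using C main[OF r] by (intro integral_real_bounded) (auto simp: N_def)
  qed (rule C)
qed

text \<open>Strictly a correlation: the kernels used are even.\<close>

definition kernel_conv :: "('a::euclidean_space \<Rightarrow> real) \<Rightarrow> ('a \<Rightarrow> 'b::euclidean_space) \<Rightarrow> 'a \<Rightarrow> 'b" where
  "kernel_conv k h x = (LBINT y. k (y - x) *\<^sub>R h y)"

text \<open>Moves the dependence on x from the kernel to the density; this is how a derivative in x
  is later passed to the density.\<close>

lemma kernel_conv_shift:
  fixes k :: "'a::euclidean_space \<Rightarrow> real" and h :: "'a \<Rightarrow> 'b::euclidean_space"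
  assumes "k \<in> borel_measurable borel" "h \<in> borel_measurable borel"
  shows "kernel_conv k h x = (LBINT z. k z *\<^sub>R h (x + z))"
  unfolding kernel_conv_def
  by (subst integral_lborel_translate[of _ x, symmetric]) (use assms in \<open>auto\<close>)

text \<open>Young's inequality for an integrable kernel and a bounded density. The bound is uniform
  in x, so L^1 convergence of kernels becomes uniform convergence of convolutions.\<close>

lemma kernel_conv_bound:
  fixes k :: "'a::euclidean_space \<Rightarrow> real" and h :: "'a \<Rightarrow> 'b::euclidean_space"
  assumes k: "integrable lborel k" and h: "h \<in> borel_measurable borel" "\<And>y. norm (h y) \<le> M"
  shows "integrable lborel (\<lambda>y. k (y - x) *\<^sub>R h y)"
    and "norm (kernel_conv k h x) \<le> M * (LBINT z. \<bar>k z\<bar>)"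
proof -
  have M: "M \<ge> 0" using h(2)[of undefined] norm_ge_zero order_trans by blast
  have km: "k \<in> borel_measurable borel" using borel_measurable_integrable[OF k] by simp
  have ik: "integrable lborel (\<lambda>y. M * \<bar>k (y - x)\<bar>)"
    using integrable_lborel_translate[OF k, of "- x"] by (intro integrable_mult_right integrable_abs) simp
  have le: "norm (k (y - x) *\<^sub>R h y) \<le> M * \<bar>k (y - x)\<bar>" for y
    using h(2)[of y] by (simp add: mult.commute mult_right_mono)
  show i: "integrable lborel (\<lambda>y. k (y - x) *\<^sub>R h y)"
  proof (rule Bochner_Integration.integrable_bound[OF ik])
    show "(\<lambda>y. k (y - x) *\<^sub>R h y) \<in> borel_measurable lborel" using km h by measurable
    show "AE y in lborel. norm (k (y - x) *\<^sub>R h y) \<le> norm (M * \<bar>k (y - x)\<bar>)"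
      using le M by (intro AE_I2) (simp add: abs_mult)
  qed
  have "norm (kernel_conv k h x) \<le> (LBINT y. M * \<bar>k (y - x)\<bar>)"
    unfolding kernel_conv_def by (rule norm_integral_le[OF i ik le])
  also have "\<dots> = M * (LBINT y. \<bar>k (- x + y)\<bar>)" by simp
  also have "(LBINT y. \<bar>k (- x + y)\<bar>) = (LBINT y. \<bar>k y\<bar>)"
    by (rule integral_lborel_translate) (use km in measurable)
  finally show "norm (kernel_conv k h x) \<le> M * (LBINT z. \<bar>k z\<bar>)" .
qed

lemma kernel_conv_diff_kernel:
  fixes k k' :: "'a::euclidean_space \<Rightarrow> real" and h :: "'a \<Rightarrow> 'b::euclidean_space"
  assumes "integrable lborel k" "integrable lborel k'" "h \<in> borel_measurable borel" "\<And>y. norm (h y) \<le> M"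
  shows "kernel_conv (\<lambda>z. k z - k' z) h x = kernel_conv k h x - kernel_conv k' h x"
  unfolding kernel_conv_def
  using kernel_conv_bound(1)[OF assms(1,3,4), of x] kernel_conv_bound(1)[OF assms(2,3,4), of x]
  by (simp add: scaleR_diff_left)

lemma uniform_continuity_compact_support:
  fixes f :: "'a::euclidean_space \<Rightarrow> 'b::real_normed_vector"
  assumes f: "continuous_on UNIV f" "\<And>y. norm y > R \<Longrightarrow> f y = 0" and e: "e > 0"
  obtains d where "d > 0" "d \<le> 1" "\<And>x y. norm (y - x) < d \<Longrightarrow> norm (f y - f x) < e"
proof -
  have "uniformly_continuous_on (cball 0 (R + 1)) f"
    using f(1) by (intro compact_uniformly_continuous) (auto intro: continuous_on_subset)
  then obtain d where d: "d > 0"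
    "\<And>x y. x \<in> cball 0 (R + 1) \<Longrightarrow> y \<in> cball 0 (R + 1) \<Longrightarrow> dist y x < d \<Longrightarrow> dist (f y) (f x) < e"
    using e unfolding uniformly_continuous_on_def by metis
  show thesis
  proof (rule that[of "min d 1"])
    fix x y :: 'a assume xy: "norm (y - x) < min d 1"
    show "norm (f y - f x) < e"
    proof (cases "x \<in> cball 0 (R + 1) \<and> y \<in> cball 0 (R + 1)")
      case True
      then show ?thesis using d(2)[of x y] xy by (simp add: dist_norm)
    next
      case False
      have "norm x > R \<and> norm y > R"
        using False xy norm_triangle_sub[of x y] norm_triangle_sub[of y x] norm_minus_commute[of x y] by auto
      then show ?thesis using f(2) e by simp
    qed
  qed (use d in auto)
qed

lemma kernel_conv_continuous:
  fixes k :: "'a::euclidean_space \<Rightarrow> real" and h :: "'a \<Rightarrow> 'b::euclidean_space"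
  assumes k: "continuous_on UNIV k" "\<And>z. norm z > R \<Longrightarrow> k z = 0"
    and h: "h \<in> borel_measurable borel" "\<And>y. norm (h y) \<le> M"
  shows "continuous_on UNIV (kernel_conv k h)"
proof (rule continuous_at_imp_continuous_on, rule ballI)
  fix x :: 'a
  have M: "M \<ge> 0" using h(2)[of undefined] norm_ge_zero order_trans by blast
  have ki: "integrable lborel k"
    by (rule integrable_compact_support[OF k(1), of "cball 0 R"]) (use k(2) in auto)
  \<comment> \<open>For |x' - x| < 1 the ball of radius \<open>R + 1\<close> about x contains the
    supports of both shifted kernels.\<close>
  define V where "V = measure lborel (cball x (R + 1))"
  show "isCont (kernel_conv k h) x"
    unfolding continuous_at_eps_delta
  proof (intro allI impI)
    fix e :: real assume e: "e > 0"
    define e' where "e' = e / (M * V + 1)"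
    have e': "e' > 0" "e' * (M * V) < e"
    proof -
      have p: "M * V + 1 > 0" using M by (simp add: V_def add_nonneg_pos)
      then show "e' > 0" using e by (simp add: e'_def)
      have "e' * (M * V + 1) = e" using p by (simp add: e'_def)
      then show "e' * (M * V) < e" using \<open>e' > 0\<close> by (simp add: algebra_simps)
    qed
    obtain d where d: "d > 0" "d \<le> 1" "\<And>x y. norm (y - x) < d \<Longrightarrow> norm (k y - k x) < e'"
      using uniform_continuity_compact_support[OF k e'(1)] by blast
    have "norm (kernel_conv k h x' - kernel_conv k h x) < e" if x': "norm (x' - x) < d" for x'
    proof -
      have "kernel_conv k h x' - kernel_conv k h x = (LBINT y. (k (y - x') - k (y - x)) *\<^sub>R h y)"
        unfolding kernel_conv_def using kernel_conv_bound(1)[OF ki h, of x'] kernel_conv_bound(1)[OF ki h, of x]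
        by (simp add: scaleR_diff_left)
      also have "norm \<dots> \<le> (LBINT y. indicator (cball x (R + 1)) y *\<^sub>R (e' * M))"
      proof (rule norm_integral_le)
        show "integrable lborel (\<lambda>y. (k (y - x') - k (y - x)) *\<^sub>R h y)"
          unfolding scaleR_diff_left using kernel_conv_bound(1)[OF ki h, of x'] kernel_conv_bound(1)[OF ki h, of x]
          by (rule Bochner_Integration.integrable_diff)
        show "integrable lborel (\<lambda>y. indicator (cball x (R + 1)) y *\<^sub>R (e' * M))"
          by (rule borel_integrable_compact) auto
        fix y
        show "norm ((k (y - x') - k (y - x)) *\<^sub>R h y) \<le> indicator (cball x (R + 1)) y *\<^sub>R (e' * M)"
        proof (cases "y \<in> cball x (R + 1)")
          case True
          have "norm ((y - x') - (y - x)) < d" using x' by (simp add: norm_minus_commute)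
          then have "\<bar>k (y - x') - k (y - x)\<bar> \<le> e'" using d(3) by (metis less_imp_le real_norm_def)
          then have "\<bar>k (y - x') - k (y - x)\<bar> * norm (h y) \<le> e' * M" using h(2) e' by (intro mult_mono) auto
          then show ?thesis using True by simp
        next
          case False
          then have "norm (y - x) > R + 1" by (simp add: dist_norm norm_minus_commute)
          moreover have "norm (y - x) \<le> norm (y - x') + norm (x' - x)"
            using norm_triangle_ineq[of "y - x'" "x' - x"] by simp
          ultimately have "norm (y - x) > R" "norm (y - x') > R" using x' d by linarith+
          then show ?thesis using k(2) False by simp
        qed
      qed
      also have "\<dots> = e' * (M * V)" by (simp add: V_def)
      finally show ?thesis using e' by simp
    qed
    then show "\<exists>d>0. \<forall>x'. dist x' x < d \<longrightarrow> dist (kernel_conv k h x') (kernel_conv k h x) < e"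
      using d by (auto simp: dist_norm)
  qed
qed

text \<open>The density is merely bounded and measurable, so the derivative falls on the kernel; the
  minus sign comes from differentiating k(y - x) in x. Uniform continuity of the \<open>kd b\<close>
  makes the linear approximation of k uniform in its argument.\<close>

lemma kernel_conv_has_derivative_smooth:
  fixes k :: "'a::euclidean_space \<Rightarrow> real" and h :: "'a \<Rightarrow> 'b::euclidean_space"
  assumes k: "\<And>z. (k has_derivative (\<lambda>v. \<Sum>b\<in>Basis. (v \<bullet> b) * kd b z)) (at z)"
    and kd: "\<And>b. b \<in> Basis \<Longrightarrow> continuous_on UNIV (kd b)"
    and out: "\<And>z. norm z > R \<Longrightarrow> k z = 0" "\<And>z b. b \<in> Basis \<Longrightarrow> norm z > R \<Longrightarrow> kd b z = 0"
    and h: "h \<in> borel_measurable borel" "\<And>y. norm (h y) \<le> M"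
  shows "(kernel_conv k h has_derivative (\<lambda>v. \<Sum>b\<in>Basis. (v \<bullet> b) *\<^sub>R (- kernel_conv (kd b) h x))) (at x)"
proof -
  have M: "M \<ge> 0" using h(2)[of undefined] norm_ge_zero order_trans by blast
  have kc: "continuous_on UNIV k"
    using k by (meson continuous_at_imp_continuous_on has_derivative_continuous)
  have ki: "integrable lborel k"
    by (rule integrable_compact_support[OF kc, of "cball 0 R"]) (use out in auto)
  have kdi: "integrable lborel (kd b)" if "b \<in> Basis" for b
    by (rule integrable_compact_support[OF kd[OF that], of "cball 0 R"]) (use out that in auto)
  define V where "V = measure lborel (cball x (R + 1))"
  define N where "N = real DIM('a)"
  have N: "N \<ge> 0" by (simp add: N_def)
  define D where "D v = (\<Sum>b\<in>Basis. (v \<bullet> b) *\<^sub>R (- kernel_conv (kd b) h x))" for v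
  show ?thesis unfolding D_def[symmetric] has_derivative_at'
  proof (intro conjI allI impI)
    show "bounded_linear D" unfolding D_def
      by (intro bounded_linear_sum bounded_linear_compose[OF bounded_linear_scaleR_left] bounded_linear_inner_left)
    fix e :: real assume e: "e > 0"
    define e' where "e' = e / (N * M * V + 1)"
    have e': "e' > 0" "e' * (N * M * V) < e"
    proof -
      have p: "N * M * V + 1 > 0" using M N by (simp add: V_def add_nonneg_pos)
      then show "e' > 0" using e by (simp add: e'_def)
      have "e' * (N * M * V + 1) = e" using p by (simp add: e'_def)
      then show "e' * (N * M * V) < e" using \<open>e' > 0\<close> by (simp add: algebra_simps)
    qed
    have "\<exists>d>0. d \<le> 1 \<and> (\<forall>x y. norm (y - x) < d \<longrightarrow> norm (kd b y - kd b x) < e')" if "b \<in> Basis" for b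
      using uniform_continuity_compact_support[OF kd[OF that] out(2)[OF that] e'(1)] by metis
    then obtain dd where dd: "\<And>b. b \<in> Basis \<Longrightarrow> dd b > 0" "\<And>b. b \<in> Basis \<Longrightarrow> dd b \<le> 1"
      "\<And>b x y. b \<in> Basis \<Longrightarrow> norm (y - x) < dd b \<Longrightarrow> norm (kd b y - kd b x) < e'"
      by metis
    define d where "d = Min (dd ` Basis)"
    have d: "d > 0" "\<And>b. b \<in> Basis \<Longrightarrow> d \<le> dd b" using dd(1) by (auto simp: d_def)
    have d1: "d \<le> 1" using d(2) dd(2) nonempty_Basis by (meson all_not_in_conv order_trans)
    have lin: "\<bar>k (z + w) - k z - (\<Sum>b\<in>Basis. (w \<bullet> b) * kd b z)\<bar> \<le> norm w * (N * e')" if w: "norm w < d" for z w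
    proof -
      have "norm (k (z + w) - k z - (\<Sum>b\<in>Basis. ((z + w - z) \<bullet> b) * kd b z)) \<le> norm (z + w - z) * (N * e')"
      proof (rule differentiable_bound_linearization[where f' = "\<lambda>z v. \<Sum>b\<in>Basis. (v \<bullet> b) * kd b z" and S = "ball z d"])
        show "z + t *\<^sub>R (z + w - z) \<in> ball z d" if "t \<in> {0..1}" for t
        proof -
          have "norm (t *\<^sub>R w) \<le> 1 * norm w" unfolding norm_scaleR using that by (intro mult_right_mono) auto
          then show ?thesis using w by (simp add: dist_norm)
        qed
        show "(k has_derivative (\<lambda>v. \<Sum>b\<in>Basis. (v \<bullet> b) * kd b x)) (at x within ball z d)" if "x \<in> ball z d" for x
          by (rule has_derivative_at_withinI[OF k])
        show "onorm ((\<lambda>i. \<Sum>b\<in>Basis. (i \<bullet> b) * kd b x) - (\<lambda>i. \<Sum>b\<in>Basis. (i \<bullet> b) * kd b z)) \<le> N * e'"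
          if x: "x \<in> ball z d" for x
          unfolding fun_diff_def
        proof (rule onorm_le)
          fix i :: 'a
          have "\<bar>(\<Sum>b\<in>Basis. (i \<bullet> b) * kd b x) - (\<Sum>b\<in>Basis. (i \<bullet> b) * kd b z)\<bar>
            = \<bar>\<Sum>b\<in>Basis. (i \<bullet> b) * (kd b x - kd b z)\<bar>"
            by (simp add: sum_subtractf right_diff_distrib)
          also have "\<dots> \<le> (\<Sum>b\<in>(Basis::'a set). norm i * e')"
          proof (rule order_trans[OF sum_abs sum_mono])
            fix b :: 'a assume b: "b \<in> Basis"
            have "\<bar>kd b x - kd b z\<bar> \<le> e'" using dd(3)[OF b, of x z] x d(2)[OF b]
              by (simp add: dist_norm norm_minus_commute)
            then show "\<bar>(i \<bullet> b) * (kd b x - kd b z)\<bar> \<le> norm i * e'"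
              unfolding abs_mult using Basis_le_norm[OF b, of i] by (intro mult_mono) auto
          qed
          finally show "norm ((\<Sum>b\<in>Basis. (i \<bullet> b) * kd b x) - (\<Sum>b\<in>Basis. (i \<bullet> b) * kd b z)) \<le> N * e' * norm i"
            by (simp add: N_def mult_ac)
        qed
      qed (use d in simp)
      then show ?thesis by simp
    qed
    have "norm (kernel_conv k h x' - kernel_conv k h x - D (x' - x)) / norm (x' - x) < e"
      if x': "0 < norm (x' - x)" "norm (x' - x) < d" for x'
    proof -
      define w where "w = x - x'"
      have w: "norm w < d" "norm w > 0" "norm w = norm (x' - x)" using x' by (auto simp: w_def norm_minus_commute)
      define g where "g y = k (y - x + w) - k (y - x) - (\<Sum>b\<in>Basis. (w \<bullet> b) * kd b (y - x))" for y
      have ib: "integrable lborel (\<lambda>y. ((w \<bullet> b) * kd b (y - x)) *\<^sub>R h y)" if "b \<in> Basis" for b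
        using kernel_conv_bound(1)[OF kdi[OF that] h, of x] by (simp flip: scaleR_scaleR)
      have yx: "y - x + w = y - x'" for y by (simp add: w_def)
      have gi: "integrable lborel (\<lambda>y. g y *\<^sub>R h y)"
        unfolding g_def scaleR_diff_left scaleR_sum_left yx
        by (intro Bochner_Integration.integrable_diff Bochner_Integration.integrable_sum
            kernel_conv_bound(1)[OF ki h] ib)
      have "kernel_conv k h x' - kernel_conv k h x - D (x' - x) = (LBINT y. g y *\<^sub>R h y)"
      proof -
        have "D (x' - x) = (\<Sum>b\<in>Basis. (w \<bullet> b) *\<^sub>R kernel_conv (kd b) h x)"
          unfolding D_def w_def by (intro sum.cong refl) (simp add: inner_diff_left algebra_simps)
        also have "\<dots> = (\<Sum>b\<in>Basis. (LBINT y. ((w \<bullet> b) * kd b (y - x)) *\<^sub>R h y))"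
          unfolding kernel_conv_def by (intro sum.cong refl) (simp flip: scaleR_scaleR)
        also have "\<dots> = (LBINT y. \<Sum>b\<in>Basis. ((w \<bullet> b) * kd b (y - x)) *\<^sub>R h y)"
          using ib by (intro Bochner_Integration.integral_sum[symmetric]) auto
        finally show ?thesis
          unfolding kernel_conv_def g_def scaleR_diff_left scaleR_sum_left yx
          using kernel_conv_bound(1)[OF ki h, of x'] kernel_conv_bound(1)[OF ki h, of x] ib
          by (simp add: Bochner_Integration.integrable_sum)
      qed
      also have "norm ((LBINT y. g y *\<^sub>R h y))
        \<le> (LBINT y. indicator (cball x (R + 1)) y *\<^sub>R (norm w * (N * e') * M))"
      proof (rule norm_integral_le[OF gi])
        show "integrable lborel (\<lambda>y. indicator (cball x (R + 1)) y *\<^sub>R (norm w * (N * e') * M))"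
          by (rule borel_integrable_compact) auto
        fix y
        show "norm (g y *\<^sub>R h y) \<le> indicator (cball x (R + 1)) y *\<^sub>R (norm w * (N * e') * M)"
        proof (cases "y \<in> cball x (R + 1)")
          case True
          have "\<bar>g y\<bar> * norm (h y) \<le> norm w * (N * e') * M"
            unfolding g_def using lin[OF w(1)] h(2) e' N by (intro mult_mono) auto
          then show ?thesis using True by simp
        next
          case False
          then have "norm (y - x) > R + 1" by (simp add: dist_norm norm_minus_commute)
          moreover have "norm (y - x) \<le> norm (y - x + w) + norm w"
            using norm_triangle_ineq4[of "y - x + w" w] by simp
          ultimately have "norm (y - x) > R" "norm (y - x + w) > R" using w d1 by linarith+
          then show ?thesis using out False by (simp add: g_def)
        qed
      qed
      also have "\<dots> = norm w * (e' * (N * M * V))" by (simp add: V_def)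
      also have "\<dots> < norm w * e" using w e' by simp
      finally show ?thesis using w by (simp add: divide_less_eq mult.commute)
    qed
    then show "\<exists>d>0. \<forall>x'. 0 < norm (x' - x) \<and> norm (x' - x) < d \<longrightarrow>
      norm (kernel_conv k h x' - kernel_conv k h x - D (x' - x)) / norm (x' - x) < e"
      using d(1) by blast
  qed
qed

text \<open>A singular kernel is reached as an L^1 limit of C^1 kernels whose derivatives converge
  in L^1 as well. Against a bounded density both convergences become uniform, so the limit is C^1.
  \<open>kd\<close> is a derivative of \<open>k\<close> in this limiting sense only.\<close>

lemma kernel_conv_C_1:
  fixes k :: "'a::euclidean_space \<Rightarrow> real" and h :: "'a \<Rightarrow> 'b::euclidean_space"
  assumes kn: "\<And>n z. (kn n has_derivative (\<lambda>v. \<Sum>b\<in>Basis. (v \<bullet> b) * knd n b z)) (at z)"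
    and knd: "\<And>n b. b \<in> Basis \<Longrightarrow> continuous_on UNIV (knd n b)"
    and out: "\<And>n z. norm z > R \<Longrightarrow> kn n z = 0" "\<And>n z b. b \<in> Basis \<Longrightarrow> norm z > R \<Longrightarrow> knd n b z = 0"
    and k: "integrable lborel k" "\<And>b. b \<in> Basis \<Longrightarrow> integrable lborel (kd b)"
    and lim: "(\<lambda>n. (LBINT z. \<bar>kn n z - k z\<bar>)) \<longlonglongrightarrow> 0"
      "\<And>b. b \<in> Basis \<Longrightarrow> (\<lambda>n. (LBINT z. \<bar>knd n b z - kd b z\<bar>)) \<longlonglongrightarrow> 0"
    and h: "h \<in> borel_measurable borel" "\<And>y. norm (h y) \<le> M"
  shows "C_k_on 1 UNIV (kernel_conv k h)"
proof -
  have M: "M \<ge> 0" using h(2)[of undefined] norm_ge_zero order_trans by blast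
  have kc: "continuous_on UNIV (kn n)" for n
    using kn by (meson continuous_at_imp_continuous_on has_derivative_continuous)
  have ki: "integrable lborel (kn n)" for n
    by (rule integrable_compact_support[OF kc, of "cball 0 R"]) (use out in auto)
  have kdi: "integrable lborel (knd n b)" if "b \<in> Basis" for b n
    by (rule integrable_compact_support[OF knd[OF that], of "cball 0 R"]) (use out that in auto)
  have b1: "norm (kernel_conv (kn n) h x - kernel_conv k h x) \<le> M * (LBINT z. \<bar>kn n z - k z\<bar>)" for n x
    using kernel_conv_bound(2)[OF Bochner_Integration.integrable_diff[OF ki k(1)] h]
      kernel_conv_diff_kernel[OF ki k(1) h] by metis
  have b2: "norm (kernel_conv (knd n b) h x - kernel_conv (kd b) h x) \<le> M * (LBINT z. \<bar>knd n b z - kd b z\<bar>)"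
    if "b \<in> Basis" for n x b
    using kernel_conv_bound(2)[OF Bochner_Integration.integrable_diff[OF kdi[OF that] k(2)[OF that]] h]
      kernel_conv_diff_kernel[OF kdi[OF that] k(2)[OF that] h] by metis
  have cd: "continuous_on UNIV (kernel_conv (kd b) h)" if b: "b \<in> Basis" for b
  proof (rule uniform_limit_theorem)
    show "\<forall>\<^sub>F n in sequentially. continuous_on UNIV (kernel_conv (knd n b) h)"
      using kernel_conv_continuous[OF knd[OF b] out(2)[OF b] h] by simp
    show "uniform_limit UNIV (\<lambda>n. kernel_conv (knd n b) h) (kernel_conv (kd b) h) sequentially"
      unfolding uniform_limit_iff
    proof (intro allI impI)
      fix e :: real assume "e > 0"
      moreover have "(\<lambda>n. M * (LBINT z. \<bar>knd n b z - kd b z\<bar>)) \<longlonglongrightarrow> 0"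
        by (rule tendsto_mult_right_zero[OF lim(2)[OF b]])
      ultimately have "\<forall>\<^sub>F n in sequentially. M * (LBINT z. \<bar>knd n b z - kd b z\<bar>) < e"
        using order_tendstoD(2) by blast
      then show "\<forall>\<^sub>F n in sequentially. \<forall>x\<in>UNIV. dist (kernel_conv (knd n b) h x) (kernel_conv (kd b) h x) < e"
        by eventually_elim (use b2[OF b] le_less_trans in \<open>fastforce simp: dist_norm\<close>)
    qed
  qed simp
  \<comment> \<open>From convergence at a single point the rule yields some limit function, which is
    identified with the convolution afterwards.\<close>
  have "\<exists>g. \<forall>x\<in>UNIV. (\<lambda>n. kernel_conv (kn n) h x) \<longlonglongrightarrow> g x \<and>
    (g has_derivative (\<lambda>v. \<Sum>b\<in>Basis. (v \<bullet> b) *\<^sub>R (- kernel_conv (kd b) h x))) (at x within UNIV)"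
  proof (rule has_derivative_sequence)
    show "(kernel_conv (kn n) h has_derivative (\<lambda>v. \<Sum>b\<in>Basis. (v \<bullet> b) *\<^sub>R (- kernel_conv (knd n b) h x))) (at x within UNIV)" for n x
      using kernel_conv_has_derivative_smooth[OF kn knd out h] by simp
    fix e :: real assume e: "e > 0"
    have "(\<lambda>n. \<Sum>b\<in>Basis. M * (LBINT z. \<bar>knd n b z - kd b z\<bar>)) \<longlonglongrightarrow> (\<Sum>b\<in>(Basis::'a set). 0)"
      by (intro tendsto_sum tendsto_mult_right_zero lim)
    then have "\<forall>\<^sub>F n in sequentially. (\<Sum>b\<in>Basis. M * (LBINT z. \<bar>knd n b z - kd b z\<bar>)) < e"
      using order_tendstoD(2)[OF _ e] by simp
    then show "\<forall>\<^sub>F n in sequentially. \<forall>x\<in>UNIV. \<forall>v. norm ((\<Sum>b\<in>Basis. (v \<bullet> b) *\<^sub>R (- kernel_conv (knd n b) h x))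
       - (\<Sum>b\<in>Basis. (v \<bullet> b) *\<^sub>R (- kernel_conv (kd b) h x))) \<le> e * norm v"
    proof eventually_elim
      case (elim n)
      show ?case
      proof (intro ballI allI)
        fix x v :: 'a
        have "norm ((\<Sum>b\<in>Basis. (v \<bullet> b) *\<^sub>R (- kernel_conv (knd n b) h x)) - (\<Sum>b\<in>Basis. (v \<bullet> b) *\<^sub>R (- kernel_conv (kd b) h x)))
          = norm (\<Sum>b\<in>Basis. (v \<bullet> b) *\<^sub>R (kernel_conv (kd b) h x - kernel_conv (knd n b) h x))"
          unfolding sum_subtractf[symmetric] by (simp add: algebra_simps)
        also have "\<dots> \<le> (\<Sum>b\<in>Basis. norm v * (M * (LBINT z. \<bar>knd n b z - kd b z\<bar>)))"
        proof (rule sum_norm_le)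
          fix b :: 'a assume b: "b \<in> Basis"
          show "norm ((v \<bullet> b) *\<^sub>R (kernel_conv (kd b) h x - kernel_conv (knd n b) h x))
            \<le> norm v * (M * (LBINT z. \<bar>knd n b z - kd b z\<bar>))"
            unfolding norm_scaleR using Basis_le_norm[OF b, of v] b2[OF b, of n x]
            by (intro mult_mono) (auto simp: norm_minus_commute)
        qed
        also have "\<dots> = (\<Sum>b\<in>Basis. M * (LBINT z. \<bar>knd n b z - kd b z\<bar>)) * norm v"
          unfolding sum_distrib_right by (intro sum.cong refl) (simp add: mult_ac)
        also have "\<dots> \<le> e * norm v" using elim by (intro mult_right_mono) auto
        finally show "norm ((\<Sum>b\<in>Basis. (v \<bullet> b) *\<^sub>R (- kernel_conv (knd n b) h x))
          - (\<Sum>b\<in>Basis. (v \<bullet> b) *\<^sub>R (- kernel_conv (kd b) h x))) \<le> e * norm v" .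
      qed
    qed
  next
    have l: "(\<lambda>n. kernel_conv (kn n) h x - kernel_conv k h x) \<longlonglongrightarrow> 0" for x
      by (rule Lim_null_comparison[OF always_eventually[OF allI[OF b1]] tendsto_mult_right_zero[OF lim(1)]])
    then show "(\<lambda>n. kernel_conv (kn n) h 0) \<longlonglongrightarrow> kernel_conv k h 0" by (rule LIM_zero_cancel)
  qed auto
  then obtain g where g: "\<And>x. (\<lambda>n. kernel_conv (kn n) h x) \<longlonglongrightarrow> g x"
    "\<And>x. (g has_derivative (\<lambda>v. \<Sum>b\<in>Basis. (v \<bullet> b) *\<^sub>R (- kernel_conv (kd b) h x))) (at x)"
    by auto
  have l: "(\<lambda>n. kernel_conv (kn n) h x - kernel_conv k h x) \<longlonglongrightarrow> 0" for x
    by (rule Lim_null_comparison[OF always_eventually[OF allI[OF b1]] tendsto_mult_right_zero[OF lim(1)]])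
  have "g x = kernel_conv k h x" for x using LIMSEQ_unique[OF g(1) LIM_zero_cancel[OF l]] .
  then have geq: "g = kernel_conv k h" by auto
  show ?thesis
    unfolding One_nat_def
  proof (rule C_k_on_SucI[OF open_UNIV g(2)[unfolded geq]])
    show "C_k_on 0 UNIV (\<lambda>x. \<Sum>c\<in>Basis. (b \<bullet> c) *\<^sub>R (- kernel_conv (kd c) h x))" if "b \<in> Basis" for b
      unfolding sum_Basis_partial_deriv[OF that] using cd[OF that] by (auto intro!: continuous_intros)
  qed
qed

text \<open>With \<open>p\<close> a cutoff this is the Newton kernel \<open>|z|\<^bsup>2-n\<^esup>\<close>, truncated and regularised by \<open>e > 0\<close>.
  For \<open>e = 0\<close> the value at the origin is the junk value 0 of \<open>powr\<close>.\<close>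

definition newton_kernel :: "(real \<Rightarrow> real) \<Rightarrow> real \<Rightarrow> 'a::euclidean_space \<Rightarrow> real" where
  "newton_kernel p e z = (z \<bullet> z + e) powr (1 - real DIM('a) / 2) * p (z \<bullet> z)"

text \<open>For e > 0, and p' the derivative of p, the derivative of
  \<open>newton_kernel p e\<close> in direction b. For e = 0 it serves as the L^1 limit of
  these.\<close>

definition newton_kernel_deriv :: "(real \<Rightarrow> real) \<Rightarrow> (real \<Rightarrow> real) \<Rightarrow> real \<Rightarrow> 'a::euclidean_space \<Rightarrow> 'a \<Rightarrow> real" where
  "newton_kernel_deriv p p' e b z = 2 * (z \<bullet> b) * ((1 - real DIM('a) / 2) * (z \<bullet> z + e) powr (- (real DIM('a) / 2)) * p (z \<bullet> z)
     + (z \<bullet> z + e) powr (1 - real DIM('a) / 2) * p' (z \<bullet> z))"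

text \<open>The argument of a profile is |z|^2, so the kernel built from it lives in the ball of
  radius sqrt d.\<close>

definition profile :: "real \<Rightarrow> (real \<Rightarrow> real) \<Rightarrow> (real \<Rightarrow> real) \<Rightarrow> bool" where
  "profile d p p' \<longleftrightarrow> 0 < d \<and> (\<forall>s. (p has_real_derivative p' s) (at s)) \<and> continuous_on UNIV p' \<and>
     (\<forall>s\<ge>d. p s = 0 \<and> p' s = 0)"

lemma profileD:
  assumes "profile d p p'"
  shows "0 < d" "(p has_real_derivative p' s) (at s)" "continuous_on UNIV p'" "continuous_on UNIV p"
    "s \<ge> d \<Longrightarrow> p s = 0" "s \<ge> d \<Longrightarrow> p' s = 0"
  using assms unfolding profile_def by (auto intro!: continuous_at_imp_continuous_on DERIV_isCont)

lemma profile_bound: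
  assumes "profile d p p'"
  obtains P where "P \<ge> 0" "\<And>s. s \<ge> 0 \<Longrightarrow> \<bar>p s\<bar> \<le> P" "\<And>s. s \<ge> 0 \<Longrightarrow> \<bar>p' s\<bar> \<le> P"
proof -
  note D = profileD[OF assms]
  have ex: "\<exists>P\<ge>0. \<forall>s\<ge>0. \<bar>f s\<bar> \<le> P" if f: "continuous_on UNIV f" "\<And>s. s \<ge> d \<Longrightarrow> f s = 0" for f :: "real \<Rightarrow> real"
  proof -
    have "bounded (f ` {0..d})"
      using f(1) by (intro compact_imp_bounded compact_continuous_image) (auto intro: continuous_on_subset)
    then obtain B where B: "B > 0" "\<And>s. s \<in> {0..d} \<Longrightarrow> \<bar>f s\<bar> \<le> B" by (auto simp: bounded_pos)
    have "\<bar>f s\<bar> \<le> B" if "s \<ge> 0" for s using B f(2)[of s] that by (cases "s \<ge> d") auto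
    then show ?thesis using B(1) less_imp_le by blast
  qed
  obtain P1 where P1: "P1 \<ge> 0" "\<And>s. s \<ge> 0 \<Longrightarrow> \<bar>p s\<bar> \<le> P1" using ex[OF D(4,5)] by blast
  obtain P2 where P2: "P2 \<ge> 0" "\<And>s. s \<ge> 0 \<Longrightarrow> \<bar>p' s\<bar> \<le> P2" using ex[OF D(3,6)] by blast
  show thesis by (rule that[of "max P1 P2"]) (use P1 P2 in \<open>auto intro: max.coboundedI1 max.coboundedI2\<close>)
qed

text \<open>Drops e, so that one majorant serves all the regularised kernels.\<close>

lemma inner_self_powr_le:
  fixes z :: "'a::real_inner"
  assumes "z \<noteq> 0" "e \<ge> 0" "a \<ge> 0"
  shows "(z \<bullet> z + e) powr (- a) \<le> norm z powr (- (2 * a))"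
proof -
  have "(z \<bullet> z + e) powr (- a) \<le> (z \<bullet> z) powr (- a)"
    using assms by (intro powr_mono2') auto
  also have "(z \<bullet> z) powr (- a) = norm z powr (- (2 * a))"
  proof -
    have "z \<bullet> z = norm z powr 2" using assms by (simp add: power2_norm_eq_inner)
    then show ?thesis by (simp only: powr_powr) simp
  qed
  finally show ?thesis .
qed

lemma newton_kernel_has_derivative:
  fixes z :: "'a::euclidean_space"
  assumes p: "profile d p p'" and e: "e > 0"
  shows "(newton_kernel p e has_derivative (\<lambda>v. \<Sum>b\<in>Basis. (v \<bullet> b) * newton_kernel_deriv p p' e b z)) (at z)"
proof -
  let ?c = "1 - real DIM('a) / 2"
  let ?X = "?c * (z \<bullet> z + e) powr (- (real DIM('a) / 2)) * p (z \<bullet> z) + (z \<bullet> z + e) powr ?c * p' (z \<bullet> z)"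
  have pos: "z \<bullet> z + e > 0" using e by (simp add: add_nonneg_pos)
  have 1: "((\<lambda>s. (s + e) powr ?c) has_real_derivative ?c * (z \<bullet> z + e) powr (?c - 1)) (at (z \<bullet> z))"
  proof -
    have "((\<lambda>s. s + e) has_real_derivative 1) (at (z \<bullet> z))" by (auto intro!: derivative_eq_intros)
    from DERIV_chain'[where f = "\<lambda>s. s + e" and x = "z \<bullet> z", OF this has_real_derivative_powr[OF pos, of ?c]]
    show ?thesis by simp
  qed
  have 2: "((\<lambda>s. (s + e) powr ?c * p s) has_real_derivative ?X) (at (z \<bullet> z))"
    using DERIV_mult[OF 1 profileD(2)[OF p]] by (simp add: algebra_simps)
  have q: "((\<lambda>z. z \<bullet> z) has_derivative (\<lambda>h. 2 * (z \<bullet> h))) (at z)"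
    by (auto intro!: derivative_eq_intros simp: inner_commute)
  have "(newton_kernel p e has_derivative (\<lambda>h. ?X * (2 * (z \<bullet> h)))) (at z)"
    unfolding newton_kernel_def[abs_def]
    using has_derivative_compose[OF q 2[unfolded has_field_derivative_def]] by simp
  also have "(\<lambda>h. ?X * (2 * (z \<bullet> h))) = (\<lambda>v. \<Sum>b\<in>Basis. (v \<bullet> b) * newton_kernel_deriv p p' e b z)"
  proof
    fix v
    have "(\<Sum>b\<in>Basis. (v \<bullet> b) * newton_kernel_deriv p p' e b z) = (\<Sum>b\<in>Basis. 2 * ?X * ((z \<bullet> b) * (v \<bullet> b)))"
      unfolding newton_kernel_deriv_def by (intro sum.cong refl) (simp only: mult_ac)
    also have "\<dots> = 2 * ?X * (z \<bullet> v)" by (simp only: sum_distrib_left[symmetric] euclidean_inner[symmetric])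
    finally show "?X * (2 * (z \<bullet> v)) = (\<Sum>b\<in>Basis. (v \<bullet> b) * newton_kernel_deriv p p' e b z)" by simp
  qed
  finally show ?thesis .
qed

lemma newton_kernel_deriv_continuous:
  assumes p: "profile d p p'" and e: "e > 0"
  shows "continuous_on UNIV (newton_kernel_deriv p p' e (b::'a::euclidean_space))"
proof -
  have "z \<bullet> z + e \<noteq> 0" for z :: 'a using e inner_ge_zero[of z] by linarith
  then show ?thesis unfolding newton_kernel_deriv_def[abs_def]
    by (intro continuous_intros continuous_on_compose2[OF profileD(4)[OF p]]
        continuous_on_compose2[OF profileD(3)[OF p]]) auto
qed

lemma newton_kernel_outside:
  fixes z :: "'a::euclidean_space"
  assumes "profile d p p'" "norm z \<ge> sqrt d"
  shows "newton_kernel p e z = 0" "newton_kernel_deriv p p' e b z = 0"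
proof -
  have "z \<bullet> z \<ge> d"
    using assms(2) real_le_lsqrt real_sqrt_le_iff[of d "z \<bullet> z"] by (simp add: norm_eq_sqrt_inner)
  then show "newton_kernel p e z = 0" "newton_kernel_deriv p p' e b z = 0"
    using profileD(5,6)[OF assms(1)] by (auto simp: newton_kernel_def newton_kernel_deriv_def)
qed

lemma newton_kernel_le:
  fixes z :: "'a::euclidean_space"
  assumes dim: "DIM('a) \<ge> 3" and p: "profile d p p'" and P: "\<And>s. s \<ge> 0 \<Longrightarrow> \<bar>p s\<bar> \<le> P"
    and z: "z \<noteq> 0" and e: "e \<ge> 0"
  shows "\<bar>newton_kernel p e z\<bar> \<le> P * (indicator (cball 0 (sqrt d)) z * norm z powr (- (real DIM('a) - 2)))"
proof (cases "z \<in> cball 0 (sqrt d)")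
  case True
  have "(z \<bullet> z + e) powr (1 - real DIM('a) / 2) \<le> norm z powr (- (real DIM('a) - 2))"
    using inner_self_powr_le[OF z e, of "real DIM('a) / 2 - 1"] dim by (simp add: algebra_simps)
  then have "(z \<bullet> z + e) powr (1 - real DIM('a) / 2) * \<bar>p (z \<bullet> z)\<bar> \<le> norm z powr (- (real DIM('a) - 2)) * P"
    using P by (intro mult_mono) auto
  then show ?thesis using True by (simp add: newton_kernel_def abs_mult mult.commute)
next
  case False
  then show ?thesis using newton_kernel_outside[OF p, of z] by simp
qed

text \<open>The gradient is of order |z|^(1-N), uniformly in e. The term with p' is smaller by a
  factor |z|^2, which is at most d on the support; this is where the d in the constant comes
  from.\<close>

lemma newton_kernel_deriv_le:
  fixes z :: "'a::euclidean_space"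
  assumes dim: "DIM('a) \<ge> 3" and p: "profile d p p'" and P: "\<And>s. s \<ge> 0 \<Longrightarrow> \<bar>p s\<bar> \<le> P" "\<And>s. s \<ge> 0 \<Longrightarrow> \<bar>p' s\<bar> \<le> P"
    and z: "z \<noteq> 0" and e: "e \<ge> 0" and b: "b \<in> Basis"
  shows "\<bar>newton_kernel_deriv p p' e b z\<bar> \<le> 2 * P * (real DIM('a) + d) * (indicator (cball 0 (sqrt d)) z * norm z powr (- (real DIM('a) - 1)))"
proof (cases "z \<in> cball 0 (sqrt d)")
  case True
  let ?N = "real DIM('a)"
  have P0: "P \<ge> 0" using P(1)[of 0] by simp
  have d: "d > 0" using profileD(1)[OF p] .
  have z0: "norm z > 0" using z by simp
  have zd: "(norm z)\<^sup>2 \<le> d" using True real_sqrt_le_iff d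
    by (metis dist_0_norm less_imp_le mem_cball norm_ge_zero power_mono real_sqrt_pow2)
  have 1: "(z \<bullet> z + e) powr (- (?N / 2)) \<le> norm z powr (- ?N)"
    using inner_self_powr_le[OF z e, of "?N / 2"] by simp
  have 2: "(z \<bullet> z + e) powr (1 - ?N / 2) \<le> norm z powr (- ?N) * d"
  proof -
    have "(z \<bullet> z + e) powr (1 - ?N / 2) \<le> norm z powr (- (?N - 2))"
      using inner_self_powr_le[OF z e, of "?N / 2 - 1"] dim by (simp add: algebra_simps)
    also have "\<dots> = norm z powr (- ?N) * norm z powr 2" by (subst powr_add[symmetric]) simp
    also have "\<dots> = norm z powr (- ?N) * (norm z)\<^sup>2" using z0 by (simp add: powr_numeral)
    also have "\<dots> \<le> norm z powr (- ?N) * d" using zd by (intro mult_left_mono) auto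
    finally show ?thesis .
  qed
  have A: "\<bar>(1 - ?N / 2) * (z \<bullet> z + e) powr (- (?N / 2)) * p (z \<bullet> z)\<bar> \<le> ?N * norm z powr (- ?N) * P"
    unfolding abs_mult using P 1 dim by (intro mult_mono) auto
  have B: "\<bar>(z \<bullet> z + e) powr (1 - ?N / 2) * p' (z \<bullet> z)\<bar> \<le> norm z powr (- ?N) * d * P"
    unfolding abs_mult using P 2 d by (intro mult_mono) auto
  have C: "\<bar>2 * (z \<bullet> b)\<bar> \<le> 2 * norm z" using Basis_le_norm[OF b, of z] by simp
  have "\<bar>newton_kernel_deriv p p' e b z\<bar> \<le> 2 * norm z * (?N * norm z powr (- ?N) * P + norm z powr (- ?N) * d * P)"
    unfolding newton_kernel_deriv_def abs_mult[of "2 * (z \<bullet> b)"]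
    by (intro mult_mono C order_trans[OF abs_triangle_ineq add_mono[OF A B]]) auto
  also have "\<dots> = 2 * P * (?N + d) * (norm z powr 1 * norm z powr (- ?N))" using z0 by (simp add: algebra_simps)
  also have "norm z powr 1 * norm z powr (- ?N) = norm z powr (- (?N - 1))"
    by (subst powr_add[symmetric]) simp
  finally show ?thesis using True by simp
next
  case False
  then show ?thesis using newton_kernel_outside[OF p, of z] by simp
qed

lemma newton_kernel_measurable:
  assumes p: "profile d p p'"
  shows "newton_kernel p e \<in> borel_measurable borel" "newton_kernel_deriv p p' e b \<in> borel_measurable borel"
proof -
  have [measurable]: "p \<in> borel_measurable borel" "p' \<in> borel_measurable borel"
    using profileD(3,4)[OF p] by (auto intro: borel_measurable_continuous_onI)
  show "newton_kernel p e \<in> borel_measurable borel" unfolding newton_kernel_def[abs_def] by measurable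
  show "newton_kernel_deriv p p' e b \<in> borel_measurable borel" unfolding newton_kernel_deriv_def[abs_def] by measurable
qed

text \<open>The majorants are of orders 2 - N and 1 - N, both integrable near 0, and do not depend
  on e, so dominated convergence applies. Second derivatives would be of order -N, which is not
  integrable: the kernel can take only one derivative.\<close>

lemma newton_kernel_integrable_limit:
  fixes b :: "'a::euclidean_space"
  assumes dim: "DIM('a) \<ge> 3" and p: "profile d p p'" and b: "b \<in> Basis"
  shows "e \<ge> 0 \<Longrightarrow> integrable lborel (newton_kernel p e :: 'a \<Rightarrow> real)"
    and "e \<ge> 0 \<Longrightarrow> integrable lborel (newton_kernel_deriv p p' e b)"
    and "(\<lambda>n. (LBINT z::'a. \<bar>newton_kernel p (1 / real (Suc n)) z - newton_kernel p 0 z\<bar>)) \<longlonglongrightarrow> 0"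
    and "(\<lambda>n. (LBINT z. \<bar>newton_kernel_deriv p p' (1 / real (Suc n)) b z - newton_kernel_deriv p p' 0 b z\<bar>)) \<longlonglongrightarrow> 0"
proof -
  let ?N = "real DIM('a)"
  obtain P where P: "P \<ge> 0" "\<And>s. s \<ge> 0 \<Longrightarrow> \<bar>p s\<bar> \<le> P" "\<And>s. s \<ge> 0 \<Longrightarrow> \<bar>p' s\<bar> \<le> P"
    using profile_bound[OF p] by blast
  have sd: "sqrt d > 0" using profileD(1)[OF p] by simp
  have i1: "integrable lborel (\<lambda>z::'a. c * (indicator (cball 0 (sqrt d)) z * norm z powr (- (?N - 2))))" for c
    using norm_powr_integral[of "?N - 2", where 'a='a] dim sd by (intro integrable_mult_right) auto
  have i2: "integrable lborel (\<lambda>z::'a. c * (indicator (cball 0 (sqrt d)) z * norm z powr (- (?N - 1))))" for c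
    using norm_powr_integral[of "?N - 1", where 'a='a] dim sd by (intro integrable_mult_right) auto
  have AE0: "AE z::'a in lborel. z \<noteq> 0" by (rule AE_lborel_singleton)
  let ?g1 = "\<lambda>z::'a. P * (indicator (cball 0 (sqrt d)) z * norm z powr (- (?N - 2)))"
  let ?g2 = "\<lambda>z::'a. 2 * P * (?N + d) * (indicator (cball 0 (sqrt d)) z * norm z powr (- (?N - 1)))"
  note m = newton_kernel_measurable[OF p]
  have le1: "\<bar>newton_kernel p e z\<bar> \<le> ?g1 z" if "z \<noteq> 0" "e \<ge> 0" for z e
    by (rule newton_kernel_le[OF dim p _ that]) (rule P(2))
  have le2: "\<bar>newton_kernel_deriv p p' e b z\<bar> \<le> ?g2 z" if "z \<noteq> 0" "e \<ge> 0" for z e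
    by (rule newton_kernel_deriv_le[OF dim p _ _ that b]) (auto intro: P(2,3))
  have key: "integrable lborel (f e)" if "e \<ge> 0" and m: "f e \<in> borel_measurable borel" and ig: "integrable lborel g"
    and le: "\<And>z. z \<noteq> 0 \<Longrightarrow> \<bar>f e z\<bar> \<le> g z" for f :: "real \<Rightarrow> 'a \<Rightarrow> real" and g e
  proof (rule Bochner_Integration.integrable_bound[OF ig])
    show "AE z in lborel. norm (f e z) \<le> norm (g z)" using AE0
    proof eventually_elim
      case (elim z)
      show ?case using order_trans[OF le[OF elim] abs_ge_self] by simp
    qed
  qed (use m in simp)
  show "integrable lborel (newton_kernel p e :: 'a \<Rightarrow> real)" if "e \<ge> 0"
    by (rule key[where f = "newton_kernel p" and g = ?g1, OF that m(1) i1 le1[OF _ that]])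
  show "integrable lborel (newton_kernel_deriv p p' e b)" if "e \<ge> 0"
    by (rule key[where f = "\<lambda>e. newton_kernel_deriv p p' e b" and g = ?g2, OF that m(2) i2 le2[OF _ that]])
  have r0: "(\<lambda>n. 1 / real (Suc n)) \<longlonglongrightarrow> 0"
    using LIMSEQ_inverse_real_of_nat by (simp add: inverse_eq_divide)
  have lim: "(\<lambda>n. (LBINT z. \<bar>f (1 / real (Suc n)) z - f 0 z\<bar>)) \<longlonglongrightarrow> 0"
    if m: "\<And>e. f e \<in> borel_measurable borel" and ig: "integrable lborel g"
    and le: "\<And>z e. z \<noteq> 0 \<Longrightarrow> e \<ge> 0 \<Longrightarrow> \<bar>f e z\<bar> \<le> g z"
    and pl: "\<And>z. z \<noteq> 0 \<Longrightarrow> (\<lambda>n. f (1 / real (Suc n)) z) \<longlonglongrightarrow> f 0 z" for f :: "real \<Rightarrow> 'a \<Rightarrow> real" and g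
  proof -
    have "(\<lambda>n. (LBINT z. \<bar>f (1 / real (Suc n)) z - f 0 z\<bar>)) \<longlonglongrightarrow> (LBINT z::'a. 0::real)"
    proof (rule integral_dominated_convergence[where w = "\<lambda>z. 2 * g z"])
      show "(\<lambda>z. \<bar>f (1 / real (Suc n)) z - f 0 z\<bar>) \<in> borel_measurable lborel" for n
        using m by measurable
      show "integrable lborel (\<lambda>z. 2 * g z)" using ig by simp
      show "AE z in lborel. (\<lambda>n. \<bar>f (1 / real (Suc n)) z - f 0 z\<bar>) \<longlonglongrightarrow> 0"
        using AE0 by eventually_elim (use pl in \<open>simp add: tendsto_rabs_zero_iff LIM_zero\<close>)
      show "AE z in lborel. norm \<bar>f (1 / real (Suc n)) z - f 0 z\<bar> \<le> 2 * g z" for n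
        using AE0
      proof eventually_elim
        case (elim z)
        show ?case using le[OF elim, of "1 / real (Suc n)"] le[OF elim, of 0] by simp
      qed
    qed simp
    then show ?thesis by simp
  qed
  show "(\<lambda>n. (LBINT z::'a. \<bar>newton_kernel p (1 / real (Suc n)) z - newton_kernel p 0 z\<bar>)) \<longlonglongrightarrow> 0"
  proof (rule lim[where f = "newton_kernel p" and g = ?g1, OF m(1) i1 le1])
    show "(\<lambda>n. newton_kernel p (1 / real (Suc n)) z) \<longlonglongrightarrow> newton_kernel p 0 z" if "z \<noteq> 0" for z :: 'a
      unfolding newton_kernel_def by (intro tendsto_intros r0) (use that in auto)
  qed
  show "(\<lambda>n. (LBINT z. \<bar>newton_kernel_deriv p p' (1 / real (Suc n)) b z - newton_kernel_deriv p p' 0 b z\<bar>)) \<longlonglongrightarrow> 0"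
  proof (rule lim[where f = "\<lambda>e. newton_kernel_deriv p p' e b" and g = ?g2, OF m(2) i2 le2])
    show "(\<lambda>n. newton_kernel_deriv p p' (1 / real (Suc n)) b z) \<longlonglongrightarrow> newton_kernel_deriv p p' 0 b z" if "z \<noteq> 0" for z :: 'a
      unfolding newton_kernel_deriv_def by (intro tendsto_intros r0) (use that in auto)
  qed
qed

lemma newton_kernel_conv_C_1:
  fixes h :: "'a::euclidean_space \<Rightarrow> 'b::euclidean_space"
  assumes dim: "DIM('a) \<ge> 3" and p: "profile d p p'"
    and h: "h \<in> borel_measurable borel" "\<And>y. norm (h y) \<le> M"
  shows "C_k_on 1 UNIV (kernel_conv (newton_kernel p 0) h)"
proof -
  obtain b :: 'a where b: "b \<in> Basis" using nonempty_Basis by blast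
  show ?thesis
  proof (rule kernel_conv_C_1[where kn = "\<lambda>n. newton_kernel p (1 / real (Suc n))" and knd = "\<lambda>n. newton_kernel_deriv p p' (1 / real (Suc n))"
        and kd = "newton_kernel_deriv p p' 0" and R = "sqrt d" and M = M])
    show "newton_kernel p (1 / real (Suc n)) z = 0" if "norm z > sqrt d" for n and z :: 'a
      using newton_kernel_outside(1)[OF p less_imp_le[OF that]] .
    show "newton_kernel_deriv p p' (1 / real (Suc n)) b z = 0" if "norm z > sqrt d" for n and z b :: 'a
      using newton_kernel_outside(2)[OF p less_imp_le[OF that]] .
    show "integrable lborel (newton_kernel p 0 :: 'a \<Rightarrow> real)" by (rule newton_kernel_integrable_limit(1)[OF dim p b]) simp
    show "integrable lborel (newton_kernel_deriv p p' 0 b)" if "b \<in> Basis" for b :: 'a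
      by (rule newton_kernel_integrable_limit(2)[OF dim p that]) simp
    show "(\<lambda>n. (LBINT z::'a. \<bar>newton_kernel p (1 / real (Suc n)) z - newton_kernel p 0 z\<bar>)) \<longlonglongrightarrow> 0"
      by (rule newton_kernel_integrable_limit(3)[OF dim p b])
    show "(\<lambda>n. (LBINT z. \<bar>newton_kernel_deriv p p' (1 / real (Suc n)) b z - newton_kernel_deriv p p' 0 b z\<bar>)) \<longlonglongrightarrow> 0"
      if "b \<in> Basis" for b :: 'a
      by (rule newton_kernel_integrable_limit(4)[OF dim p that])
  qed (use h in \<open>auto intro!: newton_kernel_has_derivative[OF p] newton_kernel_deriv_continuous[OF p]\<close>)
qed

text \<open>The derivative of a merely differentiable function may be discontinuous, but it is a
  pointwise limit of difference quotients of continuous functions.\<close>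

lemma partial_deriv_measurable:
  fixes h :: "'a::euclidean_space \<Rightarrow> 'b::euclidean_space"
  assumes S: "open S" and diff: "\<And>y. y \<in> S \<Longrightarrow> h differentiable (at y)"
  shows "(\<lambda>y. indicator S y *\<^sub>R h y) \<in> borel_measurable borel"
    and "(\<lambda>y. indicator S y *\<^sub>R partial_deriv b h y) \<in> borel_measurable borel"
proof -
  let ?h = "\<lambda>y. indicator S y *\<^sub>R h y"
  have "continuous_on S h" using diff
    by (simp add: continuous_at_imp_continuous_on differentiable_imp_continuous_within)
  then show m[measurable]: "?h \<in> borel_measurable borel"
    using S by (intro borel_measurable_continuous_on_indicator) auto
  have [measurable]: "S \<in> sets borel" using S by simp
  \<comment> \<open>Quotients of the extension by zero are measurable everywhere. At a point of the
    open set the shifted point eventually stays in the set, so the extension does not affect the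
    limit.\<close>
  let ?F = "\<lambda>n y. indicator S y *\<^sub>R (real (Suc n) *\<^sub>R (?h (y + (1 / real (Suc n)) *\<^sub>R b) - ?h y))"
  show "(\<lambda>y. indicator S y *\<^sub>R partial_deriv b h y) \<in> borel_measurable borel"
  proof (rule borel_measurable_LIMSEQ_metric[of ?F])
    show "?F n \<in> borel_measurable borel" for n by measurable
    fix y
    show "(\<lambda>n. ?F n y) \<longlonglongrightarrow> indicator S y *\<^sub>R partial_deriv b h y"
    proof (cases "y \<in> S")
      case True
      have eq: "h z = ?h z" if "z \<in> S" for z using that by simp
      have "?h differentiable (at y)" using differentiable_cong_open[OF S True eq] diff[OF True] by simp
      then have "(\<lambda>n. ?F n y) \<longlonglongrightarrow> indicator S y *\<^sub>R partial_deriv b ?h y"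
        by (intro tendsto_scaleR tendsto_const difference_quotient_tendsto)
      moreover have "partial_deriv b h y = partial_deriv b ?h y"
        by (rule partial_deriv_cong[OF S True eq])
      ultimately show ?thesis by simp
    qed simp
  qed
qed

text \<open>The kernel has support radius r and x is within r of x0, so only the density inside the
  double ball is seen, and the jump of the truncated density at its boundary is harmless.
  Differentiability at x is assumed; what is found is the value, as a limit of difference quotients
  that fall on h. The derivative of h need only be bounded, not continuous.\<close>

lemma kernel_conv_partial_deriv:
  fixes h :: "'a::euclidean_space \<Rightarrow> 'b::euclidean_space"
  assumes k: "integrable lborel k" "\<And>z. norm z > r \<Longrightarrow> k z = 0"
    and x: "x \<in> ball x0 r" and b: "b \<in> Basis"
    and diff: "\<And>y. y \<in> ball x0 (2 * r) \<Longrightarrow> h differentiable (at y)"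
    and bd: "\<And>y. y \<in> ball x0 (2 * r) \<Longrightarrow> norm (h y) \<le> M"
       "\<And>y. y \<in> ball x0 (2 * r) \<Longrightarrow> norm (partial_deriv b h y) \<le> M"
    and D: "kernel_conv k (\<lambda>y. indicator (ball x0 (2 * r)) y *\<^sub>R h y) differentiable (at x)"
  shows "partial_deriv b (kernel_conv k (\<lambda>y. indicator (ball x0 (2 * r)) y *\<^sub>R h y)) x
     = kernel_conv k (\<lambda>y. indicator (ball x0 (2 * r)) y *\<^sub>R partial_deriv b h y) x"
proof -
  let ?B = "ball x0 (2 * r)"
  let ?h = "\<lambda>y. indicator ?B y *\<^sub>R h y"
  let ?h' = "\<lambda>y. indicator ?B y *\<^sub>R partial_deriv b h y"
  have m: "?h \<in> borel_measurable borel" "?h' \<in> borel_measurable borel"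
    using partial_deriv_measurable(1)[of ?B h] partial_deriv_measurable(2)[of ?B h b] diff by auto
  have km: "k \<in> borel_measurable borel" using borel_measurable_integrable[OF k(1)] by simp
  have r: "r > 0" using x by (meson le_less_trans mem_ball zero_le_dist)
  have M: "M \<ge> 0" using order_trans[OF norm_ge_zero bd(1)[of x0]] r by simp
  have hB: "norm (?h y) \<le> M" "norm (?h' y) \<le> M" for y using bd[of y] M by (auto simp: indicator_def)
  define t where "t n = 1 / real (Suc n)" for n
  have t0: "t n > 0" for n by (simp add: t_def)
  have tl: "t \<longlonglongrightarrow> 0" unfolding t_def using LIMSEQ_inverse_real_of_nat by (simp add: inverse_eq_divide)
  have "r - dist x0 x > 0" using x by simp
  from order_tendstoD(2)[OF tl this]
  \<comment> \<open>From \<open>n0\<close> on, the shifted points stay in the double ball for every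
    z in the support of the kernel.\<close>
  obtain n0 where n0: "\<And>n. n \<ge> n0 \<Longrightarrow> t n < r - dist x0 x"
    by (auto simp: eventually_sequentially)
  define F where "F n z = k z *\<^sub>R (real (Suc n) *\<^sub>R (?h (x + z + t n *\<^sub>R b) - ?h (x + z)))" for n z
  have seg: "x + z + s *\<^sub>R b \<in> ?B" if "norm z \<le> r" "0 \<le> s" "s \<le> t n" "n \<ge> n0" for z s n
  proof -
    have "dist x0 (x + z + s *\<^sub>R b) \<le> dist x0 x + norm (z + s *\<^sub>R b)"
    proof -
      have "dist x0 (x + w) \<le> dist x0 x + norm w" for w
        using dist_triangle[of x0 "x + w" x] by (simp add: dist_norm[of x])
      from this[of "z + s *\<^sub>R b"] show ?thesis by (simp add: add.assoc)
    qed
    also have "norm (z + s *\<^sub>R b) \<le> norm z + s" using norm_triangle_ineq[of z "s *\<^sub>R b"] that b by simp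
    finally show ?thesis using that n0[of n] by simp
  qed
  have U: "kernel_conv k ?h y = (LBINT z. k z *\<^sub>R ?h (y + z))" for y
    by (rule kernel_conv_shift[OF km m(1)])
  have U': "integrable lborel (\<lambda>z. k z *\<^sub>R ?h (y + z))" for y
    using integrable_lborel_translate[OF kernel_conv_bound(1)[OF k(1) m(1) hB(1), of y], of y] by simp
  have q: "real (Suc n) *\<^sub>R (kernel_conv k ?h (x + t n *\<^sub>R b) - kernel_conv k ?h x) = integral\<^sup>L lborel (F n)" for n
  proof -
    have "F n = (\<lambda>z. real (Suc n) *\<^sub>R (k z *\<^sub>R ?h ((x + t n *\<^sub>R b) + z) - k z *\<^sub>R ?h (x + z)))"
    proof
      fix z
      have 1: "x + t n *\<^sub>R b + z = x + z + t n *\<^sub>R b" by (simp add: add_ac)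
      have 2: "c *\<^sub>R (d *\<^sub>R (A - B)) = d *\<^sub>R (c *\<^sub>R A - c *\<^sub>R B)" for c d :: real and A B :: 'b
        by (simp add: scaleR_diff_right mult.commute)
      show "F n z = real (Suc n) *\<^sub>R (k z *\<^sub>R ?h ((x + t n *\<^sub>R b) + z) - k z *\<^sub>R ?h (x + z))"
        unfolding F_def 1 by (rule 2)
    qed
    then show ?thesis unfolding U using U'[of "x + t n *\<^sub>R b"] U'[of x]
      by (simp del: of_nat_Suc)
  qed
  have "(\<lambda>n. real (Suc n) *\<^sub>R (kernel_conv k ?h (x + t n *\<^sub>R b) - kernel_conv k ?h x)) \<longlonglongrightarrow> partial_deriv b (kernel_conv k ?h) x"
    unfolding t_def by (rule difference_quotient_tendsto[OF D])
  then have 1: "(\<lambda>n. integral\<^sup>L lborel (F (n + n0))) \<longlonglongrightarrow> partial_deriv b (kernel_conv k ?h) x"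
    unfolding q by (rule LIMSEQ_ignore_initial_segment)
  have Fm: "F n \<in> borel_measurable lborel" for n
    unfolding F_def using km m(1) by measurable
  have 2: "(\<lambda>n. integral\<^sup>L lborel (F (n + n0))) \<longlonglongrightarrow> (LBINT z. k z *\<^sub>R ?h' (x + z))"
  proof (rule integral_dominated_convergence[where w = "\<lambda>z. \<bar>k z\<bar> * M"])
    show "(\<lambda>z. k z *\<^sub>R ?h' (x + z)) \<in> borel_measurable lborel" using km m(2) by measurable
    show "integrable lborel (\<lambda>z. \<bar>k z\<bar> * M)" using k(1) by simp
    show "AE z in lborel. (\<lambda>n. F (n + n0) z) \<longlonglongrightarrow> k z *\<^sub>R ?h' (x + z)"
    proof (rule AE_I2)
      fix z
      show "(\<lambda>n. F (n + n0) z) \<longlonglongrightarrow> k z *\<^sub>R ?h' (x + z)"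
      proof (cases "norm z \<le> r")
        case True
        have xz: "x + z \<in> ?B" using seg[OF True, of 0 n0] t0[of n0] by simp
        have "?h differentiable (at (x + z))"
          using differentiable_cong_open[OF open_ball xz, of h ?h] diff[OF xz] by simp
        from difference_quotient_tendsto[OF this, of b]
        have "(\<lambda>n. F n z) \<longlonglongrightarrow> k z *\<^sub>R partial_deriv b ?h (x + z)"
          unfolding F_def t_def by (rule tendsto_scaleR[OF tendsto_const])
        moreover have "partial_deriv b h (x + z) = partial_deriv b ?h (x + z)"
          by (rule partial_deriv_cong[OF open_ball xz]) simp
        ultimately have "(\<lambda>n. F n z) \<longlonglongrightarrow> k z *\<^sub>R ?h' (x + z)" using xz by simp
        then show ?thesis by (rule LIMSEQ_ignore_initial_segment)
      qed (use k(2) in \<open>simp add: F_def\<close>)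
    qed
    show "AE z in lborel. norm (F (n + n0) z) \<le> \<bar>k z\<bar> * M" for n
    proof (rule AE_I2)
      fix z
      let ?n = "n + n0"
      show "norm (F ?n z) \<le> \<bar>k z\<bar> * M"
      proof (cases "norm z \<le> r")
        case True
        have "norm (h (x + z + t ?n *\<^sub>R b) - h (x + z)) \<le> M * t ?n"
          by (rule norm_line_diff_le) (use diff bd seg[OF True, of _ ?n] t0[of ?n] in \<open>auto simp: less_imp_le\<close>)
        moreover have "?h (x + z + t ?n *\<^sub>R b) = h (x + z + t ?n *\<^sub>R b)" "?h (x + z) = h (x + z)"
          using seg[OF True, of "t ?n" ?n] seg[OF True, of 0 ?n] t0[of ?n] by auto
        ultimately have "real (Suc ?n) * norm (?h (x + z + t ?n *\<^sub>R b) - ?h (x + z)) \<le> real (Suc ?n) * (M * t ?n)"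
          by (intro mult_left_mono) auto
        also have "\<dots> = M" by (simp add: t_def del: of_nat_Suc)
        finally have "\<bar>k z\<bar> * (real (Suc ?n) * norm (?h (x + z + t ?n *\<^sub>R b) - ?h (x + z))) \<le> \<bar>k z\<bar> * M"
          by (intro mult_left_mono) auto
        then show ?thesis unfolding F_def norm_scaleR by (simp only: abs_of_nat)
      qed (use k(2) in \<open>simp add: F_def\<close>)
    qed
  qed (use Fm in auto)
  show ?thesis using LIMSEQ_unique[OF 1 2] kernel_conv_shift[OF km m(2)] by simp
qed

text \<open>The kernel contributes one derivative, the density the other j. In the induction step a
  partial derivative of the convolution is the convolution with a partial derivative of h, which has
  one order less.\<close>

lemma newton_kernel_conv_C_Suc:
  fixes h :: "'a::euclidean_space \<Rightarrow> 'b::euclidean_space"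
  assumes dim: "DIM('a) \<ge> 3" and p: "profile (r\<^sup>2) p p'" and r: "r > 0"
    and S: "open S" "cball x0 (2 * r) \<subseteq> S" and h: "C_k_on j S h"
  shows "C_k_on (Suc j) (ball x0 r) (kernel_conv (newton_kernel p 0) (\<lambda>y. indicator (ball x0 (2 * r)) y *\<^sub>R h y))"
  using h
proof (induction j arbitrary: h)
  have bdd: "\<exists>M. \<forall>y\<in>ball x0 (2 * r). norm (f y) \<le> M" if "continuous_on S f" for f :: "'a \<Rightarrow> 'b"
  proof -
    have "bounded (f ` cball x0 (2 * r))"
      using that S by (intro compact_imp_bounded compact_continuous_image) (auto intro: continuous_on_subset)
    then obtain M where "\<forall>z\<in>f ` cball x0 (2 * r). norm z \<le> M" unfolding bounded_iff by blast
    then show ?thesis using ball_subset_cball by blast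
  qed
  have C1: "C_k_on 1 UNIV (kernel_conv (newton_kernel p 0) (\<lambda>y. indicator (ball x0 (2 * r)) y *\<^sub>R f y))"
    if f: "continuous_on S f" for f :: "'a \<Rightarrow> 'b"
  proof -
    obtain M where M: "\<And>y. y \<in> ball x0 (2 * r) \<Longrightarrow> norm (f y) \<le> M" using bdd[OF f] by blast
    have "ball x0 (2 * r) \<subseteq> S" using S by force
    then have m: "(\<lambda>y. indicator (ball x0 (2 * r)) y *\<^sub>R f y) \<in> borel_measurable borel"
      using f by (intro borel_measurable_continuous_on_indicator) (auto intro: continuous_on_subset)
    show ?thesis
      by (rule newton_kernel_conv_C_1[OF dim p m, of "max M 0"]) (use M in \<open>auto simp: indicator_def intro: max.coboundedI1\<close>)
  qed
  {
    case 0
    then show ?case using C_k_on_subset[OF C1 subset_UNIV] by (simp only: One_nat_def C_k_on.simps(1))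
  next
    case (Suc j)
    have sub: "ball x0 (2 * r) \<subseteq> S" using S by force
    have hc: "continuous_on S h" using C_k_on_imp_continuous_on[OF Suc.prems] .
    let ?U = "kernel_conv (newton_kernel p 0) (\<lambda>y. indicator (ball x0 (2 * r)) y *\<^sub>R h y)"
    have diff: "?U differentiable (at x)" for x using C1[OF hc] by simp
    have "C_k_on (Suc j) (ball x0 r) (partial_deriv b ?U)" if b: "b \<in> Basis" for b
    proof (rule C_k_on_cong[OF open_ball _ Suc.IH])
      show hb: "C_k_on j S (partial_deriv b h)" using Suc.prems b by simp
      fix x assume x: "x \<in> ball x0 r"
      obtain M1 where M1: "\<And>y. y \<in> ball x0 (2 * r) \<Longrightarrow> norm (h y) \<le> M1" using bdd[OF hc] by blast
      obtain M2 where M2: "\<And>y. y \<in> ball x0 (2 * r) \<Longrightarrow> norm (partial_deriv b h y) \<le> M2"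
        using bdd[OF C_k_on_imp_continuous_on[OF hb]] by blast
      show "kernel_conv (newton_kernel p 0) (\<lambda>y. indicator (ball x0 (2 * r)) y *\<^sub>R partial_deriv b h y) x = partial_deriv b ?U x"
      proof (rule kernel_conv_partial_deriv[OF _ _ x b _ _ _ diff, symmetric])
        show "integrable lborel (newton_kernel p 0 :: 'a \<Rightarrow> real)" by (rule newton_kernel_integrable_limit(1)[OF dim p b]) simp
        show "newton_kernel p 0 z = 0" if "norm z > r" for z :: 'a
          using newton_kernel_outside(1)[OF p, of z] that r by simp
        show "h differentiable (at y)" if "y \<in> ball x0 (2 * r)" for y
          using that sub Suc.prems by auto
        show "norm (h y) \<le> max M1 M2" "norm (partial_deriv b h y) \<le> max M1 M2" if "y \<in> ball x0 (2 * r)" for y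
          using M1[OF that] M2[OF that] by auto
      qed
    qed
    then show ?case using diff by simp
  }
qed

section \<open>The representation formula\<close>

text \<open>For \<open>K = (|z|\<^sup>2 + e)\<^bsup>-m\<^esup> \<chi>(|z|\<^sup>2)\<close> with \<open>\<chi>(s) = max(0, d - s)\<^sup>4\<close> one has
  \<open>\<Delta>K = (|z|\<^sup>2 + e)\<^bsup>-m\<^esup> \<rho>(|z|\<^sup>2) - \<psi>\<close>, where \<open>\<rho>(s) = (8 - 2n) \<chi>'(s) + 4 s \<chi>''(s)\<close> is \<open>cutoff_remainder\<close> and
  \<open>\<psi> \<ge> 0\<close> is \<open>approx_id\<close>.  All singular terms go into \<open>\<psi>\<close>, which concentrates at 0 as \<open>e \<rightarrow> 0\<close>; its limiting
  mass is the constant of the representation formula.\<close>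

definition cutoff :: "real \<Rightarrow> real \<Rightarrow> real" where
  "cutoff d s = max 0 (d - s) ^ 4"

definition cutoff_remainder :: "real \<Rightarrow> real \<Rightarrow> real \<Rightarrow> real" where
  "cutoff_remainder N d s = (8 - 2 * N) * (- 4 * max 0 (d - s) ^ 3) + 4 * s * (12 * max 0 (d - s) ^ 2)"

definition approx_id :: "real \<Rightarrow> real \<Rightarrow> 'a::euclidean_space \<Rightarrow> real" where
  "approx_id d e z = real DIM('a) * (real DIM('a) - 2) * e * (z \<bullet> z + e) powr (- (real DIM('a) / 2 + 1)) * max 0 (d - z \<bullet> z) ^ 4
     + 16 * (real DIM('a) - 2) * e * (z \<bullet> z + e) powr (- (real DIM('a) / 2)) * max 0 (d - z \<bullet> z) ^ 3"

definition repr_const :: "'a::euclidean_space itself \<Rightarrow> real \<Rightarrow> real" where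
  "repr_const _ d = integral\<^sup>L lborel (newton_kernel (cutoff_remainder (real DIM('a)) d) 0 :: 'a \<Rightarrow> real)"

lemma DERIV_max_0_diff_power:
  "((\<lambda>s::real. max 0 (d - s) ^ Suc (Suc k)) has_real_derivative - (real (Suc (Suc k)) * max 0 (d - s) ^ Suc k)) (at s)"
proof -
  have "((\<lambda>s. d - s) has_real_derivative -1) (at s)" by (auto intro!: derivative_eq_intros)
  from DERIV_chain'[OF this DERIV_max_0_power] show ?thesis by simp
qed

lemma DERIV_max_0_diff:
  shows "((\<lambda>s::real. max 0 (d - s) ^ 4) has_real_derivative - (4 * max 0 (d - s) ^ 3)) (at s)"
    and "((\<lambda>s::real. max 0 (d - s) ^ 3) has_real_derivative - (3 * max 0 (d - s) ^ 2)) (at s)"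
    and "((\<lambda>s::real. max 0 (d - s) ^ 2) has_real_derivative - (2 * max 0 (d - s))) (at s)"
  using DERIV_max_0_diff_power[of d 2 s] DERIV_max_0_diff_power[of d 1 s] DERIV_max_0_diff_power[of d 0 s]
  by (simp_all add: numeral_2_eq_2 numeral_3_eq_3 eval_nat_numeral)

lemma profile_cutoff: "d > 0 \<Longrightarrow> profile d (cutoff d) (\<lambda>s. - (4 * max 0 (d - s) ^ 3))"
  unfolding profile_def cutoff_def[abs_def]
  by (auto intro!: DERIV_max_0_diff continuous_intros)

text \<open>The fourth power in \<open>cutoff\<close> is chosen for this: the remainder contains the
  second derivative of the cutoff and must itself be C^1 for its kernel to gain a derivative. Four
  is the least integer power for which it is.\<close>

lemma profile_cutoff_remainder:
  "d > 0 \<Longrightarrow> profile d (cutoff_remainder N d) (\<lambda>s. (8 - 2 * N) * (12 * max 0 (d - s) ^ 2)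
     + (4 * (12 * max 0 (d - s) ^ 2) + 4 * s * (- 24 * max 0 (d - s))))"
  unfolding profile_def
proof (intro conjI allI impI)
  fix s
  show "(cutoff_remainder N d has_real_derivative (8 - 2 * N) * (12 * max 0 (d - s) ^ 2)
     + (4 * (12 * max 0 (d - s) ^ 2) + 4 * s * (- 24 * max 0 (d - s)))) (at s)"
    unfolding cutoff_remainder_def[abs_def]
    by (rule DERIV_cong, (rule DERIV_add DERIV_mult DERIV_cmult DERIV_max_0_diff DERIV_ident DERIV_const)+)
       (simp add: algebra_simps)
qed (auto intro!: continuous_intros simp: cutoff_remainder_def)

text \<open>For a radial profile k the Laplacian is 4 s k'' + 2 N k'. Substituting s = (s + e) - e,
  the main terms in front of the cutoff cancel, as |z|^(2-N) is harmonic, and what remains of the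
  singular terms carries an explicit factor e.\<close>

lemma newton_kernel_cutoff_laplacian:
  fixes x :: "'a::euclidean_space"
  assumes e: "e > 0"
  shows "C_k_on 2 UNIV (\<lambda>y. newton_kernel (cutoff d) e (y - x))"
    and "vlaplacian (\<lambda>y. newton_kernel (cutoff d) e (y - x)) y = newton_kernel (cutoff_remainder (real DIM('a)) d) e (y - x) - approx_id d e (y - x)"
proof -
  let ?N = "real DIM('a)"
  let ?m = "?N / 2 - 1"
  let ?c = "\<lambda>k s. max 0 (d - s) ^ k"
  define k0 where "k0 s = (s + e) powr (1 - ?N / 2) * cutoff d s" for s
  define k1 where "k1 s = (1 - ?N / 2) * (s + e) powr (- (?N / 2)) * ?c 4 s + (s + e) powr (1 - ?N / 2) * - (4 * ?c 3 s)" for s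
  define k2 where "k2 s = (1 - ?N / 2) * (- (?N / 2)) * (s + e) powr (- (?N / 2 + 1)) * ?c 4 s
     + 2 * (1 - ?N / 2) * (s + e) powr (- (?N / 2)) * - (4 * ?c 3 s) + (s + e) powr (1 - ?N / 2) * (12 * ?c 2 s)" for s
  have pw: "((\<lambda>s. (s + e) powr a) has_real_derivative a * (s + e) powr (a - 1)) (at s)" if "s \<in> {- e<..}" for s a
  proof -
    have "((\<lambda>s. s + e) has_real_derivative 1) (at s)" by (auto intro!: derivative_eq_intros)
    from DERIV_chain'[where f = "\<lambda>s. s + e" and x = s, OF this has_real_derivative_powr[of "s + e" a]] that
    show ?thesis by simp
  qed
  have ex: "1 - ?N / 2 - 1 = - (?N / 2)" "- (?N / 2) - 1 = - (?N / 2 + 1)" by simp_all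
  have d1: "(k0 has_real_derivative k1 s) (at s)" if "s \<in> {- e<..}" for s
    unfolding k0_def[abs_def] cutoff_def
    by (rule DERIV_cong[OF DERIV_mult[OF pw[OF that, of "1 - ?N / 2", unfolded ex] DERIV_max_0_diff(1)]]) (simp add: k1_def algebra_simps)
  have d2: "(k1 has_real_derivative k2 s) (at s)" if "s \<in> {- e<..}" for s
    unfolding k1_def[abs_def]
    by (rule DERIV_cong[OF DERIV_add[OF DERIV_mult[OF DERIV_cmult[OF pw[OF that, of "- (?N / 2)", unfolded ex]] DERIV_max_0_diff(1)]
         DERIV_mult[OF pw[OF that, of "1 - ?N / 2", unfolded ex] DERIV_minus[OF DERIV_cmult[OF DERIV_max_0_diff(2)]]]]])
       (simp add: k2_def field_simps)
  have c2: "continuous_on {- e<..} k2" unfolding k2_def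
    by (intro continuous_intros) auto
  have pos: "z \<bullet> z \<in> {- e<..}" for z :: 'a using e inner_ge_zero[of z] by (simp del: inner_ge_zero)
  have U: "{y. (y - x) \<bullet> (y - x) \<in> {- e<..}} = UNIV" using pos by blast
  have nk: "newton_kernel (cutoff d) e (y - x) = k0 ((y - x) \<bullet> (y - x))" for y by (simp add: newton_kernel_def k0_def)
  note rad = radial_derivatives[where I = "{- e<..}" and k = k0 and ?k1.0 = k1 and ?k2.0 = k2 and p = x, OF open_greaterThan d1 d2 c2, unfolded U]
  show "C_k_on 2 UNIV (\<lambda>y. newton_kernel (cutoff d) e (y - x))" unfolding nk using rad(2) by simp
  define s where "s = (y - x) \<bullet> (y - x)"
  have s: "s + e > 0" using pos[of "y - x"] by (simp add: s_def)
  \<comment> \<open>With every power of s + e written as a multiple of \<open>t\<close>, the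
    identity becomes one between polynomials.\<close>
  define t where "t = (s + e) powr (- (?N / 2 + 1))"
  have t1: "(s + e) powr (- (?N / 2)) = (s + e) * t"
    using s powr_add[of "s + e" 1 "- (?N / 2 + 1)"] by (simp add: t_def)
  have t2: "(s + e) powr (1 - ?N / 2) = (s + e) * ((s + e) * t)"
    using s powr_add[of "s + e" 1 "- (?N / 2)"] t1 by (simp add: algebra_simps)
  have "vlaplacian (\<lambda>y. newton_kernel (cutoff d) e (y - x)) y = 4 * s * k2 s + 2 * ?N * k1 s"
    unfolding nk using rad(4)[where x = y] by (simp add: s_def)
  also have "\<dots> = (s + e) powr (1 - ?N / 2) * cutoff_remainder ?N d s -
     (?N * (?N - 2) * e * t * ?c 4 s + 16 * (?N - 2) * e * (s + e) powr (- (?N / 2)) * ?c 3 s)"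
    unfolding k1_def k2_def cutoff_remainder_def t_def[symmetric] t1 t2
    by (simp add: field_simps power2_eq_square)
  also have "\<dots> = newton_kernel (cutoff_remainder (real DIM('a)) d) e (y - x) - approx_id d e (y - x)"
    unfolding newton_kernel_def approx_id_def t_def s_def by simp
  finally show "vlaplacian (\<lambda>y. newton_kernel (cutoff d) e (y - x)) y = newton_kernel (cutoff_remainder (real DIM('a)) d) e (y - x) - approx_id d e (y - x)" .
qed

lemma partial_deriv_const: "partial_deriv b (\<lambda>y. c) = (\<lambda>y. 0)"
  by (rule ext) (rule partial_deriv_eq[OF has_derivative_const])

lemma sqrt_le_norm_imp:
  fixes z :: "'a::real_inner"
  assumes "norm z \<ge> sqrt d"
  shows "z \<bullet> z \<ge> d"
  using assms real_sqrt_le_iff[of d "z \<bullet> z"] by (simp add: norm_eq_sqrt_inner)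

text \<open>The mass is compared without evaluating an integral: the Laplacian of the compactly
  supported kernel integrates to 0, as integration by parts against the constant 1 shows.\<close>

lemma approx_id_basic:
  fixes z :: "'a::euclidean_space"
  assumes dim: "DIM('a) \<ge> 3" and d: "d > 0" and e: "e > 0"
  shows "approx_id d e z \<ge> 0" and "norm z \<ge> sqrt d \<Longrightarrow> approx_id d e z = 0"
    and "continuous_on UNIV (approx_id d e :: 'a \<Rightarrow> real)"
    and "integrable lborel (approx_id d e :: 'a \<Rightarrow> real)"
    and "integral\<^sup>L lborel (approx_id d e :: 'a \<Rightarrow> real) = integral\<^sup>L lborel (newton_kernel (cutoff_remainder (real DIM('a)) d) e :: 'a \<Rightarrow> real)"
proof -
  show "approx_id d e z \<ge> 0" unfolding approx_id_def using dim e
    by (intro add_nonneg_nonneg mult_nonneg_nonneg) auto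
  show out: "approx_id d e z = 0" if "norm z \<ge> sqrt d" for z :: 'a
    using sqrt_le_norm_imp[OF that] by (simp add: approx_id_def)
  have nz: "z \<bullet> z + e \<noteq> 0" for z :: 'a using e inner_ge_zero[of z] by linarith
  show c: "continuous_on UNIV (approx_id d e :: 'a \<Rightarrow> real)"
    unfolding approx_id_def by (intro continuous_intros) (use nz in auto)
  show i: "integrable lborel (approx_id d e :: 'a \<Rightarrow> real)"
    by (rule integrable_compact_support[OF c, of "cball 0 (sqrt d)"]) (use out in auto)
  let ?g = "\<lambda>y::'a. newton_kernel (cutoff d) e (y - 0)"
  note L = newton_kernel_cutoff_laplacian[OF e, of d "0::'a"]
  have v1: "vlaplacian (\<lambda>y::'a. 1::real) = (\<lambda>y. 0)"
    by (simp add: vlaplacian_def[abs_def] partial_deriv_const)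
  have "(LBINT y. ?g y *\<^sub>R vlaplacian (\<lambda>y::'a. 1::real) y) = (LBINT y. vlaplacian ?g y *\<^sub>R (1::real))"
  proof (rule integral_by_parts_vlaplacian[OF open_UNIV C_k_on_const[OF open_UNIV] L(1), of "cball 0 (sqrt d)"])
    show "?g y = 0" if "y \<notin> cball 0 (sqrt d)" for y
      using newton_kernel_outside(1)[OF profile_cutoff[OF d], of y e] that by simp
  qed auto
  then have "(LBINT y::'a. newton_kernel (cutoff_remainder (real DIM('a)) d) e y - approx_id d e y) = 0"
    unfolding v1 L(2) by simp
  moreover obtain b :: 'a where b: "b \<in> Basis" using nonempty_Basis by blast
  have "integrable lborel (newton_kernel (cutoff_remainder (real DIM('a)) d) e :: 'a \<Rightarrow> real)"
    using newton_kernel_integrable_limit(1)[OF dim profile_cutoff_remainder[OF d] b] e by simp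
  ultimately show "integral\<^sup>L lborel (approx_id d e :: 'a \<Rightarrow> real) = integral\<^sup>L lborel (newton_kernel (cutoff_remainder (real DIM('a)) d) e :: 'a \<Rightarrow> real)"
    using i by simp
qed

section \<open>Limits as the regularisation tends to zero\<close>

lemma newton_kernel_conv_limit:
  fixes h :: "'a::euclidean_space \<Rightarrow> 'b::euclidean_space"
  assumes dim: "DIM('a) \<ge> 3" and p: "profile d p p'"
    and h: "h \<in> borel_measurable borel" "\<And>y. norm (h y) \<le> M"
  shows "(\<lambda>n. kernel_conv (newton_kernel p (1 / real (Suc n))) h x) \<longlonglongrightarrow> kernel_conv (newton_kernel p 0) h x"
proof -
  obtain b :: 'a where b: "b \<in> Basis" using nonempty_Basis by blast
  note I = newton_kernel_integrable_limit[OF dim p b]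
  have "norm (kernel_conv (newton_kernel p (1 / real (Suc n))) h x - kernel_conv (newton_kernel p 0) h x)
    \<le> M * (LBINT z::'a. \<bar>newton_kernel p (1 / real (Suc n)) z - newton_kernel p 0 z\<bar>)" for n
  proof -
    have i: "integrable lborel (newton_kernel p (1 / real (Suc n)) :: 'a \<Rightarrow> real)" "integrable lborel (newton_kernel p 0 :: 'a \<Rightarrow> real)"
      by (rule I(1); simp)+
    show ?thesis using kernel_conv_bound(2)[OF Bochner_Integration.integrable_diff[OF i] h]
      kernel_conv_diff_kernel[OF i h] by metis
  qed
  then have "(\<lambda>n. kernel_conv (newton_kernel p (1 / real (Suc n))) h x - kernel_conv (newton_kernel p 0) h x) \<longlonglongrightarrow> 0"
    by (intro Lim_null_comparison[OF always_eventually tendsto_mult_right_zero[OF I(3)]]) blast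
  then show ?thesis by (rule LIM_zero_cancel)
qed

text \<open>The mass equals that of the remainder kernel, whose limit is already known; convolution
  with the constant 1 reads it off.\<close>

lemma integral_approx_id_tendsto:
  assumes dim: "DIM('a::euclidean_space) \<ge> 3" and d: "d > 0"
  shows "(\<lambda>n. integral\<^sup>L lborel (approx_id d (1 / real (Suc n)) :: 'a \<Rightarrow> real)) \<longlonglongrightarrow> repr_const TYPE('a) d"
proof -
  have "(\<lambda>n. kernel_conv (newton_kernel (cutoff_remainder (real DIM('a)) d) (1 / real (Suc n))) (\<lambda>y::'a. 1::real) 0)
    \<longlonglongrightarrow> kernel_conv (newton_kernel (cutoff_remainder (real DIM('a)) d) 0) (\<lambda>y::'a. 1::real) 0"
    by (rule newton_kernel_conv_limit[OF dim profile_cutoff_remainder[OF d], of _ 1]) auto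
  moreover have "integral\<^sup>L lborel (approx_id d (1 / real (Suc n)) :: 'a \<Rightarrow> real)
     = integral\<^sup>L lborel (newton_kernel (cutoff_remainder (real DIM('a)) d) (1 / real (Suc n)) :: 'a \<Rightarrow> real)" for n
    by (rule approx_id_basic(5)[OF dim d]) simp
  ultimately show ?thesis
    unfolding kernel_conv_def repr_const_def by simp
qed

text \<open>The ball |z|^2 <= e already carries enough mass: there the singular factor is at least e
  (2 e)^(-(N/2 + 1)), the volume is a multiple of e^(N/2), and the powers of e cancel. The explicit
  growth d^4 matches the bounds on the two kernels in the mean value inequality and makes its
  constant independent of the radius.\<close>

lemma repr_const_lower_bound:
  assumes dim: "DIM('a::euclidean_space) \<ge> 3"
  shows "\<exists>c0>0. \<forall>d>0. repr_const TYPE('a) d \<ge> c0 * d ^ 4"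
proof -
  let ?N = "real DIM('a)"
  define w where "w = unit_ball_vol ?N"
  define c0 where "c0 = ?N * (?N - 2) * 2 powr (- (?N / 2 + 1)) * w"
  have w: "w > 0" by (simp add: w_def)
  have c0: "c0 > 0" using dim w by (simp add: c0_def)
  have low: "integral\<^sup>L lborel (approx_id d e :: 'a \<Rightarrow> real) \<ge> c0 * (d - e) ^ 4" if e: "0 < e" "e \<le> d" for d e
  proof -
    have d: "d > 0" using e by simp
    define K where "K = ?N * (?N - 2) * e * (2 * e) powr (- (?N / 2 + 1)) * (d - e) ^ 4"
    have K: "K \<ge> 0" using dim e by (simp add: K_def)
    have "(LBINT z::'a. indicator (cball 0 (sqrt e)) z *\<^sub>R K) \<le> integral\<^sup>L lborel (approx_id d e :: 'a \<Rightarrow> real)"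
    proof (rule integral_mono)
      show "integrable lborel (\<lambda>z::'a. indicator (cball 0 (sqrt e)) z *\<^sub>R K)"
        by (rule borel_integrable_compact) auto
      show "integrable lborel (approx_id d e :: 'a \<Rightarrow> real)" by (rule approx_id_basic(4)[OF dim d e(1)])
      fix z :: 'a
      show "indicator (cball 0 (sqrt e)) z *\<^sub>R K \<le> approx_id d e z"
      proof (cases "z \<in> cball 0 (sqrt e)")
        case True
        then have "(norm z)\<^sup>2 \<le> e" using e
          by (metis dist_0_norm less_imp_le mem_cball norm_ge_zero power_mono real_sqrt_pow2)
        then have q: "z \<bullet> z \<le> e" by (simp add: power2_norm_eq_inner)
        have q0: "z \<bullet> z + e > 0" using e by (simp add: add_nonneg_pos)
        have A: "(2 * e) powr (- (?N / 2 + 1)) \<le> (z \<bullet> z + e) powr (- (?N / 2 + 1))"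
          using q q0 by (intro powr_mono2') auto
        have B: "(d - e) ^ 4 \<le> max 0 (d - z \<bullet> z) ^ 4" using q e by (intro power_mono) auto
        have "K \<le> ?N * (?N - 2) * e * (z \<bullet> z + e) powr (- (?N / 2 + 1)) * max 0 (d - z \<bullet> z) ^ 4"
          unfolding K_def using dim e A B by (intro mult_mono mult_left_mono) auto
        also have "\<dots> \<le> approx_id d e z"
          unfolding approx_id_def using dim e by (simp add: mult_nonneg_nonneg)
        finally show ?thesis using True by simp
      qed (use approx_id_basic(1)[OF dim d e(1), of z] in simp)
    qed
    also have "(LBINT z::'a. indicator (cball 0 (sqrt e)) z *\<^sub>R K) = measure lborel (cball (0::'a) (sqrt e)) * K"
      by simp
    also have "measure lborel (cball (0::'a) (sqrt e)) = w * e powr (?N / 2)"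
    proof -
      have "sqrt e ^ DIM('a) = (e powr (1/2)) powr ?N" using e by (simp add: powr_realpow powr_half_sqrt)
      then show ?thesis using e by (simp add: content_cball w_def powr_powr)
    qed
    also have "w * e powr (?N / 2) * K = c0 * (d - e) ^ 4"
    proof -
      have "e powr (?N / 2) * (e * e powr (- (?N / 2 + 1))) = e powr (?N / 2 + (1 + - (?N / 2 + 1)))"
        using e by (simp only: powr_add powr_one)
      also have "\<dots> = 1" using e by simp
      finally have E: "e powr (?N / 2) * (e * e powr (- (?N / 2 + 1))) = 1" .
      have "(2 * e) powr (- (?N / 2 + 1)) = 2 powr (- (?N / 2 + 1)) * e powr (- (?N / 2 + 1))"
        using e by (simp add: powr_mult)
      then have "w * e powr (?N / 2) * K = c0 * (d - e) ^ 4 * (e powr (?N / 2) * (e * e powr (- (?N / 2 + 1))))"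
        unfolding K_def c0_def by (simp only: mult_ac)
      then show ?thesis unfolding E by simp
    qed
    finally show ?thesis .
  qed
  have r0: "(\<lambda>n. 1 / real (Suc n)) \<longlonglongrightarrow> 0"
    using LIMSEQ_inverse_real_of_nat by (simp add: inverse_eq_divide)
  have "repr_const TYPE('a) d \<ge> c0 * d ^ 4" if d: "d > 0" for d
  proof (rule LIMSEQ_le[OF _ integral_approx_id_tendsto[OF dim d]])
    have "(\<lambda>n. c0 * (d - 1 / real (Suc n)) ^ 4) \<longlonglongrightarrow> c0 * (d - 0) ^ 4" by (intro tendsto_intros r0)
    then show "(\<lambda>n. c0 * (d - 1 / real (Suc n)) ^ 4) \<longlonglongrightarrow> c0 * d ^ 4" by simp
    obtain n0 where n0: "\<And>n. n \<ge> n0 \<Longrightarrow> 1 / real (Suc n) < d"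
      using order_tendstoD(2)[OF r0 d] by (auto simp: eventually_sequentially)
    show "\<exists>N. \<forall>n\<ge>N. c0 * (d - 1 / real (Suc n)) ^ 4 \<le> integral\<^sup>L lborel (approx_id d (1 / real (Suc n)) :: 'a \<Rightarrow> real)"
      by (rule exI[of _ n0], intro allI impI low) (use n0 less_imp_le in auto)
  qed
  then show ?thesis using c0 by blast
qed

text \<open>The usual splitting: near 0 the continuity of h at x is used, and away from 0
  \<open>approx_id\<close> is at most a constant times e, thanks to its explicit factor e. The total
  mass is not normalised, hence the factor \<open>repr_const\<close>.\<close>

lemma kernel_conv_approx_id_tendsto:
  fixes h :: "'a::euclidean_space \<Rightarrow> 'b::euclidean_space"
  assumes dim: "DIM('a) \<ge> 3" and d: "d > 0"
    and h: "h \<in> borel_measurable borel" "\<And>y. norm (h y) \<le> M" and cont: "isCont h x"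
  shows "(\<lambda>n. kernel_conv (approx_id d (1 / real (Suc n))) h x) \<longlonglongrightarrow> repr_const TYPE('a) d *\<^sub>R h x"
proof -
  let ?N = "real DIM('a)"
  define t where "t n = 1 / real (Suc n)" for n
  have t0: "t n > 0" "t n \<le> 1" for n by (auto simp: t_def)
  have tl: "t \<longlonglongrightarrow> 0" unfolding t_def using LIMSEQ_inverse_real_of_nat by (simp add: inverse_eq_divide)
  have M: "M \<ge> 0" using order_trans[OF norm_ge_zero h(2)] .
  let ?I = "\<lambda>n. integral\<^sup>L lborel (approx_id d (t n) :: 'a \<Rightarrow> real)"
  have Il: "?I \<longlonglongrightarrow> repr_const TYPE('a) d" unfolding t_def by (rule integral_approx_id_tendsto[OF dim d])
  note ai = approx_id_basic[OF dim d t0(1)]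
  have am: "(approx_id d (t n) :: 'a \<Rightarrow> real) \<in> borel_measurable borel" for n
    using ai(3) by (rule borel_measurable_continuous_onI)
  have ih: "integrable lborel (\<lambda>z. approx_id d (t n) z *\<^sub>R h (x + z))" for n
    using integrable_lborel_translate[OF kernel_conv_bound(1)[OF ai(4) h, of n x], of x] by simp
  have ic: "integrable lborel (\<lambda>z::'a. approx_id d (t n) z *\<^sub>R h x)" for n using ai(4)[of n] by (intro integrable_scaleR_left)
  have id: "integrable lborel (\<lambda>z. approx_id d (t n) z *\<^sub>R (h (x + z) - h x))" for n
    unfolding scaleR_diff_right using ih ic by (rule Bochner_Integration.integrable_diff)
  have eq: "kernel_conv (approx_id d (t n)) h x - ?I n *\<^sub>R h x = (LBINT z. approx_id d (t n) z *\<^sub>R (h (x + z) - h x))" for n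
    unfolding kernel_conv_shift[OF am h(1)] scaleR_diff_right using ih ic ai(4) by simp
  have "(\<lambda>n. kernel_conv (approx_id d (t n)) h x - ?I n *\<^sub>R h x) \<longlonglongrightarrow> 0"
  proof (rule LIMSEQ_I)
    fix e :: real assume e: "e > 0"
    obtain B where B: "B > 0" "\<And>n. norm (?I n) \<le> B"
      by (rule BseqE[OF convergent_imp_Bseq[OF convergentI[OF Il]]]) blast
    define e1 where "e1 = e / (2 * B)"
    have e1: "e1 > 0" using e B by (simp add: e1_def)
    obtain r where r0: "r > 0" "\<And>y. dist y x < r \<Longrightarrow> dist (h y) (h x) < e1"
      using cont e1 unfolding continuous_at_eps_delta by blast
    have r: "r > 0" "\<And>z. norm z < r \<Longrightarrow> norm (h (x + z) - h x) < e1"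
      using r0(1) r0(2)[of "x + _"] by (auto simp: dist_norm)
    define K where "K = ?N * (?N - 2) * r powr (- (2 * (?N / 2 + 1))) * d ^ 4 + 16 * (?N - 2) * r powr (- (2 * (?N / 2))) * d ^ 3"
    have K: "K \<ge> 0" using dim d by (simp add: K_def)
    have far: "approx_id d (t n) z \<le> t n * K" if z: "norm z \<ge> r" for z :: 'a and n
    proof -
      have z0: "z \<noteq> 0" using z r by auto
      have A: "(z \<bullet> z + t n) powr (- a) \<le> r powr (- (2 * a))" if "a \<ge> 0" for a
      proof (rule order_trans[OF inner_self_powr_le[OF z0 less_imp_le[OF t0(1)] that]])
        show "norm z powr (- (2 * a)) \<le> r powr (- (2 * a))"
          using z r(1) that by (intro powr_mono2') auto
      qed
      have mx: "max 0 (d - z \<bullet> z) ^ k \<le> d ^ k" for k using d by (intro power_mono) auto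
      have "approx_id d (t n) z \<le> ?N * (?N - 2) * t n * r powr (- (2 * (?N / 2 + 1))) * d ^ 4
        + 16 * (?N - 2) * t n * r powr (- (2 * (?N / 2))) * d ^ 3"
        unfolding approx_id_def using dim t0(1)[of n] less_imp_le[OF t0(1)[of n]]
        by (intro add_mono mult_mono mult_left_mono A mx) auto
      also have "\<dots> = t n * K" by (simp add: K_def algebra_simps)
      finally show ?thesis .
    qed
    let ?w = "measure lborel (cball (0::'a) (sqrt d))"
    have bound: "norm (kernel_conv (approx_id d (t n)) h x - ?I n *\<^sub>R h x) \<le> e1 * B + ?w * (2 * M * K) * t n" for n
    proof -
      have "norm (kernel_conv (approx_id d (t n)) h x - ?I n *\<^sub>R h x)
        \<le> (LBINT z::'a. e1 * approx_id d (t n) z + indicator (cball 0 (sqrt d)) z *\<^sub>R (t n * K * (2 * M)))"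
        unfolding eq
      proof (rule norm_integral_le[OF id])
        show "integrable lborel (\<lambda>z::'a. e1 * approx_id d (t n) z + indicator (cball 0 (sqrt d)) z *\<^sub>R (t n * K * (2 * M)))"
          using ai(4) by (intro Bochner_Integration.integrable_add borel_integrable_compact) auto
        fix z :: 'a
        have a0: "approx_id d (t n) z \<ge> 0" by (rule ai(1))
        have n2: "norm (h (x + z) - h x) \<le> 2 * M" using norm_triangle_ineq4[of "h (x + z)" "h x"] h(2)[of x] h(2)[of "x + z"] by linarith
        show "norm (approx_id d (t n) z *\<^sub>R (h (x + z) - h x))
          \<le> e1 * approx_id d (t n) z + indicator (cball 0 (sqrt d)) z *\<^sub>R (t n * K * (2 * M))"
        proof (cases "norm z < r")
          case True
          have "approx_id d (t n) z * norm (h (x + z) - h x) \<le> approx_id d (t n) z * e1"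
            using r(2)[OF True] a0 by (intro mult_left_mono) auto
          moreover have "0 \<le> indicator (cball 0 (sqrt d)) z *\<^sub>R (t n * K * (2 * M))"
            using less_imp_le[OF t0(1)[of n]] K M by simp
          ultimately show ?thesis
            unfolding norm_scaleR abs_of_nonneg[OF a0] mult.commute[of e1] by linarith
        next
          case False
          show ?thesis
          proof (cases "norm z \<le> sqrt d")
            case True
            have "approx_id d (t n) z * norm (h (x + z) - h x) \<le> (t n * K) * (2 * M)"
            proof (rule mult_mono)
              show "approx_id d (t n) z \<le> t n * K" using far[of z n] False by simp
              show "0 \<le> t n * K" using K less_imp_le[OF t0(1)[of n]] by simp
            qed (use n2 in auto)
            moreover have "0 \<le> e1 * approx_id d (t n) z" using e1 a0 by simp
            moreover have "indicator (cball 0 (sqrt d)) z = (1::real)" using True by simp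
            ultimately show ?thesis unfolding norm_scaleR abs_of_nonneg[OF a0] by simp
          next
            case f2: False
            then have "approx_id d (t n) z = 0" by (intro ai(2)) simp
            then show ?thesis using f2 by simp
          qed
        qed
      qed
      also have "\<dots> = e1 * ?I n + ?w * (t n * K * (2 * M))"
      proof -
        have i2: "integrable lborel (\<lambda>z::'a. indicator (cball 0 (sqrt d)) z *\<^sub>R (t n * K * (2 * M)))"
          by (rule borel_integrable_compact) auto
        show ?thesis
          by (subst Bochner_Integration.integral_add[OF _ i2]) (use ai(4) in auto)
      qed
      also have "\<dots> \<le> e1 * B + ?w * (2 * M * K) * t n"
      proof -
        have "?I n \<le> B" using B(2)[of n] by simp
        then have "e1 * ?I n \<le> e1 * B" using e1 by (intro mult_left_mono) auto
        moreover have "?w * (t n * K * (2 * M)) = ?w * (2 * M * K) * t n" by (simp only: mult_ac)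
        ultimately show ?thesis by linarith
      qed
      finally show ?thesis .
    qed
    have "(\<lambda>n. e1 * B + ?w * (2 * M * K) * t n) \<longlonglongrightarrow> e1 * B + ?w * (2 * M * K) * 0"
      by (intro tendsto_intros tl)
    moreover have "e1 * B + ?w * (2 * M * K) * 0 < e" using B e by (simp add: e1_def)
    ultimately have "\<forall>\<^sub>F n in sequentially. e1 * B + ?w * (2 * M * K) * t n < e"
      by (rule order_tendstoD(2))
    then obtain n0 where n0: "\<And>n. n \<ge> n0 \<Longrightarrow> e1 * B + ?w * (2 * M * K) * t n < e"
      unfolding eventually_sequentially by blast
    show "\<exists>no. \<forall>n\<ge>no. norm (kernel_conv (approx_id d (t n)) h x - ?I n *\<^sub>R h x - 0) < e"
    proof (intro exI allI impI)
      fix n assume "n \<ge> n0"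
      from le_less_trans[OF bound n0[OF this]]
      show "norm (kernel_conv (approx_id d (t n)) h x - ?I n *\<^sub>R h x - 0) < e" by simp
    qed
  qed
  from tendsto_add[OF this tendsto_scaleR[OF Il tendsto_const[of "h x"]]]
  show ?thesis unfolding t_def by simp
qed

text \<open>Integration by parts against the regularised kernel centred at x, then e -> 0.
  \<open>u0\<close> and \<open>v0\<close> are global bounded stand-ins for u and its Laplacian, so
  values outside the ball or at p do not matter. For a function that is C^2 on all of
  \<open>S\<close>, any p other than x may be taken.\<close>

theorem vlaplacian_representation:
  fixes u :: "'a::euclidean_space \<Rightarrow> 'b::euclidean_space"
  assumes dim: "DIM('a) \<ge> 3" and r: "r > 0"
    and S: "open S" "cball x r \<subseteq> S" and u: "C_k_on 2 (S - {p}) u" and xp: "x \<noteq> p"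
    and u0: "u0 \<in> borel_measurable borel" "\<And>y. norm (u0 y) \<le> M" "\<And>y. y \<in> cball x r - {p} \<Longrightarrow> u0 y = u y"
    and v0: "v0 \<in> borel_measurable borel" "\<And>y. norm (v0 y) \<le> M" "\<And>y. y \<in> cball x r - {p} \<Longrightarrow> v0 y = vlaplacian u y"
  shows "repr_const TYPE('a) (r\<^sup>2) *\<^sub>R u x
    = kernel_conv (newton_kernel (cutoff_remainder (real DIM('a)) (r\<^sup>2)) 0) u0 x - kernel_conv (newton_kernel (cutoff (r\<^sup>2)) 0) v0 x"
proof -
  define d where "d = r\<^sup>2"
  have d: "d > 0" and sd: "sqrt d = r" using r by (auto simp: d_def)
  define t where "t n = 1 / real (Suc n)" for n
  have t0: "t n > 0" for n by (simp add: t_def)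
  have AEp: "AE y in lborel. y \<noteq> p" by (rule AE_lborel_singleton)
  have S': "open (S - {p})" using S by auto
  have um: "(\<lambda>y. indicator (S - {p}) y *\<^sub>R u y) \<in> borel_measurable borel"
    "(\<lambda>y. indicator (S - {p}) y *\<^sub>R vlaplacian u y) \<in> borel_measurable borel"
    using C_k_on_imp_continuous_on[OF u] vlaplacian_continuous_on[OF u] S'
    by (auto intro!: borel_measurable_continuous_on_indicator)
  obtain b :: 'a where b: "b \<in> Basis" using nonempty_Basis by blast
  have step: "kernel_conv (newton_kernel (cutoff d) (t n)) v0 x = kernel_conv (newton_kernel (cutoff_remainder (real DIM('a)) d) (t n)) u0 x - kernel_conv (approx_id d (t n)) u0 x" for n
  proof -
    let ?g = "\<lambda>y. newton_kernel (cutoff d) (t n) (y - x)"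
    note L = newton_kernel_cutoff_laplacian[OF t0, where d = d and x = x]
    have far: "norm (y - x) \<ge> sqrt d" if "y \<notin> cball x r" for y
      using that sd by (simp add: dist_norm norm_minus_commute)
    have g0: "?g y = 0" if "y \<notin> cball x r" for y
      by (rule newton_kernel_outside(1)[OF profile_cutoff[OF d] far[OF that]])
    have gv0: "vlaplacian ?g y = 0" if "y \<notin> cball x r" for y
      unfolding L(2) using newton_kernel_outside(1)[OF profile_cutoff_remainder[OF d] far[OF that]] approx_id_basic(2)[OF dim d t0 far[OF that]]
      by simp
    have gm: "?g \<in> borel_measurable borel" "vlaplacian ?g \<in> borel_measurable borel"
      using C_k_on_imp_continuous_on[OF L(1)] vlaplacian_continuous_on[OF L(1)] by (auto intro: borel_measurable_continuous_onI)
    have ibp: "(LBINT y. ?g y *\<^sub>R (indicator (S - {p}) y *\<^sub>R vlaplacian u y))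
      = (LBINT y. vlaplacian ?g y *\<^sub>R (indicator (S - {p}) y *\<^sub>R u y))"
    proof (rule integral_by_parts_vlaplacian_punctured[OF dim S(1) u L(1) compact_cball S(2) g0])
      show "norm (u y) \<le> M" "norm (vlaplacian u y) \<le> M" if "y \<in> cball x r - {p}" for y
        using u0(2)[of y] u0(3)[OF that] v0(2)[of y] v0(3)[OF that] by auto
    qed
    have "kernel_conv (newton_kernel (cutoff d) (t n)) v0 x = (LBINT y. ?g y *\<^sub>R (indicator (S - {p}) y *\<^sub>R vlaplacian u y))"
      unfolding kernel_conv_def
    proof (rule integral_cong_AE)
      show "AE y in lborel. ?g y *\<^sub>R v0 y = ?g y *\<^sub>R (indicator (S - {p}) y *\<^sub>R vlaplacian u y)" using AEp
      proof eventually_elim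
        case (elim y)
        then show ?case using g0[of y] v0(3)[of y] S(2) by (cases "y \<in> cball x r") auto
      qed
    qed (use gm(1) v0(1) um(2) in measurable)
    also note ibp
    also have "(LBINT y. vlaplacian ?g y *\<^sub>R (indicator (S - {p}) y *\<^sub>R u y)) = (LBINT y. vlaplacian ?g y *\<^sub>R u0 y)"
    proof (rule integral_cong_AE)
      show "AE y in lborel. vlaplacian ?g y *\<^sub>R (indicator (S - {p}) y *\<^sub>R u y) = vlaplacian ?g y *\<^sub>R u0 y" using AEp
      proof eventually_elim
        case (elim y)
        then show ?case using gv0[of y] u0(3)[of y] S(2) by (cases "y \<in> cball x r") auto
      qed
    qed (use gm(2) u0(1) um(1) in measurable)
    also have "\<dots> = (LBINT y. (newton_kernel (cutoff_remainder (real DIM('a)) d) (t n) (y - x) - approx_id d (t n) (y - x)) *\<^sub>R u0 y)"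
      unfolding L(2) ..
    also have "\<dots> = kernel_conv (newton_kernel (cutoff_remainder (real DIM('a)) d) (t n)) u0 x - kernel_conv (approx_id d (t n)) u0 x"
    proof -
      have "integrable lborel (newton_kernel (cutoff_remainder (real DIM('a)) d) (t n) :: 'a \<Rightarrow> real)"
        using newton_kernel_integrable_limit(1)[OF dim profile_cutoff_remainder[OF d] b] t0[of n] by simp
      from kernel_conv_diff_kernel[OF this approx_id_basic(4)[OF dim d t0] u0(1,2)]
      show ?thesis unfolding kernel_conv_def by simp
    qed
    finally show ?thesis .
  qed
  have "\<forall>\<^sub>F y in nhds x. y \<in> ball x r - {p}"
    using r xp by (intro eventually_nhds_in_open) auto
  then have ev: "\<forall>\<^sub>F y in nhds x. u0 y = u y"
    by eventually_elim (use u0(3) in auto)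
  have "isCont u x"
    using C_k_on_imp_continuous_on[OF u] S' S(2) r xp
    by (metis Diff_iff centre_in_cball continuous_on_eq_continuous_at empty_iff insert_iff less_imp_le subsetD)
  then have ic: "isCont u0 x" using isCont_cong[OF ev] by simp
  have ux: "u0 x = u x" using u0(3)[of x] r xp by simp
  have 1: "(\<lambda>n. kernel_conv (newton_kernel (cutoff_remainder (real DIM('a)) d) (t n)) u0 x - kernel_conv (approx_id d (t n)) u0 x)
    \<longlonglongrightarrow> kernel_conv (newton_kernel (cutoff_remainder (real DIM('a)) d) 0) u0 x - repr_const TYPE('a) d *\<^sub>R u x"
    unfolding t_def ux[symmetric]
    by (intro tendsto_diff newton_kernel_conv_limit[OF dim profile_cutoff_remainder[OF d] u0(1,2)]
        kernel_conv_approx_id_tendsto[OF dim d u0(1,2) ic])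
  have 2: "(\<lambda>n. kernel_conv (newton_kernel (cutoff d) (t n)) v0 x) \<longlonglongrightarrow> kernel_conv (newton_kernel (cutoff d) 0) v0 x"
    unfolding t_def by (rule newton_kernel_conv_limit[OF dim profile_cutoff[OF d] v0(1,2)])
  have "kernel_conv (newton_kernel (cutoff d) 0) v0 x = kernel_conv (newton_kernel (cutoff_remainder (real DIM('a)) d) 0) u0 x - repr_const TYPE('a) d *\<^sub>R u x"
    by (rule LIMSEQ_unique[OF 2[unfolded step] 1])
  then show ?thesis unfolding d_def[symmetric] by simp
qed

section \<open>Decay under small energy\<close>

text \<open>The constant is 4 (8 + 2 N) + 48, one summand for each term of the remainder.\<close>

lemma cutoff_remainder_bound:
  assumes "N \<ge> 0" "d > 0" "s \<ge> 0"
  shows "\<bar>cutoff_remainder N d s\<bar> \<le> (8 * N + 80) * d ^ 3"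
proof (cases "s \<le> d")
  case True
  have a: "(d - s) ^ k \<le> d ^ k" for k using True assms by (intro power_mono) auto
  have b: "0 \<le> (d - s) ^ k" for k using True by simp
  have 1: "\<bar>(8 - 2 * N) * (- 4 * (d - s) ^ 3)\<bar> \<le> (8 + 2 * N) * (4 * d ^ 3)"
    unfolding abs_mult[of "8 - 2 * N"] using a[of 3] b[of 3] assms by (intro mult_mono) (auto simp: abs_mult)
  have "4 * s * (12 * (d - s) ^ 2) \<le> 4 * d * (12 * d ^ 2)"
    using a[of 2] True assms by (intro mult_mono) auto
  then have 2: "\<bar>4 * s * (12 * (d - s) ^ 2)\<bar> \<le> 48 * d ^ 3"
    using b[of 2] assms by (simp add: abs_mult power2_eq_square power3_eq_cube)
  have "\<bar>cutoff_remainder N d s\<bar> \<le> (8 + 2 * N) * (4 * d ^ 3) + 48 * d ^ 3"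
    unfolding cutoff_remainder_def using True 1 2 by (simp add: max_def)
  also have "\<dots> = (8 * N + 80) * d ^ 3" by (simp add: algebra_simps)
  finally show ?thesis .
qed (use assms in \<open>simp add: cutoff_remainder_def\<close>)

lemma cutoff_bound:
  assumes "d > 0" "s \<ge> 0"
  shows "\<bar>cutoff d s\<bar> \<le> d ^ 4"
  unfolding cutoff_def using assms by (auto intro!: power_mono)

text \<open>The remainder term of the representation formula is split at radius
  \<open>\<eta> * s\<close>. Inside, the bound A meets the integral of |z|^(2-N), which is of order
  (\<eta> s)^2; outside, the kernel is at most a multiple of (\<eta> s)^(2-N) and meets the L^1
  norm. The factor \<eta>^2 lets the A term be absorbed later.\<close>

lemma mean_value_inequality:
  assumes dim: "DIM('a::euclidean_space) \<ge> 3"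
  obtains K where "K > 0" "\<And>(u :: 'a \<Rightarrow> 'b::euclidean_space) S x s A B \<eta>.
    \<lbrakk>open S; C_k_on 2 S u; s > 0; cball x s \<subseteq> S; \<eta> > 0;
     \<forall>y\<in>cball x s. norm (u y) \<le> A \<and> norm (vlaplacian u y) \<le> B\<rbrakk> \<Longrightarrow>
    norm (u x) \<le> K * (A * \<eta>\<^sup>2 + \<eta> powr (- (real DIM('a) - 2)) * s powr (- real DIM('a)) *
       (LBINT y. indicator (cball x s) y * norm (u y)) + B * s\<^sup>2)"
proof -
  let ?N = "real DIM('a)"
  obtain c0 where c0: "c0 > 0" "\<And>d. d > 0 \<Longrightarrow> repr_const TYPE('a) d \<ge> c0 * d ^ 4"
    using repr_const_lower_bound[OF dim] by blast
  obtain C0 where C0: "C0 \<ge> 0" "\<And>r. r > 0 \<Longrightarrow> integrable lborel (\<lambda>z::'a. indicator (cball 0 r) z * norm z powr (- (?N - 2)))"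
    "\<And>r. r > 0 \<Longrightarrow> (LBINT z::'a. indicator (cball 0 r) z * norm z powr (- (?N - 2))) \<le> C0 * r powr (?N - (?N - 2))"
    using norm_powr_integral[of "?N - 2", where 'a='a] dim by auto
  define cR where "cR = 8 * ?N + 80"
  have cR: "cR > 0" by (simp add: cR_def add_nonneg_pos)
  define K where "K = (cR * C0 + cR + C0) / c0"
  have "cR * C0 \<ge> 0" using cR C0(1) by simp
  then have "cR * C0 + cR + C0 > 0" using cR C0(1) by linarith
  then have K: "K > 0" using c0(1) by (simp add: K_def)
  obtain b :: 'a where b: "b \<in> Basis" using nonempty_Basis by blast
  have AE0: "AE z::'a in lborel. z \<noteq> 0" by (rule AE_lborel_singleton)
  have "norm (u x) \<le> K * (A * \<eta>\<^sup>2 + \<eta> powr (- (?N - 2)) * s powr (- ?N) *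
       (LBINT y. indicator (cball x s) y * norm (u y)) + B * s\<^sup>2)"
    if S: "open S" and u: "C_k_on 2 S u" and s: "s > 0" and sub: "cball x s \<subseteq> S" and eta: "\<eta> > 0"
    and bd: "\<forall>y\<in>cball x s. norm (u y) \<le> A \<and> norm (vlaplacian u y) \<le> B"
    for u :: "'a \<Rightarrow> 'b" and S x s A B \<eta>
  proof -
    define d where "d = s\<^sup>2"
    have d: "d > 0" and sd: "sqrt d = s" using s by (auto simp: d_def)
    have AB: "A \<ge> 0" "B \<ge> 0"
      using bd s order_trans[OF norm_ge_zero] by (meson centre_in_cball less_imp_le)+
    define u0 where "u0 y = indicator (cball x s) y *\<^sub>R u y" for y
    define v0 where "v0 y = indicator (cball x s) y *\<^sub>R vlaplacian u y" for y
    have m: "u0 \<in> borel_measurable borel" "v0 \<in> borel_measurable borel"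
      unfolding u0_def v0_def
      using C_k_on_imp_continuous_on[OF u] vlaplacian_continuous_on[OF u] sub
      by (auto intro!: borel_measurable_continuous_on_indicator intro: continuous_on_subset)
    have u0A: "norm (u0 y) \<le> A" and v0B: "norm (v0 y) \<le> B" for y
      using bd AB by (auto simp: u0_def v0_def indicator_def)
    define I where "I = (LBINT y. indicator (cball x s) y * norm (u y))"
    have I_eq: "indicator (cball x s) y * norm (u y) = norm (u0 y)" for y by (simp add: u0_def)
    have iu0: "integrable lborel u0" unfolding u0_def
      using C_k_on_imp_continuous_on[OF u] sub by (intro borel_integrable_compact) (auto intro: continuous_on_subset)
    have iu: "integrable lborel (\<lambda>z. norm (u0 (x + z)))"
      using integrable_lborel_translate[OF iu0, of x] by (rule integrable_norm)
    have Iz: "(LBINT z. norm (u0 (x + z))) = I"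
      unfolding I_def I_eq by (rule integral_lborel_translate) (use m in measurable)
    have rep: "repr_const TYPE('a) d *\<^sub>R u x = kernel_conv (newton_kernel (cutoff_remainder ?N d) 0) u0 x - kernel_conv (newton_kernel (cutoff d) 0) v0 x"
      unfolding d_def
    \<comment> \<open>There is no singularity here; p is just some point different from x.\<close>
    proof (rule vlaplacian_representation[OF dim s S sub, where p = "x + b" and M = "max A B"])
      show "C_k_on 2 (S - {x + b}) u" using u by (rule C_k_on_subset) auto
      show "x \<noteq> x + b" using b by (auto simp: nonzero_Basis)
      show "norm (u0 y) \<le> max A B" "norm (v0 y) \<le> max A B" for y using u0A[of y] v0B[of y] by auto
      show "u0 y = u y" "v0 y = vlaplacian u y" if "y \<in> cball x s - {x + b}" for y
        using that by (auto simp: u0_def v0_def)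
    qed (use m in simp_all)
    note pR = profile_cutoff_remainder[OF d, of ?N] and pf = profile_cutoff[OF d]
    have kR: "\<bar>newton_kernel (cutoff_remainder ?N d) 0 z\<bar> \<le> (cR * d ^ 3) * (indicator (cball 0 s) z * norm z powr (- (?N - 2)))" if "z \<noteq> 0" for z :: 'a
      using newton_kernel_le[OF dim pR _ that, of "cR * d ^ 3" 0] cutoff_remainder_bound[of ?N d] d unfolding cR_def sd by auto
    have kf: "\<bar>newton_kernel (cutoff d) 0 z\<bar> \<le> d ^ 4 * (indicator (cball 0 s) z * norm z powr (- (?N - 2)))" if "z \<noteq> 0" for z :: 'a
      using newton_kernel_le[OF dim pf _ that, of "d ^ 4" 0] cutoff_bound[of d] d unfolding sd by auto
    have ik: "integrable lborel (newton_kernel (cutoff_remainder ?N d) 0 :: 'a \<Rightarrow> real)" "integrable lborel (newton_kernel (cutoff d) 0 :: 'a \<Rightarrow> real)"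
      using newton_kernel_integrable_limit(1)[OF dim pR b, of 0] newton_kernel_integrable_limit(1)[OF dim pf b, of 0] by auto
    have r1: "norm (kernel_conv (newton_kernel (cutoff_remainder ?N d) 0) u0 x) \<le> cR * d ^ 3 * (A * C0 * (\<eta> * s)\<^sup>2 + (\<eta> * s) powr (- (?N - 2)) * I)"
    proof -
      have es: "\<eta> * s > 0" using eta s by simp
      let ?g = "\<lambda>z::'a. cR * d ^ 3 * (A * (indicator (cball 0 (\<eta> * s)) z * norm z powr (- (?N - 2)))
         + (\<eta> * s) powr (- (?N - 2)) * norm (u0 (x + z)))"
      have ig: "integrable lborel ?g"
        using C0(2)[OF es] iu by (intro integrable_mult_right Bochner_Integration.integrable_add) auto
      have ic: "integrable lborel (\<lambda>z. newton_kernel (cutoff_remainder ?N d) 0 z *\<^sub>R u0 (x + z))"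
        using integrable_lborel_translate[OF kernel_conv_bound(1)[OF ik(1) m(1) u0A, of x], of x] by simp
      have "kernel_conv (newton_kernel (cutoff_remainder ?N d) 0) u0 x = (LBINT z. newton_kernel (cutoff_remainder ?N d) 0 z *\<^sub>R u0 (x + z))"
        by (rule kernel_conv_shift[OF newton_kernel_measurable(1)[OF pR] m(1)])
      also have "norm \<dots> \<le> (LBINT z. norm (newton_kernel (cutoff_remainder ?N d) 0 z *\<^sub>R u0 (x + z)))"
        by (rule integral_norm_bound)
      also have "\<dots> \<le> integral\<^sup>L lborel ?g"
      proof (rule integral_mono_AE[OF integrable_norm[OF ic] ig])
        show "AE z in lborel. norm (newton_kernel (cutoff_remainder ?N d) 0 z *\<^sub>R u0 (x + z)) \<le> ?g z" using AE0
        proof eventually_elim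
          case (elim z)
          have le: "norm z powr (- (?N - 2)) * norm (u0 (x + z)) \<le>
             A * (indicator (cball 0 (\<eta> * s)) z * norm z powr (- (?N - 2))) + (\<eta> * s) powr (- (?N - 2)) * norm (u0 (x + z))"
          proof (cases "z \<in> cball 0 (\<eta> * s)")
            case True
            have "norm z powr (- (?N - 2)) * norm (u0 (x + z)) \<le> norm z powr (- (?N - 2)) * A"
              using u0A by (intro mult_left_mono) auto
            moreover have "0 \<le> (\<eta> * s) powr (- (?N - 2)) * norm (u0 (x + z))" by simp
            moreover have i: "indicator (cball 0 (\<eta> * s)) z = (1::real)" using True by simp
            ultimately show ?thesis unfolding i mult_1 mult.commute[of A] by linarith
          next
            case False
            then have "norm z powr (- (?N - 2)) \<le> (\<eta> * s) powr (- (?N - 2))"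
              using es dim by (intro powr_mono2') auto
            then have "norm z powr (- (?N - 2)) * norm (u0 (x + z)) \<le> (\<eta> * s) powr (- (?N - 2)) * norm (u0 (x + z))"
              by (intro mult_right_mono) auto
            then show ?thesis using False by simp
          qed
          have "norm (newton_kernel (cutoff_remainder ?N d) 0 z *\<^sub>R u0 (x + z)) \<le> (cR * d ^ 3) * (1 * norm z powr (- (?N - 2))) * norm (u0 (x + z))"
          proof -
            have "\<bar>newton_kernel (cutoff_remainder ?N d) 0 z\<bar> \<le> (cR * d ^ 3) * (1 * norm z powr (- (?N - 2)))"
              by (rule order_trans[OF kR[OF elim]]) (use cR d in \<open>auto intro!: mult_left_mono mult_right_mono simp: indicator_def\<close>)
            then show ?thesis unfolding norm_scaleR by (intro mult_right_mono) auto
          qed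
          also have "\<dots> = (cR * d ^ 3) * (norm z powr (- (?N - 2)) * norm (u0 (x + z)))" by simp
          also have "\<dots> \<le> ?g z" using le cR d by (intro mult_left_mono) auto
          finally show ?case .
        qed
      qed
      also have "\<dots> = cR * d ^ 3 * (A * (LBINT z::'a. indicator (cball 0 (\<eta> * s)) z * norm z powr (- (?N - 2)))
         + (\<eta> * s) powr (- (?N - 2)) * I)"
        using C0(2)[OF es] iu by (simp add: Iz)
      also have "\<dots> \<le> cR * d ^ 3 * (A * (C0 * (\<eta> * s) powr 2) + (\<eta> * s) powr (- (?N - 2)) * I)"
        using C0(3)[OF es] AB cR d by (intro mult_left_mono add_right_mono) auto
      also have "(\<eta> * s) powr 2 = (\<eta> * s)\<^sup>2" using es by simp
      finally show ?thesis by (simp add: mult.assoc)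
    qed
    have r2: "norm (kernel_conv (newton_kernel (cutoff d) 0) v0 x) \<le> B * (d ^ 4 * (C0 * s\<^sup>2))"
    proof -
      have "norm (kernel_conv (newton_kernel (cutoff d) 0) v0 x) \<le> B * (LBINT z::'a. \<bar>newton_kernel (cutoff d) 0 z\<bar>)"
        by (rule kernel_conv_bound(2)[OF ik(2) m(2) v0B])
      also have "(LBINT z::'a. \<bar>newton_kernel (cutoff d) 0 z\<bar>)
         \<le> (LBINT z::'a. d ^ 4 * (indicator (cball 0 s) z * norm z powr (- (?N - 2))))"
      proof (rule integral_mono_AE)
        show "integrable lborel (\<lambda>z::'a. \<bar>newton_kernel (cutoff d) 0 z\<bar>)" using ik(2) by simp
        show "integrable lborel (\<lambda>z::'a. d ^ 4 * (indicator (cball 0 s) z * norm z powr (- (?N - 2))))"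
          using C0(2)[OF s] by simp
        show "AE z::'a in lborel. \<bar>newton_kernel (cutoff d) 0 z\<bar> \<le> d ^ 4 * (indicator (cball 0 s) z * norm z powr (- (?N - 2)))"
          using AE0 by eventually_elim (rule kf)
      qed
      also have "\<dots> \<le> d ^ 4 * (C0 * s powr 2)"
        using C0(3)[OF s] d by simp
      also have "s powr 2 = s\<^sup>2" using s by simp
      finally show ?thesis using AB by (simp add: mult_left_mono)
    qed
    have "c0 * d ^ 4 * norm (u x) \<le> norm (repr_const TYPE('a) d *\<^sub>R u x)"
    proof -
      have "c0 * d ^ 4 \<le> \<bar>repr_const TYPE('a) d\<bar>" using c0(2)[OF d] by linarith
      then show ?thesis by (simp add: mult_right_mono)
    qed
    also have "\<dots> \<le> cR * d ^ 3 * (A * C0 * (\<eta> * s)\<^sup>2 + (\<eta> * s) powr (- (?N - 2)) * I) + B * (d ^ 4 * (C0 * s\<^sup>2))"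
      unfolding rep using norm_triangle_ineq4 r1 r2 by (meson add_mono order_trans)
    also have "\<dots> = d ^ 4 * (cR * C0 * (A * \<eta>\<^sup>2) + cR * (\<eta> powr (- (?N - 2)) * s powr (- ?N) * I) + C0 * (B * s\<^sup>2))"
    proof -
      have "s powr (- (?N - 2)) = s powr (- ?N + 2)" by (simp add: algebra_simps)
      also have "\<dots> = s powr (- ?N) * s\<^sup>2" using s by (subst powr_add) simp
      finally have e: "(\<eta> * s) powr (- (?N - 2)) = \<eta> powr (- (?N - 2)) * (s powr (- ?N) * s\<^sup>2)"
        using eta s by (simp add: powr_mult)
      have d4: "d ^ 4 = d ^ 3 * s\<^sup>2" by (simp add: d_def power_mult[symmetric] power_add[symmetric])
      show ?thesis unfolding e d4 by (simp add: power_mult_distrib algebra_simps)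
    qed
    finally have "d ^ 4 * (c0 * norm (u x)) \<le> d ^ 4 * (cR * C0 * (A * \<eta>\<^sup>2) + cR * (\<eta> powr (- (?N - 2)) * s powr (- ?N) * I) + C0 * (B * s\<^sup>2))"
      by (simp add: mult_ac)
    then have "c0 * norm (u x) \<le> cR * C0 * (A * \<eta>\<^sup>2) + cR * (\<eta> powr (- (?N - 2)) * s powr (- ?N) * I) + C0 * (B * s\<^sup>2)"
      using d by simp
    also have "\<dots> \<le> (cR * C0 + cR + C0) * (A * \<eta>\<^sup>2) + (cR * C0 + cR + C0) * (\<eta> powr (- (?N - 2)) * s powr (- ?N) * I)
       + (cR * C0 + cR + C0) * (B * s\<^sup>2)"
    proof -
      have "I \<ge> 0" unfolding I_def by (intro Bochner_Integration.integral_nonneg) auto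
      then show ?thesis using cR C0(1) AB by (intro add_mono mult_right_mono) auto
    qed
    also have "\<dots> = c0 * (K * (A * \<eta>\<^sup>2 + \<eta> powr (- (?N - 2)) * s powr (- ?N) * I + B * s\<^sup>2))"
    proof -
      have cK: "c0 * K = cR * C0 + cR + C0" using c0(1) by (simp add: K_def)
      show ?thesis unfolding cK[symmetric] by (simp only: distrib_left mult.assoc)
    qed
    finally show ?thesis using c0(1) unfolding I_def by simp
  qed
  then show thesis by (rule that[OF K])
qed

text \<open>Point picking: at a maximum z of Q the value M = |u z| controls |u| by 2^m M on the ball
  of half the distance to the boundary. There the mean value inequality has absorbable terms and
  yields M s^m < \<tau> for every admissible radius s, as the energy is scale invariant. The radius
  \<theta> M^(-1/m) would violate this, so the distance to the boundary is short on this scale,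
  which bounds Q.\<close>

lemma small_energy_decay:
  fixes e C :: real
  assumes dim: "DIM('a::euclidean_space) \<ge> 3" and C: "C \<ge> 0" and e: "e > 0"
  defines "N \<equiv> real DIM('a)"
  obtains E0 where "E0 > 0" "\<And>(u :: 'a \<Rightarrow> 'b::euclidean_space) S x \<rho>.
    \<lbrakk>open S; C_k_on 2 S u; \<rho> > 0; cball x \<rho> \<subseteq> S;
     \<forall>y\<in>cball x \<rho>. norm (vlaplacian u y) \<le> C * norm (u y) powr ((N + 2) / (N - 2));
     (LBINT y. indicator (cball x \<rho>) y * norm (u y) powr (2 * N / (N - 2))) \<le> E0\<rbrakk> \<Longrightarrow>
    \<rho> powr (N / 2 - 1) * norm (u x) \<le> e"
proof -
  define m where "m = N / 2 - 1"
  define P where "P = 2 * N / (N - 2)"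
  define q where "q = (N + 2) / (N - 2)"
  have N: "N \<ge> 3" using dim by (simp add: N_def)
  have m: "m > 0" using N by (simp add: m_def)
  have m2: "m = (N - 2) / 2" by (simp add: m_def field_simps)
  \<comment> \<open>The next two facts are criticality: the energy and the equation scale in the
    same way.\<close>
  have mP: "m * P = N" using N by (simp add: m2 P_def)
  have mq: "q - 2 / m = 1" using N by (simp add: m2 q_def diff_divide_distrib[symmetric])
  have P1: "P > 1" using N by (simp add: P_def field_simps)
  have q0: "q > 0" using N by (simp add: q_def)
  obtain K where K: "K > 0" "\<And>(u :: 'a \<Rightarrow> 'b) S x s A B \<eta>.
    \<lbrakk>open S; C_k_on 2 S u; s > 0; cball x s \<subseteq> S; \<eta> > 0;
     \<forall>y\<in>cball x s. norm (u y) \<le> A \<and> norm (vlaplacian u y) \<le> B\<rbrakk> \<Longrightarrow>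
    norm (u x) \<le> K * (A * \<eta>\<^sup>2 + \<eta> powr (- (N - 2)) * s powr (- N) *
       (LBINT y. indicator (cball x s) y * norm (u y)) + B * s\<^sup>2)"
    by (rule mean_value_inequality[OF dim, where 'b = 'b, folded N_def]) (rule that)
  \<comment> \<open>The loss on the half-distance ball, (2 \<sigma>)^m against \<sigma>^m.\<close>
  define L where "L = 2 powr m"
  have L: "L > 0" by (simp add: L_def)
  \<comment> \<open>\<eta>, \<theta> and k are chosen so that the sup term, the Laplacian term and
    the low part of the integral of |u| cost M/8 each. The \<open>+ 1\<close> in \<theta> covers C =
    0.\<close>
  define \<eta> where "\<eta> = sqrt (1 / (8 * K * L))"
  have eta: "\<eta> > 0" "K * (L * \<eta>\<^sup>2) \<le> 1 / 8" using K L by (auto simp: \<eta>_def)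
  define \<theta> where "\<theta> = sqrt (1 / (8 * K * (C * L powr q + 1)))"
  have CL: "C * L powr q + 1 > 0" using C by (simp add: add_nonneg_pos)
  have theta: "\<theta> > 0" "K * (C * L powr q * \<theta>\<^sup>2) \<le> 1 / 8"
  proof -
    show "\<theta> > 0" using K CL by (simp add: \<theta>_def)
    have "\<theta>\<^sup>2 = 1 / (8 * K * (C * L powr q + 1))" using K CL by (simp add: \<theta>_def)
    then have "K * (C * L powr q * \<theta>\<^sup>2) = C * L powr q / (8 * (C * L powr q + 1))" using K(1) by simp
    also have "\<dots> \<le> 1 / 8" using CL by (simp add: divide_simps)
    finally show "K * (C * L powr q * \<theta>\<^sup>2) \<le> 1 / 8" .
  qed
  define w where "w = unit_ball_vol N"
  have w: "w > 0" using N by (simp add: w_def)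
  define H where "H = K * \<eta> powr (- (N - 2))"
  have H: "H > 0" using K eta by (simp add: H_def)
  define k where "k = 1 / (8 * H * w)"
  have k: "k > 0" "H * (k * w) \<le> 1 / 8" using H w by (auto simp: k_def)
  define K4 where "K4 = 2 * (H * k powr (1 - P))"
  have K4: "K4 > 0" using H k by (simp add: K4_def)
  \<comment> \<open>The first entry rules out the radius \<open>s1\<close> below, the second gives
    the claim through Q z = 2^m M \<sigma>^m.\<close>
  define \<tau> where "\<tau> = min (\<theta> powr m) (e / 2 powr m)"
  have tau: "\<tau> > 0" using theta e by (simp add: \<tau>_def)
  define E0 where "E0 = \<tau> powr P / (2 * K4)"
  have E0: "E0 > 0" "K4 * E0 < \<tau> powr P" using tau K4 by (auto simp: E0_def)
  have "\<rho> powr m * norm (u x) \<le> e"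
    if S: "open S" and u: "C_k_on 2 S u" and rho: "\<rho> > 0" and sub: "cball x \<rho> \<subseteq> S"
    and eq: "\<forall>y\<in>cball x \<rho>. norm (vlaplacian u y) \<le> C * norm (u y) powr q"
    and E: "(LBINT y. indicator (cball x \<rho>) y * norm (u y) powr P) \<le> E0"
    for u :: "'a \<Rightarrow> 'b" and S x \<rho>
  proof -
    have uc: "continuous_on (cball x \<rho>) u"
      using C_k_on_imp_continuous_on[OF u] sub continuous_on_subset by blast
    \<comment> \<open>The weight vanishes on the bounding sphere, so a maximum with positive value
      lies in the interior.\<close>
    define Q where "Q y = (\<rho> - dist x y) powr m * norm (u y)" for y
    have "continuous_on (cball x \<rho>) Q" unfolding Q_def
      using m by (intro continuous_intros continuous_on_powr' uc) auto
    then obtain z where z: "z \<in> cball x \<rho>" "\<And>y. y \<in> cball x \<rho> \<Longrightarrow> Q y \<le> Q z"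
      using continuous_attains_sup[of "cball x \<rho>" Q] rho by auto
    define M where "M = norm (u z)"
    define \<sigma> where "\<sigma> = (\<rho> - dist x z) / 2"
    have Qx: "\<rho> powr m * norm (u x) \<le> Q z" using z(2)[of x] rho by (simp add: Q_def)
    have Qz: "Q z = (2 * \<sigma>) powr m * M"
    proof -
      have "2 * \<sigma> = \<rho> - dist x z" by (simp add: \<sigma>_def)
      then show ?thesis by (simp add: Q_def M_def)
    qed
    have s0: "\<sigma> \<ge> 0" using z(1) by (simp add: \<sigma>_def)
    show ?thesis
    proof (cases "M = 0 \<or> \<sigma> = 0")
      case True
      then have "Q z = 0" using Qz by auto
      then show ?thesis using Qx e by simp
    next
      case False
      then have M: "M > 0" and sg: "\<sigma> > 0" using s0 by (auto simp: M_def)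
      have subz: "cball z \<sigma> \<subseteq> cball x \<rho>"
      proof
        fix y assume "y \<in> cball z \<sigma>"
        then show "y \<in> cball x \<rho>" using dist_triangle[of x y z] s0 by (simp add: \<sigma>_def)
      qed
      have uM: "norm (u y) \<le> L * M" if y: "y \<in> cball z \<sigma>" for y
      proof -
        have "\<rho> - dist x y \<ge> \<sigma>" using y dist_triangle[of x y z] by (simp add: \<sigma>_def)
        then have "\<sigma> powr m * norm (u y) \<le> Q y" unfolding Q_def
          using sg m by (intro mult_right_mono powr_mono2) auto
        also have "\<dots> \<le> Q z" using z(2) subz y by blast
        also have "\<dots> = \<sigma> powr m * (L * M)" unfolding Qz L_def using sg by (simp add: powr_mult)
        finally show ?thesis using sg by simp
      qed
      have vM: "norm (vlaplacian u y) \<le> C * (L * M) powr q" if y: "y \<in> cball z \<sigma>" for y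
      proof -
        have "norm (vlaplacian u y) \<le> C * norm (u y) powr q" using eq subz y by blast
        also have "\<dots> \<le> C * (L * M) powr q"
          using uM[OF y] C q0 by (intro mult_left_mono powr_mono2) auto
        finally show ?thesis .
      qed
      have main: "M * s powr m < \<tau>" if s: "s > 0" "s \<le> \<sigma>" "s \<le> \<theta> * M powr (- (1 / m))" for s
      proof -
        have subs: "cball z s \<subseteq> cball z \<sigma>" using s by (intro subset_cball)
        have subs': "cball z s \<subseteq> S" using subs subz sub by blast
        define I where "I = (LBINT y. indicator (cball z s) y * norm (u y))"
        have mv: "M \<le> K * (L * M * \<eta>\<^sup>2 + \<eta> powr (- (N - 2)) * s powr (- N) * I + C * (L * M) powr q * s\<^sup>2)"
          unfolding M_def I_def using uM vM subs
          by (intro K(2)[OF S u s(1) subs' eta(1)]) (auto simp: M_def)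
        \<comment> \<open>Smallness is known for the P-th power of |u|, while the mean value
          inequality asks for the L^1 norm. Splitting |u| at a level proportional to M lets the low
          part be absorbed.\<close>
        define l where "l = k * M"
        have l: "l > 0" using k M by (simp add: l_def)
        have young: "t \<le> l + l powr (1 - P) * t powr P" if "t \<ge> 0" for t
        proof (cases "t \<le> l")
          case False
          then have t: "t > l" by simp
          have "t = t powr (1 - P) * t powr P" using t l by (subst powr_add[symmetric]) simp
          also have "\<dots> \<le> l powr (1 - P) * t powr P"
            using t l P1 by (intro mult_right_mono powr_mono2') auto
          finally show ?thesis using l by simp
        next
          case True
          have "0 \<le> l powr (1 - P) * t powr P" by simp
          then show ?thesis using True by linarith
        qed
        have ccu: "continuous_on A (\<lambda>y. norm (u y) powr P)" if "A \<subseteq> S" for A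
          using C_k_on_imp_continuous_on[OF u] that P1
          by (intro continuous_on_powr' continuous_intros) (auto intro: continuous_on_subset)
        have iP: "integrable lborel (\<lambda>y. indicator A y *\<^sub>R (norm (u y) powr P))" if "A \<subseteq> S" "compact A" for A
          by (rule borel_integrable_compact[OF that(2) ccu[OF that(1)]])
        have iN: "integrable lborel (\<lambda>y. indicator (cball z s) y *\<^sub>R norm (u y))"
          by (rule borel_integrable_compact)
             (use C_k_on_imp_continuous_on[OF u] subs' in \<open>auto intro!: continuous_intros intro: continuous_on_subset\<close>)
        have i1: "integrable lborel (\<lambda>y. indicator (cball z s) y *\<^sub>R l)"
          by (rule borel_integrable_compact) auto
        have "I \<le> (LBINT y. indicator (cball z s) y *\<^sub>R l + l powr (1 - P) * (indicator (cball x \<rho>) y *\<^sub>R (norm (u y) powr P)))"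
          unfolding I_def real_scaleR_def[symmetric]
        proof (rule integral_mono[OF iN])
          show "integrable lborel (\<lambda>y. indicator (cball z s) y *\<^sub>R l + l powr (1 - P) *\<^sub>R (indicator (cball x \<rho>) y *\<^sub>R (norm (u y) powr P)))"
            using i1 iP[OF sub compact_cball] by (intro Bochner_Integration.integrable_add integrable_scaleR_right)
          fix y
          show "indicator (cball z s) y *\<^sub>R norm (u y) \<le> indicator (cball z s) y *\<^sub>R l + l powr (1 - P) *\<^sub>R (indicator (cball x \<rho>) y *\<^sub>R (norm (u y) powr P))"
            using young[of "norm (u y)"] subsetD[OF order_trans[OF subs subz], of y]
            by (cases "y \<in> cball z s") auto
        qed
        also have "\<dots> = measure lborel (cball z s) * l + l powr (1 - P) * (LBINT y. indicator (cball x \<rho>) y * norm (u y) powr P)"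
        proof -
          have i2: "integrable lborel (\<lambda>y. l powr (1 - P) * (indicator (cball x \<rho>) y *\<^sub>R (norm (u y) powr P)))"
            using iP[OF sub compact_cball] by simp
          show ?thesis by (subst Bochner_Integration.integral_add[OF i1 i2]) simp
        qed
        also have "\<dots> \<le> measure lborel (cball z s) * l + l powr (1 - P) * E0"
          using E by (intro add_left_mono mult_left_mono) auto
        also have "measure lborel (cball z s) = w * s powr N"
          using s by (simp add: content_cball w_def N_def powr_realpow)
        finally have Ib: "I \<le> w * s powr N * l + l powr (1 - P) * E0" .
        have sN: "s powr (- N) * s powr N = 1" using s by (simp flip: powr_add)
        have t1: "K * (L * M * \<eta>\<^sup>2) \<le> M / 8"
          using mult_right_mono[OF eta(2), of M] M by (simp add: mult_ac)
        have t2: "K * (\<eta> powr (- (N - 2)) * s powr (- N) * I) \<le> M / 8 + H * k powr (1 - P) * (M powr (1 - P) * s powr (- N) * E0)"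
        proof -
          have "K * (\<eta> powr (- (N - 2)) * s powr (- N) * I) = H * s powr (- N) * I" by (simp add: H_def)
          also have "\<dots> \<le> H * s powr (- N) * (w * s powr N * l + l powr (1 - P) * E0)"
            using Ib H by (intro mult_left_mono) auto
          also have "\<dots> = H * (k * w) * M * (s powr (- N) * s powr N) + H * k powr (1 - P) * (M powr (1 - P) * s powr (- N) * E0)"
            using k M by (simp add: l_def powr_mult algebra_simps)
          also have "\<dots> \<le> M / 8 + H * k powr (1 - P) * (M powr (1 - P) * s powr (- N) * E0)"
            unfolding sN using mult_right_mono[OF k(2), of M] M by simp
          finally show ?thesis .
        qed
        have t3: "K * (C * (L * M) powr q * s\<^sup>2) \<le> M / 8"
        proof -
          have "s\<^sup>2 \<le> (\<theta> * M powr (- (1 / m)))\<^sup>2" using s by (intro power_mono) auto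
          also have "\<dots> = \<theta>\<^sup>2 * M powr (- (2 / m))"
            using M by (simp add: power_mult_distrib powr_power)
          finally have "M powr q * s\<^sup>2 \<le> M powr q * (\<theta>\<^sup>2 * M powr (- (2 / m)))"
            by (intro mult_left_mono) auto
          also have "\<dots> = \<theta>\<^sup>2 * (M powr q * M powr (- (2 / m)))" by simp
          also have "M powr q * M powr (- (2 / m)) = M powr (q - 2 / m)" by (simp flip: powr_add)
          also have "\<dots> = M" unfolding mq using M by simp
          finally have "K * (C * L powr q) * (M powr q * s\<^sup>2) \<le> K * (C * L powr q) * (\<theta>\<^sup>2 * M)"
            using K(1) C by (intro mult_left_mono) auto
          also have "\<dots> = K * (C * L powr q * \<theta>\<^sup>2) * M" by simp
          also have "\<dots> \<le> 1 / 8 * M" using theta(2) M by (intro mult_right_mono) auto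
          finally show ?thesis using L M by (simp add: powr_mult mult_ac)
        qed
        have "M \<le> K * (L * M * \<eta>\<^sup>2) + K * (\<eta> powr (- (N - 2)) * s powr (- N) * I) + K * (C * (L * M) powr q * s\<^sup>2)"
          using mv by (simp only: distrib_left)
        \<comment> \<open>Three terms of size M/8 are absorbed on the left.\<close>
        then have "M / 2 \<le> H * k powr (1 - P) * (M powr (1 - P) * s powr (- N) * E0)"
          using t1 t2 t3 M by linarith
        then have "M \<le> K4 * E0 * (M powr (1 - P) * s powr (- N))" by (simp add: K4_def mult_ac)
        then have "M * (M powr (P - 1) * s powr N) \<le> K4 * E0 * (M powr (1 - P) * s powr (- N)) * (M powr (P - 1) * s powr N)"
          using M by (intro mult_right_mono) auto
        also have "\<dots> = K4 * E0 * ((M powr (1 - P) * M powr (P - 1)) * (s powr (- N) * s powr N))" by simp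
        also have "\<dots> = K4 * E0" unfolding sN using M by (simp flip: powr_add)
        also have "M * (M powr (P - 1) * s powr N) = (M * s powr m) powr P"
        proof -
          have "M * M powr (P - 1) = M powr P" using M powr_add[of M 1 "P - 1"] by simp
          then show ?thesis using M s by (simp add: powr_mult powr_powr mP mult.assoc[symmetric])
        qed
        finally have lt: "(M * s powr m) powr P < \<tau> powr P" using E0(2) by linarith
        show ?thesis
        proof (rule powr_less_cancel2[OF _ _ tau lt])
          show "0 < P" using P1 by simp
          show "0 < M * s powr m" using M s(1) by simp
        qed
      qed
      define s1 where "s1 = \<theta> * M powr (- (1 / m))"
      have s1: "s1 > 0" using theta M by (simp add: s1_def)
      have "M * s1 powr m = \<theta> powr m"
      proof -
        have "(M powr (- (1 / m))) powr m = inverse M"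
          unfolding powr_powr using m M by (simp add: powr_minus)
        then show ?thesis using theta M by (simp add: s1_def powr_mult)
      qed
      \<comment> \<open>At radius \<open>s1\<close> the bound would read \<theta>^m < \<tau>. So
        \<sigma> < \<open>s1\<close>, and \<sigma> itself is admissible.\<close>
      then have "\<not> s1 \<le> \<sigma>" using main[of s1] s1 by (auto simp: s1_def \<tau>_def)
      then have "M * \<sigma> powr m < \<tau>" using main[of \<sigma>] sg by (auto simp: s1_def)
      also have "\<tau> \<le> e / 2 powr m" by (simp add: \<tau>_def)
      finally have "2 powr m * (M * \<sigma> powr m) \<le> e" by (simp add: field_simps)
      then have "Q z \<le> e" unfolding Qz using sg by (simp add: powr_mult mult_ac)
      then show ?thesis using Qx by linarith
    qed
  qed
  then show thesis unfolding m_def P_def q_def by (rule that[OF E0(1)])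
qed

section \<open>Boundedness by barriers\<close>

text \<open>The power |x|^t is strictly superharmonic for 2 - N < t < 0, and minus a positive power
  is so too. The coefficients are what the barriers set against the potential.\<close>

lemma norm_powr_laplacian:
  fixes t :: real
  shows "C_k_on 2 (- {0}) (\<lambda>y::'a::euclidean_space. norm y powr t)"
    and "x \<noteq> 0 \<Longrightarrow> vlaplacian (\<lambda>y::'a. norm y powr t) x = t * (t + real DIM('a) - 2) * norm x powr (t - 2)"
proof -
  have pw: "((\<lambda>s. s powr a) has_real_derivative a * s powr (a - 1)) (at s)" if "s \<in> {0<..}" for s a :: real
    using has_real_derivative_powr[of s a] that by simp
  have d2: "((\<lambda>s. (t / 2) * s powr (t / 2 - 1)) has_real_derivative (t / 2) * ((t / 2 - 1) * s powr (t / 2 - 1 - 1))) (at s)"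
    if "s \<in> {0<..}" for s :: real
    by (rule DERIV_cmult[OF pw[OF that]])
  have c: "continuous_on {0<..} (\<lambda>s::real. (t / 2) * ((t / 2 - 1) * s powr (t / 2 - 1 - 1)))"
    by (intro continuous_intros) auto
  have eq: "(\<lambda>y::'a. norm y powr t) = (\<lambda>y. ((y - 0) \<bullet> (y - 0)) powr (t / 2))"
  proof
    fix y :: 'a
    show "norm y powr t = ((y - 0) \<bullet> (y - 0)) powr (t / 2)"
    proof (cases "y = 0")
      case False
      then have "y \<bullet> y = norm y powr 2" by (simp add: power2_norm_eq_inner)
      then show ?thesis by (simp add: powr_powr del: powr_numeral)
    qed simp
  qed
  have U: "{y::'a. (y - 0) \<bullet> (y - 0) \<in> {0<..}} = - {0}" by auto
  note rad = radial_derivatives[where I = "{0<..}" and p = "0::'a", OF open_greaterThan pw d2 c, unfolded U]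
  show "C_k_on 2 (- {0}) (\<lambda>y::'a. norm y powr t)" unfolding eq by (rule rad(2))
  assume x: "x \<noteq> 0"
  define s where "s = x \<bullet> x"
  have s: "s > 0" using x by (simp add: s_def)
  have "vlaplacian (\<lambda>y::'a. norm y powr t) x = 4 * s * ((t / 2) * ((t / 2 - 1) * s powr (t / 2 - 1 - 1)))
     + 2 * real DIM('a) * ((t / 2) * s powr (t / 2 - 1))"
    unfolding eq using rad(4)[of x] x by (simp add: s_def)
  also have "4 * s * ((t / 2) * ((t / 2 - 1) * s powr (t / 2 - 1 - 1))) = 4 * ((t / 2) * ((t / 2 - 1) * s powr (t / 2 - 1)))"
    using s powr_add[of s 1 "t / 2 - 1 - 1"] by simp
  also have "4 * ((t / 2) * ((t / 2 - 1) * s powr (t / 2 - 1))) + 2 * real DIM('a) * ((t / 2) * s powr (t / 2 - 1))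
    = t * (t + real DIM('a) - 2) * s powr (t / 2 - 1)" by (simp add: field_simps)
  also have "s powr (t / 2 - 1) = norm x powr (t - 2)"
  proof -
    have "s = norm x powr 2" using x by (simp add: s_def power2_norm_eq_inner)
    then show ?thesis by (simp add: powr_powr algebra_simps del: powr_numeral)
  qed
  finally show "vlaplacian (\<lambda>y::'a. norm y powr t) x = t * (t + real DIM('a) - 2) * norm x powr (t - 2)" .
qed

text \<open>If the ratio |V|/\<phi> exceeds 1 somewhere, it has an interior maximum K > 1 at some z.
  There the scalar e . V - K \<phi>, with e the direction of V(z), is maximal, so its Laplacian is
  at most 0, against \<open>pde\<close>. The non-smooth function |V| is never
  differentiated.\<close>

lemma barrier_comparison:
  fixes V :: "'a::euclidean_space \<Rightarrow> 'b::euclidean_space" and \<phi> :: "'a \<Rightarrow> real"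
  assumes S: "open S" "cball 0 r - {0} \<subseteq> S" and V: "C_k_on 2 S V" and phi: "C_k_on 2 (- {0}) \<phi>"
    and pos: "\<And>x. x \<noteq> 0 \<Longrightarrow> norm x \<le> r \<Longrightarrow> \<phi> x > 0"
    and bdry: "\<And>x. norm x = r \<Longrightarrow> norm (V x) \<le> \<phi> x"
    and near: "\<rho> > 0" "\<And>x. x \<noteq> 0 \<Longrightarrow> norm x < \<rho> \<Longrightarrow> norm (V x) \<le> \<phi> x"
    and pde: "\<And>x. x \<noteq> 0 \<Longrightarrow> norm x < r \<Longrightarrow> norm (V x) > \<phi> x \<Longrightarrow>
       norm (vlaplacian V x) * \<phi> x < - vlaplacian \<phi> x * norm (V x)"
    and x: "x \<noteq> 0" "norm x \<le> r"
  shows "norm (V x) \<le> \<phi> x"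
proof (rule ccontr)
  assume neg: "\<not> norm (V x) \<le> \<phi> x"
  \<comment> \<open>The inner boundary lies in the region of \<open>near\<close>, so a maximal ratio
    above 1 cannot sit there.\<close>
  define Q where "Q = cball (0::'a) r - ball 0 (\<rho> / 2)"
  have Q: "compact Q" unfolding Q_def by (intro compact_diff) auto
  have Q0: "Q \<subseteq> S" "Q \<subseteq> - {0}" using S(2) near(1) by (auto simp: Q_def)
  have xQ: "x \<in> Q" using x neg near(2)[of x] near(1) by (force simp: Q_def)
  define w where "w y = norm (V y) / \<phi> y" for y
  have posQ: "\<phi> y > 0" if "y \<in> Q" for y
  proof -
    have "y \<noteq> 0" "norm y \<le> r" using that near(1) by (auto simp: Q_def)
    then show ?thesis by (rule pos)
  qed
  have "continuous_on Q w" unfolding w_def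
    using C_k_on_imp_continuous_on[OF V] C_k_on_imp_continuous_on[OF phi] Q0 posQ
    by (intro continuous_intros) (auto intro: continuous_on_subset simp: less_imp_neq[symmetric])
  then obtain z where z: "z \<in> Q" "\<And>y. y \<in> Q \<Longrightarrow> w y \<le> w z"
    using continuous_attains_sup[of Q w] Q xQ by blast
  define K where "K = w z"
  have "w x > 1" using neg posQ[OF xQ] by (simp add: w_def)
  then have K: "K > 1" using z(2)[OF xQ] by (simp add: K_def)
  have Vz: "norm (V z) = K * \<phi> z" using posQ[OF z(1)] by (simp add: K_def w_def)
  have Vbig: "norm (V z) > \<phi> z" using Vz K posQ[OF z(1)] by simp
  have z0: "z \<noteq> 0" using z(1) Q0 by auto
  have zr: "norm z < r" using z(1) bdry[of z] Vbig by (force simp: Q_def)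
  have zp: "norm z \<ge> \<rho>" using near(2)[OF z0] Vbig by force
  define T where "T = ball (0::'a) r - cball 0 (\<rho> / 2)"
  have T: "open T" "z \<in> T" "T \<subseteq> Q" using zr zp near(1) by (auto simp: T_def Q_def)
  have TS: "T \<subseteq> S" "T \<subseteq> - {0}" using T(3) Q0 by auto
  \<comment> \<open>Freezing the direction of V at z: e . V is at most |V|, with equality at
    z.\<close>
  define e where "e = (1 / norm (V z)) *\<^sub>R V z"
  have V0: "norm (V z) > 0" using Vbig posQ[OF z(1)] by linarith
  have e: "norm e = 1" "e \<bullet> V z = norm (V z)" using V0
    by (auto simp: e_def power2_norm_eq_inner[symmetric] power2_eq_square)
  define g where "g y = e \<bullet> V y + (- K) *\<^sub>R \<phi> y" for y
  note VT = C_k_on_subset[OF V TS(1)] and pT = C_k_on_subset[OF phi TS(2)]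
  have C1: "C_k_on 2 T (\<lambda>y. e \<bullet> V y)" and C2: "C_k_on 2 T (\<lambda>y. (- K) *\<^sub>R \<phi> y)"
    by (rule C_k_on_bounded_linear[OF bounded_linear_inner_right T(1) VT]
             C_k_on_bounded_linear[OF bounded_linear_scaleR_right T(1) pT])+
  have gC: "C_k_on 2 T g" unfolding g_def by (rule C_k_on_add[OF T(1) C1 C2])
  have gv: "vlaplacian g z = e \<bullet> vlaplacian V z + (- K) *\<^sub>R vlaplacian \<phi> z"
    unfolding g_def vlaplacian_add[OF T(1,2) C1 C2]
    by (simp only: vlaplacian_bounded_linear[OF bounded_linear_inner_right T(1,2) VT]
        vlaplacian_bounded_linear[OF bounded_linear_scaleR_right T(1,2) pT])
  have "vlaplacian g z \<le> 0"
  proof (rule vlaplacian_nonpos_at_max[OF T(1,2) gC])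
    fix y assume y: "y \<in> T"
    then have yQ: "y \<in> Q" using T(3) by auto
    have "e \<bullet> V y \<le> norm (V y)" using norm_cauchy_schwarz[of e "V y"] e(1) by simp
    moreover have "norm (V y) \<le> K * \<phi> y" using z(2)[OF yQ] posQ[OF yQ] by (simp add: w_def[of y] K_def divide_le_eq)
    ultimately show "g y \<le> g z" using e(2) Vz by (simp add: g_def)
  qed
  then have 1: "e \<bullet> vlaplacian V z \<le> K * vlaplacian \<phi> z" using gv by simp
  have "- norm (vlaplacian V z) \<le> e \<bullet> vlaplacian V z"
    using Cauchy_Schwarz_ineq2[of e "vlaplacian V z"] e(1) by simp
  with 1 have "- (K * vlaplacian \<phi> z) \<le> norm (vlaplacian V z)" by simp
  then have "- (K * vlaplacian \<phi> z) * \<phi> z \<le> norm (vlaplacian V z) * \<phi> z"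
    using posQ[OF z(1)] by (intro mult_right_mono) auto
  moreover have "- (K * vlaplacian \<phi> z) * \<phi> z = - vlaplacian \<phi> z * norm (V z)" using Vz by simp
  ultimately show False using pde[OF z0 zr Vbig] by linarith
qed

text \<open>Removes the \<eta> terms of the barriers at a fixed point.\<close>

lemma le_of_le_add_mult:
  fixes a b c :: real
  assumes "\<And>e. e > 0 \<Longrightarrow> a \<le> b + e * c" "c \<ge> 0"
  shows "a \<le> b"
proof (rule field_le_epsilon)
  fix e :: real assume e: "e > 0"
  have "e / (c + 1) > 0" using e assms(2) by simp
  from assms(1)[OF this] have "a \<le> b + e * (c / (c + 1))" by simp
  also have "e * (c / (c + 1)) \<le> e * 1" using e assms(2) by (intro mult_left_mono) auto
  finally show "a \<le> b + e" by simp
qed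

lemma sphere_bound:
  fixes V :: "'a::euclidean_space \<Rightarrow> 'b::real_normed_vector"
  assumes "continuous_on S V" "cball 0 r - {0} \<subseteq> S" "r > 0"
  obtains M where "M > 0" "\<And>x. norm x = r \<Longrightarrow> norm (V x) \<le> M"
proof -
  have "sphere 0 r \<subseteq> S" using assms by auto
  then have "bounded (V ` sphere 0 r)"
    using assms(1) by (intro compact_imp_bounded compact_continuous_image) (auto intro: continuous_on_subset)
  then obtain M where "M > 0" "\<And>y. y \<in> V ` sphere 0 r \<Longrightarrow> norm y \<le> M" unfolding bounded_pos by blast
  then show thesis by (intro that[of M]) auto
qed

text \<open>A bound |V| <= K |x|^(-a) makes the potential |V|^(2/m) of order |x|^(-2a/m). For a = m
  this is critical and K must be small; for a = m/2 it is only of order |x|^(-1), which a correction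
  to a constant absorbs. Each barrier contains \<eta> times a power more singular than the bound
  known so far, which settles the comparison near 0; then \<eta> -> 0.\<close>

lemma bounded_near_singularity:
  fixes V :: "'a::euclidean_space \<Rightarrow> 'b::euclidean_space"
  defines "N \<equiv> real DIM('a)"
  assumes dim: "DIM('a) \<ge> 3" and V: "C_k_on 2 (ball 0 1 - {0}) V" and C: "C \<ge> 0"
    and pde: "\<And>x. x \<in> ball 0 1 - {0} \<Longrightarrow> norm (vlaplacian V x) \<le> C * norm (V x) powr ((N + 2) / (N - 2))"
    and E: "integrable lborel (\<lambda>x. indicator (ball 0 1 - {0}) x * norm (V x) powr (2 * N / (N - 2)))"
  obtains r B where "0 < r" "r < 1" "\<And>x. x \<noteq> 0 \<Longrightarrow> norm x \<le> r \<Longrightarrow> norm (V x) \<le> B"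
proof -
  define m where "m = N / 2 - 1"
  define P where "P = 2 * N / (N - 2)"
  define q where "q = (N + 2) / (N - 2)"
  have N: "N \<ge> 3" using dim by (simp add: N_def)
  have m: "m > 0" using N by (simp add: m_def)
  have m2: "m = (N - 2) / 2" by (simp add: m_def field_simps)
  have mq: "q = 2 / m + 1" using N by (simp add: m2 q_def field_simps)
  have N2m: "N - 2 = 2 * m" by (simp add: m2)
  define S where "S = ball (0::'a) 1 - {0}"
  have S: "open S" by (auto simp: S_def)
  have Vc: "continuous_on S V" using C_k_on_imp_continuous_on[OF V] by (simp add: S_def)
  have pq: "norm (vlaplacian V x) \<le> (C * (norm (V x) powr (2 / m))) * norm (V x)" if "x \<in> S" for x
    using pde[OF that[unfolded S_def]] unfolding q_def[symmetric] mq
    by (cases "V x = 0") (simp_all add: powr_add mult.assoc)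

  \<comment> \<open>The energy on small balls tends to zero, so V decays faster than the scale-invariant rate.\<close>
  have decay: "\<exists>r1>0. r1 < 1 \<and> (\<forall>x. x \<noteq> 0 \<longrightarrow> norm x \<le> r1 \<longrightarrow> norm (V x) \<le> e * norm x powr (- m))" if e: "e > 0" for e
  proof -
    \<comment> \<open>The decay lemma is applied on the ball of radius |x|/2, whence the factor
      2^m.\<close>
    have epos: "e / 2 powr m > 0" using e by simp
    obtain E0 where E0: "E0 > 0" "\<And>(u :: 'a \<Rightarrow> 'b) S x \<rho>.
      \<lbrakk>open S; C_k_on 2 S u; \<rho> > 0; cball x \<rho> \<subseteq> S;
       \<forall>y\<in>cball x \<rho>. norm (vlaplacian u y) \<le> C * norm (u y) powr ((N + 2) / (N - 2));
       (LBINT y. indicator (cball x \<rho>) y * norm (u y) powr (2 * N / (N - 2))) \<le> E0\<rbrakk> \<Longrightarrow>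
      \<rho> powr (N / 2 - 1) * norm (u x) \<le> e / 2 powr m"
      by (rule small_energy_decay[OF dim C epos, where 'b = 'b, folded N_def]) (rule that)
    define h where "h x = indicator S x * norm (V x) powr P" for x
    have hi: "integrable lborel h" using E by (simp add: h_def[abs_def] S_def P_def)
    have "(\<lambda>n. (LBINT x. indicator (ball 0 (1 / real (Suc n))) x * h x)) \<longlonglongrightarrow> (LBINT x::'a. 0::real)"
    proof (rule integral_dominated_convergence[OF _ _ hi])
      show "(\<lambda>x. indicator (ball 0 (1 / real (Suc n))) x * h x) \<in> borel_measurable lborel" for n
        using borel_measurable_integrable[OF hi] by (intro borel_measurable_times borel_measurable_indicator) auto
      show "AE x in lborel. norm (indicator (ball 0 (1 / real (Suc n))) x * h x) \<le> h x" for n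
        by (rule AE_I2) (auto simp: h_def indicator_def)
      show "AE x in lborel. (\<lambda>n. indicator (ball 0 (1 / real (Suc n))) x * h x) \<longlonglongrightarrow> 0"
      proof (rule AE_I2)
        fix x :: 'a
        show "(\<lambda>n. indicator (ball 0 (1 / real (Suc n))) x * h x) \<longlonglongrightarrow> 0"
        proof (cases "x = 0")
          case False
          have "(\<lambda>n. 1 / real (Suc n)) \<longlonglongrightarrow> 0"
            using LIMSEQ_inverse_real_of_nat by (simp add: inverse_eq_divide)
          then have "\<forall>\<^sub>F n in sequentially. 1 / real (Suc n) < norm x"
            by (rule order_tendstoD(2)) (use False in simp)
          then have "\<forall>\<^sub>F n in sequentially. indicator (ball 0 (1 / real (Suc n))) x * h x = 0"
            by eventually_elim (simp add: indicator_def)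
          then show ?thesis by (rule tendsto_eventually)
        qed (simp add: h_def S_def)
      qed
    qed simp
    then have "\<forall>\<^sub>F n in sequentially. (LBINT x. indicator (ball 0 (1 / real (Suc n))) x * h x) < E0"
      by (rule order_tendstoD(2)) (use E0 in simp)
    then obtain n where n: "(LBINT x. indicator (ball 0 (1 / real (Suc n))) x * h x) < E0"
      unfolding eventually_sequentially by blast
    define r1 where "r1 = 1 / real (Suc n)"
    have r1: "r1 > 0" "r1 \<le> 1" by (auto simp: r1_def)
    have "norm (V x) \<le> e * norm x powr (- m)" if x: "x \<noteq> 0" "norm x \<le> r1 / 2" for x
    proof -
      define \<rho> where "\<rho> = norm x / 2"
      have rho: "\<rho> > 0" using x by (simp add: \<rho>_def)
      have in_ball: "y \<in> ball 0 r1 \<and> y \<noteq> 0" if "y \<in> cball x \<rho>" for y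
      proof -
        have "norm (x - y) \<le> norm x / 2" using that by (simp add: \<rho>_def dist_norm)
        then show ?thesis using norm_triangle_sub[of y x] norm_triangle_sub[of x y] x r1 norm_minus_commute[of x y]
          by auto
      qed
      then have sub: "cball x \<rho> \<subseteq> S" using r1 by (fastforce simp: S_def)
      have hb: "integrable lborel (\<lambda>x. indicator (ball 0 r1) x * h x)"
        using integrable_mult_indicator[OF _ hi, of "ball 0 r1"] by simp
      have "(LBINT y. indicator (cball x \<rho>) y * norm (V y) powr P)
        \<le> (LBINT x. indicator (ball 0 r1) x * h x)"
      proof (rule integral_mono'[OF hb])
        fix y
        show "indicator (cball x \<rho>) y * norm (V y) powr P \<le> indicator (ball 0 r1) y * h y"
          using in_ball[of y] sub by (auto simp: indicator_def h_def)
        show "0 \<le> indicator (ball 0 r1) y * h y" by (simp add: h_def)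
      qed
      then have en: "(LBINT y. indicator (cball x \<rho>) y * norm (V y) powr P) \<le> E0"
        using n by (simp add: r1_def)
      have "\<rho> powr (N / 2 - 1) * norm (V x) \<le> e / 2 powr m"
      proof (rule E0(2)[OF S V[folded S_def] rho sub])
        show "\<forall>y\<in>cball x \<rho>. norm (vlaplacian V y) \<le> C * norm (V y) powr ((N + 2) / (N - 2))"
          using pde[folded S_def] sub by blast
      qed (use en in \<open>simp add: P_def\<close>)
      then have "\<rho> powr m * norm (V x) \<le> e / 2 powr m" unfolding m_def[symmetric] .
      moreover have "norm x powr m = 2 powr m * \<rho> powr m"
        using x by (simp add: \<rho>_def powr_mult[symmetric])
      ultimately have "norm x powr m * norm (V x) \<le> e" by (simp add: field_simps)
      then show ?thesis using x by (simp add: powr_minus field_simps)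
    qed
    then show ?thesis using r1 by (intro exI[of _ "r1 / 2"]) auto
  qed

  \<comment> \<open>Makes C e1^(2/m) at most 3 m^2/8, half the constant of the first barrier; C + 1
    avoids a division by 0.\<close>
  define e1 where "e1 = (3 * m\<^sup>2 / 8 / (C + 1)) powr (m / 2)"
  have e1: "e1 > 0" using m C by (simp add: e1_def)
  have e1': "C * e1 powr (2 / m) < 3 * m\<^sup>2 / 4"
  proof -
    have "e1 powr (2 / m) = 3 * m\<^sup>2 / 8 / (C + 1)" using m C by (simp add: e1_def powr_powr)
    then have "C * e1 powr (2 / m) = 3 * m\<^sup>2 / 8 * (C / (C + 1))" by simp
    also have "\<dots> \<le> 3 * m\<^sup>2 / 8 * 1" using C by (intro mult_left_mono) auto
    finally have "C * e1 powr (2 / m) \<le> 3 * m\<^sup>2 / 8 * 1" .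
    moreover have "m\<^sup>2 > 0" using m by simp
    ultimately show ?thesis by linarith
  qed
  obtain r1 where r1: "r1 > 0" "r1 < 1" "\<And>x. x \<noteq> 0 \<Longrightarrow> norm x \<le> r1 \<Longrightarrow> norm (V x) \<le> e1 * norm x powr (- m)"
    using decay[OF e1] by blast
  have sub1: "cball 0 r - {0} \<subseteq> S" if "r \<le> r1" for r using that r1 by (auto simp: S_def)
  have powq: "norm (V x) powr (2 / m) \<le> K powr (2 / m) * norm x powr (- (a * (2 / m)))"
    if "norm (V x) \<le> K * norm x powr (- a)" "K \<ge> 0" "x \<noteq> 0" for x K a
  proof -
    have "norm (V x) powr (2 / m) \<le> (K * norm x powr (- a)) powr (2 / m)"
      using that m by (intro powr_mono2) auto
    also have "\<dots> = K powr (2 / m) * norm x powr (- (a * (2 / m)))"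
      using that by (simp add: powr_mult powr_powr)
    finally show ?thesis .
  qed
  obtain M1 where M1: "M1 > 0" "\<And>x. norm x = r1 \<Longrightarrow> norm (V x) \<le> M1"
    using sphere_bound[OF Vc sub1[OF order_refl] r1(1)] by blast
  \<comment> \<open>With this factor the first barrier is at least \<open>M1\<close> on the sphere
    |x| = r1.\<close>
  define B where "B = M1 * r1 powr (m / 2)"
  have B: "B > 0" using M1 r1 by (simp add: B_def)
  have nC: "C_k_on 2 (- {0}) (\<lambda>y::'a. c *\<^sub>R norm y powr t)" for c t :: real
    by (intro C_k_on_bounded_linear[OF bounded_linear_scaleR_right] norm_powr_laplacian) auto
  have nv: "vlaplacian (\<lambda>y::'a. c *\<^sub>R norm y powr t) x = c * (t * (t + 2 * m) * norm x powr (t - 2))"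
    if "x \<noteq> 0" for c t :: real and x :: 'a
  proof -
    have "t + real DIM('a) - 2 = t + 2 * m" using N2m by (simp add: N_def)
    moreover have "x \<in> - {0}" "open (- {0::'a})" using that by auto
    ultimately show ?thesis
      using vlaplacian_bounded_linear[OF bounded_linear_scaleR_right _ _ norm_powr_laplacian(1), of x c t]
        norm_powr_laplacian(2)[OF that, of t] by simp
  qed
  have o: "open (- {0::'a})" by auto

  \<comment> \<open>First barrier: both powers have the same constant in the Laplacian, \<open>3 m^2 / 4\<close>.\<close>
  have V1: "norm (V x) \<le> B * norm x powr (- (m / 2))" if x: "x \<noteq> 0" "norm x \<le> r1" for x
  proof (rule le_of_le_add_mult)
    fix \<eta> :: real assume eta: "\<eta> > 0"
    define \<phi> where "\<phi> y = B *\<^sub>R norm y powr (- (m / 2)) + \<eta> *\<^sub>R norm y powr (- (3 * m / 2))" for y :: 'a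
    have pC: "C_k_on 2 (- {0}) \<phi>" unfolding \<phi>_def by (intro C_k_on_add nC o)
    have pv: "vlaplacian \<phi> y = - (3 * m\<^sup>2 / 4) * norm y powr (- 2) * \<phi> y" if "y \<noteq> 0" for y
    proof -
      have "vlaplacian \<phi> y = B * (- (m / 2) * (- (m / 2) + 2 * m) * norm y powr (- (m / 2) - 2))
        + \<eta> * (- (3 * m / 2) * (- (3 * m / 2) + 2 * m) * norm y powr (- (3 * m / 2) - 2))"
      proof -
        have yy: "y \<in> - {0}" using that by simp
        show ?thesis unfolding \<phi>_def vlaplacian_add[OF o yy nC nC] nv[OF that] by (rule refl)
      qed
      also have "norm y powr (- (m / 2) - 2) = norm y powr (- 2) * norm y powr (- (m / 2))"
        by (subst powr_add[symmetric], rule arg_cong[where f = "\<lambda>t. norm y powr t"]) (simp add: field_simps)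
      also have "norm y powr (- (3 * m / 2) - 2) = norm y powr (- 2) * norm y powr (- (3 * m / 2))"
        by (subst powr_add[symmetric], rule arg_cong[where f = "\<lambda>t. norm y powr t"]) (simp add: field_simps)
      finally have v: "vlaplacian \<phi> y = B * (- (m / 2) * (- (m / 2) + 2 * m) * (norm y powr (- 2) * norm y powr (- (m / 2))))
        + \<eta> * (- (3 * m / 2) * (- (3 * m / 2) + 2 * m) * (norm y powr (- 2) * norm y powr (- (3 * m / 2))))" .
      have pe: "\<phi> y = B * norm y powr (- (m / 2)) + \<eta> * norm y powr (- (3 * m / 2))" by (simp add: \<phi>_def)
      show ?thesis unfolding v pe by (simp add: field_simps power2_eq_square)
    qed
    have pp: "\<phi> y > 0" if "y \<noteq> 0" for y using that B eta by (simp add: \<phi>_def add_pos_pos)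
    \<comment> \<open>Below this radius e1 |y|^(-m) is at most \<eta> |y|^(-3m/2).\<close>
    define \<rho> where "\<rho> = min r1 ((\<eta> / e1) powr (2 / m))"
    have rho: "\<rho> > 0" using r1 eta e1 by (simp add: \<rho>_def)
    have "norm (V x) \<le> \<phi> x"
    proof (rule barrier_comparison[OF S sub1[OF order_refl] V[folded S_def] pC _ _ rho _ _ x])
      show "\<phi> y > 0" if "y \<noteq> 0" for y by (rule pp[OF that])
      show "norm (V y) \<le> \<phi> y" if y: "norm y = r1" for y
      proof -
        have "B * norm y powr (- (m / 2)) = M1" using r1(1) by (simp add: y B_def powr_minus)
        moreover have "\<eta> * norm y powr (- (3 * m / 2)) \<ge> 0" using eta by simp
        ultimately show ?thesis using M1(2)[OF y] by (simp add: \<phi>_def)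
      qed
      show "norm (V y) \<le> \<phi> y" if y: "y \<noteq> 0" "norm y < \<rho>" for y
      proof -
        have "norm y powr (m / 2) \<le> ((\<eta> / e1) powr (2 / m)) powr (m / 2)"
          using y m by (intro powr_mono2) (auto simp: \<rho>_def)
        also have "\<dots> = \<eta> / e1" using m eta e1 by (simp add: powr_powr)
        finally have "e1 * norm y powr (m / 2) \<le> \<eta>" using e1 by (simp add: field_simps)
        then have "e1 * norm y powr (m / 2) * norm y powr (- (3 * m / 2)) \<le> \<eta> * norm y powr (- (3 * m / 2))"
          by (intro mult_right_mono) auto
        moreover have "norm y powr (m / 2) * norm y powr (- (3 * m / 2)) = norm y powr (- m)"
          by (subst powr_add[symmetric], rule arg_cong[where f = "\<lambda>t. norm y powr t"]) (simp add: field_simps)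
        ultimately have "e1 * norm y powr (- m) \<le> \<eta> * norm y powr (- (3 * m / 2))" by (simp add: mult.assoc)
        moreover have "norm (V y) \<le> e1 * norm y powr (- m)" using r1(3)[OF y(1)] y by (simp add: \<rho>_def)
        moreover have "B * norm y powr (- (m / 2)) \<ge> 0" using B by simp
        ultimately show ?thesis by (simp add: \<phi>_def)
      qed
      show "norm (vlaplacian V y) * \<phi> y < - vlaplacian \<phi> y * norm (V y)"
        if y: "y \<noteq> 0" "norm y < r1" "norm (V y) > \<phi> y" for y
      proof -
        have yS: "y \<in> S" using y sub1[OF order_refl] by auto
        have Vy: "norm (V y) > 0" using y(3) pp[OF y(1)] by linarith
        have "C * norm (V y) powr (2 / m) \<le> C * (e1 powr (2 / m) * norm y powr (- (m * (2 / m))))"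
          using powq[OF r1(3)[OF y(1)]] y e1 C by (intro mult_left_mono) auto
        also have "\<dots> = C * e1 powr (2 / m) * norm y powr (- 2)" using m by simp
        finally have "norm (vlaplacian V y) \<le> C * e1 powr (2 / m) * norm y powr (- 2) * norm (V y)"
          using order_trans[OF pq[OF yS] mult_right_mono] by simp
        also have "\<dots> < 3 * m\<^sup>2 / 4 * norm y powr (- 2) * norm (V y)"
          using e1' y(1) Vy by (intro mult_strict_right_mono) auto
        finally have "norm (vlaplacian V y) * \<phi> y < 3 * m\<^sup>2 / 4 * norm y powr (- 2) * norm (V y) * \<phi> y"
          using pp[OF y(1)] by (intro mult_strict_right_mono) auto
        then show ?thesis unfolding pv[OF y(1)] by (simp add: mult_ac)
      qed
    qed
    then show "norm (V x) \<le> B * norm x powr (- (m / 2)) + \<eta> * norm x powr (- (3 * m / 2))"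
      by (simp add: \<phi>_def)
  qed simp

  define C2 where "C2 = C * B powr (2 / m)"
  have C2: "C2 \<ge> 0" using C by (simp add: C2_def)
  \<comment> \<open>The second entry makes C2 r2 < m^2, for the \<eta> term of the second barrier;
    the third makes 8 C2 r2^(1/2) < 1, for its square root term.\<close>
  define r2 where "r2 = min r1 (min (m\<^sup>2 / (2 * (C2 + 1))) ((1 / (16 * (C2 + 1)))\<^sup>2))"
  have r2: "r2 > 0" "r2 \<le> r1" using r1 m C2 by (auto simp: r2_def)
  have r2a: "C2 * r2 < m\<^sup>2"
  proof -
    have "C2 * r2 \<le> (C2 + 1) * (m\<^sup>2 / (2 * (C2 + 1)))" using C2 r2 by (intro mult_mono) (auto simp: r2_def)
    also have "\<dots> = m\<^sup>2 / 2" using C2 by (simp add: field_simps)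
    finally have "C2 * r2 \<le> m\<^sup>2 / 2" .
    moreover have "m\<^sup>2 > 0" using m by simp
    ultimately show ?thesis by linarith
  qed
  have r2b: "8 * (C2 * r2 powr (1 / 2)) < 1"
  proof -
    have "r2 powr (1/2) \<le> ((1 / (16 * (C2 + 1)))\<^sup>2) powr (1/2)"
      using r2 by (intro powr_mono2) (auto simp: r2_def)
    also have "\<dots> = 1 / (16 * (C2 + 1))" using C2 by (simp add: powr_half_sqrt)
    finally have "8 * (C2 * r2 powr (1/2)) \<le> 8 * ((C2 + 1) * (1 / (16 * (C2 + 1))))"
      using C2 by (intro mult_left_mono mult_mono) auto
    also have "\<dots> = 1 / 2" using C2 by (simp add: field_simps)
    finally show ?thesis by simp
  qed
  obtain M2 where M2: "M2 > 0" "\<And>x. norm x = r2 \<Longrightarrow> norm (V x) \<le> M2"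
    using sphere_bound[OF Vc sub1[OF r2(2)] r2(1)] by blast
  have V2: "norm (V x) \<le> 2 * M2" if x: "x \<noteq> 0" "norm x \<le> r2" for x
  proof (rule le_of_le_add_mult)
    fix \<eta> :: real assume eta: "\<eta> > 0"
    \<comment> \<open>A constant is harmonic and cannot absorb a potential of order |y|^(-1). The
      term -M2 |y|^(1/2) has Laplacian of order -|y|^(-3/2) and, as |y| <= 1, costs at most half of
      the constant 2 M2. The exponent -m is midway between 0 and 2 - N, which gives the \<eta> term
      its coefficient m^2.\<close>
    define \<phi> where "\<phi> y = 2 * M2 + ((- M2) *\<^sub>R norm y powr (1 / 2) + \<eta> *\<^sub>R norm y powr (- m))" for y :: 'a
    have pC': "C_k_on 2 (- {0}) (\<lambda>y::'a. (- M2) *\<^sub>R norm y powr (1 / 2) + \<eta> *\<^sub>R norm y powr (- m))"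
      by (intro C_k_on_add nC o)
    have cC: "C_k_on 2 (- {0::'a}) (\<lambda>y. 2 * M2)" by (rule C_k_on_const[OF o])
    have pC: "C_k_on 2 (- {0}) \<phi>" unfolding \<phi>_def by (intro C_k_on_add pC' cC o)
    have pv: "- vlaplacian \<phi> y = M2 * (1 / 2 * (1 / 2 + 2 * m)) * norm y powr (1 / 2 - 2) + \<eta> * (m\<^sup>2 * norm y powr (- m - 2))" if "y \<noteq> 0" for y
    proof -
      have "vlaplacian (\<lambda>y::'a. 2 * M2) y = 0" by (simp add: vlaplacian_def partial_deriv_const)
      moreover have "vlaplacian (\<lambda>y::'a. (- M2) *\<^sub>R norm y powr (1 / 2) + \<eta> *\<^sub>R norm y powr (- m)) y
        = (- M2) * ((1/2) * (1/2 + 2 * m) * norm y powr (1/2 - 2)) + \<eta> * ((- m) * (- m + 2 * m) * norm y powr (- m - 2))"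
      proof -
        have yy: "y \<in> - {0}" using that by simp
        show ?thesis unfolding vlaplacian_add[OF o yy nC nC] nv[OF that] by (rule refl)
      qed
      moreover have "vlaplacian \<phi> y = vlaplacian (\<lambda>y::'a. 2 * M2) y + vlaplacian (\<lambda>y::'a. (- M2) *\<^sub>R norm y powr (1 / 2) + \<eta> *\<^sub>R norm y powr (- m)) y"
        unfolding \<phi>_def using that by (intro vlaplacian_add[OF o _ cC pC']) auto
      ultimately show ?thesis by (simp add: power2_eq_square)
    qed
    have half: "norm y powr (1 / 2) \<le> 1" if "norm y \<le> r2" for y :: 'a
      using that r1 r2 powr_mono2[of "1/2" "norm y" 1] by simp
    have pl: "\<phi> y \<ge> M2 + \<eta> * norm y powr (- m)" if "norm y \<le> r2" for y
      using mult_left_mono[OF half[OF that], of M2] M2 by (simp add: \<phi>_def)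
    have pp: "\<phi> y > 0" if "norm y \<le> r2" for y
    proof -
      have "\<eta> * norm y powr (- m) \<ge> 0" using eta by simp
      then show ?thesis using pl[OF that] M2 by linarith
    qed
    have pu: "\<phi> y \<le> 2 * M2 + \<eta> * norm y powr (- m)" for y using M2 by (simp add: \<phi>_def)
    \<comment> \<open>Below this radius B |y|^(-m/2) is at most \<eta> |y|^(-m).\<close>
    define \<rho> where "\<rho> = min r2 ((\<eta> / B) powr (2 / m))"
    have rho: "\<rho> > 0" using r2 eta B by (simp add: \<rho>_def)
    have "norm (V x) \<le> \<phi> x"
    proof (rule barrier_comparison[OF S sub1[OF r2(2)] V[folded S_def] pC _ _ rho _ _ x])
      show "\<phi> y > 0" if "norm y \<le> r2" for y by (rule pp[OF that])
      show "norm (V y) \<le> \<phi> y" if y: "norm y = r2" for y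
      proof -
        have "\<eta> * norm y powr (- m) \<ge> 0" using eta by simp
        then show ?thesis using M2(2)[OF y] pl[of y] y by simp
      qed
      show "norm (V y) \<le> \<phi> y" if y: "y \<noteq> 0" "norm y < \<rho>" for y
      proof -
        have "norm y powr (m / 2) \<le> ((\<eta> / B) powr (2 / m)) powr (m / 2)"
          using y m by (intro powr_mono2) (auto simp: \<rho>_def)
        also have "\<dots> = \<eta> / B" using m eta B by (simp add: powr_powr)
        finally have "B * norm y powr (m / 2) \<le> \<eta>" using B by (simp add: field_simps)
        then have "B * norm y powr (m / 2) * norm y powr (- m) \<le> \<eta> * norm y powr (- m)"
          by (intro mult_right_mono) auto
        moreover have "norm y powr (m / 2) * norm y powr (- m) = norm y powr (- (m / 2))"
          by (subst powr_add[symmetric], rule arg_cong[where f = "\<lambda>t. norm y powr t"]) (simp add: field_simps)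
        ultimately have "B * norm y powr (- (m / 2)) \<le> \<eta> * norm y powr (- m)" by (simp add: mult.assoc)
        moreover have "norm (V y) \<le> B * norm y powr (- (m / 2))" using V1[OF y(1)] y r2 by (simp add: \<rho>_def)
        moreover have "M2 + \<eta> * norm y powr (- m) \<le> \<phi> y" using pl y by (simp add: \<rho>_def)
        ultimately show ?thesis using M2(1) by linarith
      qed
      show "norm (vlaplacian V y) * \<phi> y < - vlaplacian \<phi> y * norm (V y)"
        if y: "y \<noteq> 0" "norm y < r2" "norm (V y) > \<phi> y" for y
      proof -
        have yS: "y \<in> S" using y sub1[OF r2(2)] by auto
        have y0: "norm y > 0" using y by simp
        have Vy: "norm (V y) > 0" using y(3) pp[of y] y(2) by linarith
        have V1y: "norm (V y) \<le> B * norm y powr (- (m / 2))" using V1[OF y(1)] y(2) r2 by simp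
        have "C * norm (V y) powr (2 / m) \<le> C * (B powr (2 / m) * norm y powr (- (m / 2 * (2 / m))))"
          using powq[OF V1y _ y(1)] B C by (intro mult_left_mono) auto
        also have "\<dots> = C2 * norm y powr (- 1)" using m by (simp add: C2_def)
        finally have AA: "C * norm (V y) powr (2 / m) \<le> C2 * norm y powr (- 1)" .
        have A: "norm (vlaplacian V y) \<le> C2 * norm y powr (- 1) * norm (V y)"
          by (rule order_trans[OF pq[OF yS] mult_right_mono[OF AA norm_ge_zero]])
        have "C2 * norm y powr (- 1) * \<phi> y \<le> C2 * norm y powr (- 1) * (2 * M2 + \<eta> * norm y powr (- m))"
          using pu C2 by (intro mult_left_mono) auto
        also have "\<dots> = (2 * C2 * norm y powr (1 / 2)) * M2 * norm y powr (1/2 - 2) + (C2 * norm y) * (\<eta> * norm y powr (- m - 2))"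
        proof -
          have a: "norm y powr (- 1) = norm y powr (1/2) * norm y powr (1/2 - 2)" by (subst powr_add[symmetric]) simp
          have b: "norm y powr (- 1) * norm y powr (- m) = norm y * norm y powr (- m - 2)"
          proof -
            have "norm y powr (- 1) * norm y powr (- m) = norm y powr (1 + (- m - 2))"
              by (subst powr_add[symmetric], rule arg_cong[where f = "\<lambda>t. norm y powr t"]) simp
            then show ?thesis using y0 by (simp only: powr_add) simp
          qed
          have "C2 * norm y powr (- 1) * (2 * M2 + \<eta> * norm y powr (- m))
            = 2 * C2 * M2 * norm y powr (- 1) + C2 * \<eta> * (norm y powr (- 1) * norm y powr (- m))"
            by (simp only: distrib_left mult_ac)
          then show ?thesis unfolding b unfolding a by (simp only: mult_ac)
        qed
        also have "\<dots> < (1 / 2 * (1 / 2 + 2 * m)) * M2 * norm y powr (1/2 - 2) + m\<^sup>2 * (\<eta> * norm y powr (- m - 2))"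
        proof (rule add_less_le_mono)
          have "C2 * norm y powr (1/2) \<le> C2 * r2 powr (1/2)" using y C2 by (intro mult_left_mono powr_mono2) auto
          then have "2 * C2 * norm y powr (1 / 2) < 1 / 2 * (1 / 2 + 2 * m)" using r2b m by simp
          then show "(2 * C2 * norm y powr (1 / 2)) * M2 * norm y powr (1/2 - 2) < (1 / 2 * (1 / 2 + 2 * m)) * M2 * norm y powr (1/2 - 2)"
            using M2(1) y0 by (intro mult_strict_right_mono) auto
          have "C2 * norm y \<le> C2 * r2" using y C2 by (intro mult_left_mono) auto
          then show "(C2 * norm y) * (\<eta> * norm y powr (- m - 2)) \<le> m\<^sup>2 * (\<eta> * norm y powr (- m - 2))"
            using r2a eta by (intro mult_right_mono) auto
        qed
        also have "\<dots> = - vlaplacian \<phi> y" unfolding pv[OF y(1)] by (simp only: mult_ac)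
        finally have D: "C2 * norm y powr (- 1) * \<phi> y < - vlaplacian \<phi> y" .
        have "norm (vlaplacian V y) * \<phi> y \<le> C2 * norm y powr (- 1) * norm (V y) * \<phi> y"
          using A pp[of y] y(2) by (intro mult_right_mono) auto
        also have "\<dots> = (C2 * norm y powr (- 1) * \<phi> y) * norm (V y)" by (simp only: mult_ac)
        also have "\<dots> < - vlaplacian \<phi> y * norm (V y)" using D Vy by (intro mult_strict_right_mono)
        finally show ?thesis .
      qed
    qed
    then show "norm (V x) \<le> 2 * M2 + \<eta> * norm x powr (- m)"
      using pu[of x] by linarith
  qed simp
  show thesis by (rule that[of r2 "2 * M2"]) (use r1 r2 V2 in auto)
qed

section \<open>Removal of the singularity and regularity\<close>

lemma continuous_agree_at_point:
  fixes f g :: "'a::euclidean_space \<Rightarrow> 'b::real_normed_vector"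
  assumes S: "open S" "p \<in> S" and f: "continuous_on S f" and g: "continuous_on S g"
    and eq: "\<And>x. x \<in> S - {p} \<Longrightarrow> f x = g x"
  shows "f p = g p"
proof -
  have 1: "(f \<longlongrightarrow> f p) (at p)" and 2: "(g \<longlongrightarrow> g p) (at p)"
    using f g S by (auto simp: continuous_on_eq_continuous_at isCont_def)
  have "\<forall>\<^sub>F x in at p. x \<in> S" using S by (simp add: eventually_at_in_open')
  then have "\<forall>\<^sub>F x in at p. x \<in> S \<and> x \<noteq> p" by (simp add: eventually_at_filter)
  then have "\<forall>\<^sub>F x in at p. g x = f x" by eventually_elim (use eq in auto)
  from Lim_transform_eventually[OF 2 this] show ?thesis by (intro tendsto_unique[OF _ 1]) auto
qed

lemma repr_const_pos:
  assumes "DIM('a::euclidean_space) \<ge> 3" "d > 0"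
  shows "repr_const TYPE('a) d > 0"
proof -
  obtain c0 where "c0 > 0" "\<forall>d>0. repr_const TYPE('a) d \<ge> c0 * d ^ 4"
    using repr_const_lower_bound[OF assms(1)] by blast
  moreover then have "c0 * d ^ 4 > 0" using assms(2) by simp
  ultimately show ?thesis using assms(2) by (meson less_le_trans)
qed

lemma cball_subset_ball_2:
  fixes x :: "'a::metric_space"
  assumes "x \<in> ball x0 r"
  shows "cball x r \<subseteq> ball x0 (2 * r)"
proof
  fix y assume "y \<in> cball x r"
  then show "y \<in> ball x0 (2 * r)" using assms dist_triangle[of x0 y x] by simp
qed

lemma bounded_on_cball:
  fixes f :: "'a::euclidean_space \<Rightarrow> 'b::real_normed_vector"
  assumes "continuous_on S f" "cball x r \<subseteq> S"
  obtains M where "M \<ge> 0" "\<And>y. y \<in> cball x r \<Longrightarrow> norm (f y) \<le> M"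
proof -
  have "bounded (f ` cball x r)"
    using assms by (intro compact_imp_bounded compact_continuous_image) (auto intro: continuous_on_subset)
  then obtain M where "M > 0" "\<forall>z\<in>f ` cball x r. norm z \<le> M" unfolding bounded_pos by blast
  then show thesis by (intro that[of M]) auto
qed

lemma C_k_on_diff:
  assumes "open S" "C_k_on k S g" "C_k_on k S h"
  shows "C_k_on k S (\<lambda>x. g x - h x)"
  using C_k_on_add[OF assms(1,2) C_k_on_bounded_linear[OF bounded_linear_minus[OF bounded_linear_ident] assms(1,3)]]
  by simp

text \<open>Locally W is a multiple of a difference of two convolutions, with densities W and its
  Laplacian truncated to a ball, and each convolution gains one derivative over its density. One
  derivative per round is enough for the bootstrap.\<close>

lemma regularity_gain:
  fixes W :: "'a::euclidean_space \<Rightarrow> 'b::euclidean_space"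
  assumes dim: "DIM('a) \<ge> 3" and U: "open U" and W: "C_k_on (Suc (Suc k)) U W"
    and G: "C_k_on (Suc (Suc k)) U (vlaplacian W)"
  shows "C_k_on (Suc (Suc (Suc k))) U W"
proof (rule C_k_on_local)
  fix x0 assume "x0 \<in> U"
  then obtain e where e: "e > 0" "cball x0 e \<subseteq> U" using U open_contains_cball by blast
  define r where "r = e / 2"
  have r: "r > 0" and sub: "cball x0 (2 * r) \<subseteq> U" using e by (auto simp: r_def)
  have r2: "r\<^sup>2 > 0" using r by simp
  define D where "D = ball x0 (2 * r)"
  have DU: "D \<subseteq> U" using sub by (auto simp: D_def)
  have W2: "C_k_on 2 U W" using W by (rule C_k_on_mono) simp
  obtain M1 where M1: "M1 \<ge> 0" "\<And>y. y \<in> cball x0 (2 * r) \<Longrightarrow> norm (W y) \<le> M1"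
    using bounded_on_cball[OF C_k_on_imp_continuous_on[OF W] sub] by blast
  obtain M2 where M2: "M2 \<ge> 0" "\<And>y. y \<in> cball x0 (2 * r) \<Longrightarrow> norm (vlaplacian W y) \<le> M2"
    using bounded_on_cball[OF C_k_on_imp_continuous_on[OF G] sub] by blast
  define u0 where "u0 y = indicator D y *\<^sub>R W y" for y
  define v0 where "v0 y = indicator D y *\<^sub>R vlaplacian W y" for y
  have m: "u0 \<in> borel_measurable borel" "v0 \<in> borel_measurable borel"
    unfolding u0_def v0_def
    by (intro borel_measurable_continuous_on_indicator continuous_on_subset[OF _ DU]
        C_k_on_imp_continuous_on[OF W] C_k_on_imp_continuous_on[OF G], simp add: D_def)+
  have bd: "norm (u0 y) \<le> max M1 M2" "norm (v0 y) \<le> max M1 M2" for y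
    using M1(1) M1(2)[of y] M2(2)[of y] by (auto simp: u0_def v0_def D_def indicator_def)
  obtain b :: 'a where b: "b \<in> Basis" using nonempty_Basis by blast
  define c where "c = repr_const TYPE('a) (r\<^sup>2)"
  have c: "c > 0" unfolding c_def by (rule repr_const_pos[OF dim r2])
  let ?H = "\<lambda>x. kernel_conv (newton_kernel (cutoff_remainder (real DIM('a)) (r\<^sup>2)) 0) u0 x - kernel_conv (newton_kernel (cutoff (r\<^sup>2)) 0) v0 x"
  have rep: "W x = (1 / c) *\<^sub>R ?H x" if x: "x \<in> ball x0 r" for x
  proof -
    have cs: "cball x r \<subseteq> D" using cball_subset_ball_2[OF x] by (simp add: D_def)
    have "c *\<^sub>R W x = ?H x"
      unfolding c_def
    proof (rule vlaplacian_representation[OF dim r U _ C_k_on_subset[OF W2] _ m(1) bd(1) _ m(2) bd(2)])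
      show "cball x r \<subseteq> U" using cs DU by blast
      show "x \<noteq> x + b" using b by (auto simp: nonzero_Basis)
      show "u0 y = W y" "v0 y = vlaplacian W y" if "y \<in> cball x r - {x + b}" for y
        using that cs by (auto simp: u0_def v0_def)
    qed auto
    then have "(1 / c) *\<^sub>R ?H x = (1 / c) *\<^sub>R (c *\<^sub>R W x)" by simp
    then show ?thesis using c by simp
  qed
  have "C_k_on (Suc (Suc (Suc k))) (ball x0 r) ?H"
    unfolding u0_def v0_def D_def
    by (intro C_k_on_diff open_ball newton_kernel_conv_C_Suc[OF dim profile_cutoff_remainder[OF r2] r U sub W]
        newton_kernel_conv_C_Suc[OF dim profile_cutoff[OF r2] r U sub G])
  then have "C_k_on (Suc (Suc (Suc k))) (ball x0 r) (\<lambda>x. (1 / c) *\<^sub>R ?H x)"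
    by (rule C_k_on_bounded_linear[OF bounded_linear_scaleR_right open_ball])
  from C_k_on_cong[OF open_ball rep[symmetric] this]
  have "C_k_on (Suc (Suc (Suc k))) (ball x0 r) W" by simp
  then show "\<exists>T. open T \<and> x0 \<in> T \<and> C_k_on (Suc (Suc (Suc k))) T W"
    using r by (intro exI[of _ "ball x0 r"]) auto
qed

lemma semilinear_smooth:
  fixes W :: "'a::euclidean_space \<Rightarrow> 'b::euclidean_space"
  assumes dim: "DIM('a) \<ge> 3" and U: "open U" and W: "C_k_on 2 U W" and eq: "\<And>x. x \<in> U \<Longrightarrow> vlaplacian W x = \<Phi> (W x)"
    and Om: "open \<Omega>" "\<And>x. x \<in> U \<Longrightarrow> W x \<in> \<Omega>" "smooth_on \<Omega> \<Phi>"
  shows "smooth_on U W"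
proof -
  have "C_k_on (Suc (Suc k)) U W" for k
  proof (induction k)
    case 0
    then show ?case using W by (simp add: numeral_2_eq_2)
  next
    case (Suc k)
    have "C_k_on (Suc (Suc k)) U (\<lambda>x. \<Phi> (W x))"
      using Om(3) by (intro C_k_on_compose[OF U Om(1,2) Suc]) (auto simp: smooth_on_def)
    from C_k_on_cong[OF U eq[symmetric] this]
    have "C_k_on (Suc (Suc k)) U (vlaplacian W)" by blast
    then show ?case by (rule regularity_gain[OF dim U Suc])
  qed
  then show ?thesis unfolding smooth_on_def using C_k_on_mono[of "Suc (Suc _)" U W] by (metis le_SucI le_refl)
qed

text \<open>The second derivatives of the kernel are not integrable, so a single use of the formula
  cannot yield C^2; hence two rounds on nested balls. \<open>PhiL\<close> admits arbitrary
  directions h because the chain rule for \<Phi>(W) produces the direction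
  \<open>partial_deriv b W\<close>.\<close>

theorem removable_singularity:
  fixes V :: "'a::euclidean_space \<Rightarrow> 'b::euclidean_space" and \<Phi> :: "'b \<Rightarrow> 'b"
  assumes dim: "DIM('a) \<ge> 3" and V: "C_k_on 2 (ball 0 1 - {0}) V"
    and eq: "\<And>x. x \<in> ball 0 1 - {0} \<Longrightarrow> vlaplacian V x = \<Phi> (V x)"
    and r: "0 < r" "r < 1" and B: "\<And>x. x \<noteq> 0 \<Longrightarrow> norm x \<le> r \<Longrightarrow> norm (V x) \<le> B"
    and Phi: "\<And>v. \<Phi> differentiable (at v)"
    and PhiL: "\<And>R. \<exists>L. \<forall>v h. norm v \<le> R \<longrightarrow> norm (partial_deriv h \<Phi> v) \<le> L * norm h"
  obtains W where "\<And>x. x \<noteq> 0 \<Longrightarrow> W x = V x" "C_k_on 2 (ball 0 1) W"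
    "\<And>x. x \<in> ball 0 1 \<Longrightarrow> vlaplacian W x = \<Phi> (W x)"
proof -
  obtain b :: 'a where b: "b \<in> Basis" using nonempty_Basis by blast
  have Phic: "continuous_on UNIV \<Phi>" using Phi
    by (simp add: continuous_at_imp_continuous_on differentiable_imp_continuous_within)
  have o1: "open (ball (0::'a) 1 - {0})" by auto

  \<comment> \<open>The representation formula exhibits a \<open>C\<^sup>1\<close> extension.\<close>
  define s where "s = r / 2"
  have s: "s > 0" "2 * s = r" using r by (auto simp: s_def)
  have s2: "s\<^sup>2 > 0" using s by simp
  define P where "P = ball (0::'a) r - {0}"
  have P: "open P" "P \<subseteq> ball 0 1 - {0}" using r by (auto simp: P_def)
  obtain BG where BG: "BG \<ge> 0" "\<And>v. v \<in> cball 0 \<bar>B\<bar> \<Longrightarrow> norm (\<Phi> v) \<le> BG"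
    using bounded_on_cball[OF Phic subset_UNIV] by blast
  define u0 where "u0 y = indicator P y *\<^sub>R V y" for y
  define v0 where "v0 y = indicator P y *\<^sub>R vlaplacian V y" for y
  have m: "u0 \<in> borel_measurable borel" "v0 \<in> borel_measurable borel"
    unfolding u0_def v0_def
    using P by (intro borel_measurable_continuous_on_indicator continuous_on_subset[OF _ P(2)]
        C_k_on_imp_continuous_on[OF V] vlaplacian_continuous_on[OF V], simp)+
  have bd: "norm (u0 y) \<le> max \<bar>B\<bar> BG" "norm (v0 y) \<le> max \<bar>B\<bar> BG" for y
  proof -
    have "norm (V y) \<le> \<bar>B\<bar> \<and> norm (vlaplacian V y) \<le> BG" if "y \<in> P"
    proof -
      have y: "y \<noteq> 0" "norm y \<le> r" "y \<in> ball 0 1 - {0}" using that P(2) by (auto simp: P_def)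
      have "norm (V y) \<le> \<bar>B\<bar>" using B[OF y(1,2)] by simp
      then show ?thesis using BG(2)[of "V y"] eq[OF y(3)] by simp
    qed
    then show "norm (u0 y) \<le> max \<bar>B\<bar> BG" "norm (v0 y) \<le> max \<bar>B\<bar> BG"
      using BG(1) by (cases "y \<in> P"; auto simp: u0_def v0_def)+
  qed
  define c where "c = repr_const TYPE('a) (s\<^sup>2)"
  have c: "c > 0" unfolding c_def by (rule repr_const_pos[OF dim s2])
  define H where "H x = kernel_conv (newton_kernel (cutoff_remainder (real DIM('a)) (s\<^sup>2)) 0) u0 x - kernel_conv (newton_kernel (cutoff (s\<^sup>2)) 0) v0 x" for x
  have HC: "C_k_on 1 UNIV H" unfolding H_def
    by (intro C_k_on_diff open_UNIV newton_kernel_conv_C_1[OF dim profile_cutoff_remainder[OF s2] m(1) bd(1)]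
        newton_kernel_conv_C_1[OF dim profile_cutoff[OF s2] m(2) bd(2)])
  have rep1: "c *\<^sub>R V x = H x" if x: "x \<in> ball 0 s" "x \<noteq> 0" for x
    unfolding c_def H_def
  proof (rule vlaplacian_representation[OF dim s(1) open_ball _ V x(2) m(1) bd(1) _ m(2) bd(2)])
    have cs: "cball x s \<subseteq> ball 0 r" using cball_subset_ball_2[OF x(1)] s(2) by simp
    then show "cball x s \<subseteq> ball 0 1" using r by auto
    show "u0 y = V y" "v0 y = vlaplacian V y" if "y \<in> cball x s - {0}" for y
      using that cs by (auto simp: u0_def v0_def P_def)
  qed
  \<comment> \<open>Only the value at 0 is new; it is the one that the formula prescribes.\<close>
  define W where "W x = (if x = 0 then (1 / c) *\<^sub>R H 0 else V x)" for x
  have WV: "W x = V x" if "x \<noteq> 0" for x using that by (simp add: W_def)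
  have WH: "W x = (1 / c) *\<^sub>R H x" if x: "x \<in> ball 0 s" for x
  proof (cases "x = 0")
    case False
    have "(1 / c) *\<^sub>R (c *\<^sub>R V x) = (1 / c) *\<^sub>R H x" using rep1[OF x False] by simp
    then show ?thesis using False c by (simp add: W_def)
  qed (simp add: W_def)
  have W1: "C_k_on 1 (ball 0 s) W"
    by (rule C_k_on_cong[OF open_ball WH[symmetric] C_k_on_bounded_linear[OF bounded_linear_scaleR_right open_ball]])
       (use C_k_on_subset[OF HC] in auto)

  \<comment> \<open>Now the right-hand side is differentiable with bounded derivatives, and the formula gains one more derivative.\<close>
  define t where "t = s / 4"
  have t: "t > 0" "2 * t < s" using s by (auto simp: t_def)
  have t2: "t\<^sup>2 > 0" using t by simp
  define D where "D = ball (0::'a) (2 * t)"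
  have Dsub: "cball 0 (2 * t) \<subseteq> ball (0::'a) s" "D \<subseteq> ball 0 s" "D \<subseteq> cball 0 (2 * t)" using t by (auto simp: D_def)
  have Wc: "continuous_on (ball 0 s) W" by (rule C_k_on_imp_continuous_on[OF W1])
  have Wd: "W differentiable (at y)" if "y \<in> ball 0 s" for y using W1 that by simp
  have W1c: "continuous_on (ball 0 s) (partial_deriv b' W)" if "b' \<in> Basis" for b' using W1 that by simp
  define G where "G y = \<Phi> (W y)" for y
  have Gd: "G differentiable (at y) \<and> partial_deriv b' G y = partial_deriv (partial_deriv b' W y) \<Phi> (W y)"
    if "y \<in> ball 0 s" for y b'
  proof -
    have 1: "(W has_derivative frechet_derivative W (at y)) (at y)" using Wd[OF that] frechet_derivative_works by blast
    have 2: "(\<Phi> has_derivative frechet_derivative \<Phi> (at (W y))) (at (W y))" using Phi frechet_derivative_works by blast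
    have 3: "(G has_derivative (\<lambda>h. frechet_derivative \<Phi> (at (W y)) (frechet_derivative W (at y) h))) (at y)"
      unfolding G_def using has_derivative_compose[OF 1 2] .
    then show ?thesis using partial_deriv_eq[OF 3, of b'] unfolding differentiable_def partial_deriv_def by blast
  qed
  obtain MW where MW: "MW \<ge> 0" "\<And>y. y \<in> cball 0 (2 * t) \<Longrightarrow> norm (W y) \<le> MW"
    using bounded_on_cball[OF Wc Dsub(1)] by blast
  obtain L where L: "\<And>v h. norm v \<le> MW \<Longrightarrow> norm (partial_deriv h \<Phi> v) \<le> L * norm h" using PhiL by blast
  have Gc: "continuous_on (ball 0 s) G"
    using Gd by (simp add: continuous_at_imp_continuous_on differentiable_imp_continuous_within)
  obtain MG where MG: "MG \<ge> 0" "\<And>y. y \<in> cball 0 (2 * t) \<Longrightarrow> norm (G y) \<le> MG"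
    using bounded_on_cball[OF Gc Dsub(1)] by blast
  have MD: "\<exists>M\<ge>0. \<forall>y\<in>cball 0 (2 * t). norm (partial_deriv b' G y) \<le> M" if b': "b' \<in> Basis" for b'
  proof -
    obtain M where M: "M \<ge> 0" "\<And>y. y \<in> cball 0 (2 * t) \<Longrightarrow> norm (partial_deriv b' W y) \<le> M"
      using bounded_on_cball[OF W1c[OF b'] Dsub(1)] by blast
    have "norm (partial_deriv b' G y) \<le> \<bar>L\<bar> * M" if y: "y \<in> cball 0 (2 * t)" for y
    proof -
      have "norm (partial_deriv b' G y) \<le> L * norm (partial_deriv b' W y)"
        using Gd[of y b'] L[OF MW(2)[OF y]] y Dsub(1) by auto
      also have "\<dots> \<le> \<bar>L\<bar> * M" using M(2)[OF y] by (intro mult_mono) auto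
      finally show ?thesis .
    qed
    then show ?thesis using M(1) by (intro exI[of _ "\<bar>L\<bar> * M"]) auto
  qed
  define u1 where "u1 y = indicator D y *\<^sub>R W y" for y
  define v1 where "v1 y = indicator D y *\<^sub>R G y" for y
  have m1: "u1 \<in> borel_measurable borel" "v1 \<in> borel_measurable borel"
    unfolding u1_def v1_def
    by (intro borel_measurable_continuous_on_indicator continuous_on_subset[OF _ Dsub(2)] Wc Gc, simp add: D_def)+
  have bd1: "norm (u1 y) \<le> max MW MG" "norm (v1 y) \<le> max MW MG" for y
    using MW(1) MW(2)[of y] MG(2)[of y] Dsub(3) by (auto simp: u1_def v1_def indicator_def)
  define c' where "c' = repr_const TYPE('a) (t\<^sup>2)"
  have c': "c' > 0" unfolding c'_def by (rule repr_const_pos[OF dim t2])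
  let ?K = "newton_kernel (cutoff (t\<^sup>2)) 0 :: 'a \<Rightarrow> real"
  define H' where "H' x = kernel_conv (newton_kernel (cutoff_remainder (real DIM('a)) (t\<^sup>2)) 0) u1 x - kernel_conv ?K v1 x" for x
  have rep2: "c' *\<^sub>R W x = H' x" if x: "x \<in> ball 0 t" "x \<noteq> 0" for x
  proof -
    have cs: "cball x t \<subseteq> D" using cball_subset_ball_2[OF x(1)] by (simp add: D_def)
    have cs1: "cball x t \<subseteq> ball 0 1" using cs Dsub(2) s r by (auto simp: s_def)
    have "c' *\<^sub>R V x = H' x" unfolding c'_def H'_def
    proof (rule vlaplacian_representation[OF dim t(1) open_ball cs1 V x(2) m1(1) bd1(1) _ m1(2) bd1(2)])
      fix y assume y: "y \<in> cball x t - {0}"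
      then have "y \<in> D" "y \<noteq> 0" "y \<in> ball 0 1 - {0}" using cs cs1 by auto
      then show "u1 y = V y" "v1 y = vlaplacian V y" by (simp_all add: u1_def v1_def G_def WV eq)
    qed
    then show ?thesis using WV[OF x(2)] by simp
  qed
  have K1: "C_k_on 1 UNIV (kernel_conv ?K v1)" by (rule newton_kernel_conv_C_1[OF dim profile_cutoff[OF t2] m1(2) bd1(2)])
  \<comment> \<open>The density W is already C^1, so the general gain applies. It does not apply to
    the density \<open>G\<close>, whose partial derivatives need not be continuous; that term is
    treated by hand below.\<close>
  have R1: "C_k_on 2 (ball 0 t) (kernel_conv (newton_kernel (cutoff_remainder (real DIM('a)) (t\<^sup>2)) 0) u1)"
    using newton_kernel_conv_C_Suc[OF dim profile_cutoff_remainder[OF t2] t(1) open_ball Dsub(1) W1]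
    unfolding u1_def D_def by (simp only: Suc_1)
  have "C_k_on (Suc 1) (ball 0 t) (kernel_conv ?K v1)"
    unfolding C_k_on.simps(2)[of 1]
  proof (intro conjI ballI)
    show "kernel_conv ?K v1 differentiable (at x)" for x using K1 by simp
    fix b' :: 'a assume b': "b' \<in> Basis"
    obtain M where M: "M \<ge> 0" "\<And>y. y \<in> cball 0 (2 * t) \<Longrightarrow> norm (partial_deriv b' G y) \<le> M" using MD[OF b'] by blast
    have pd: "partial_deriv b' (kernel_conv ?K v1) x = kernel_conv ?K (\<lambda>y. indicator D y *\<^sub>R partial_deriv b' G y) x"
      if x: "x \<in> ball 0 t" for x
      unfolding v1_def D_def
    proof (rule kernel_conv_partial_deriv[OF _ _ x b', where M = "max MG M"])
      show "integrable lborel ?K" by (rule newton_kernel_integrable_limit(1)[OF dim profile_cutoff[OF t2] b]) simp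
      show "?K z = 0" if "norm z > t" for z
        using newton_kernel_outside(1)[OF profile_cutoff[OF t2], of z] that t by simp
      show "G differentiable (at y)" if "y \<in> ball 0 (2 * t)" for y using Gd that Dsub(2) by (auto simp: D_def)
      show "norm (G y) \<le> max MG M" "norm (partial_deriv b' G y) \<le> max MG M" if "y \<in> ball 0 (2 * t)" for y
        using MG(2)[of y] M(2)[of y] that by auto
      show "kernel_conv ?K (\<lambda>y. indicator (ball 0 (2 * t)) y *\<^sub>R G y) differentiable (at x)"
        using K1 by (simp add: v1_def[abs_def] D_def)
    qed
    have CP: "C_k_on 1 (ball 0 t) (kernel_conv ?K (\<lambda>y. indicator D y *\<^sub>R partial_deriv b' G y))"
    proof (rule C_k_on_subset[OF newton_kernel_conv_C_1[OF dim profile_cutoff[OF t2]] subset_UNIV])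
      show "(\<lambda>y. indicator D y *\<^sub>R partial_deriv b' G y) \<in> borel_measurable borel"
        by (rule partial_deriv_measurable(2)) (use Gd Dsub(2) in \<open>auto simp: D_def\<close>)
      show "norm (indicator D y *\<^sub>R partial_deriv b' G y) \<le> M" for y
        using M(1) M(2)[of y] Dsub(3) by (auto simp: indicator_def)
    qed
    show "C_k_on 1 (ball 0 t) (partial_deriv b' (kernel_conv ?K v1))"
      by (rule C_k_on_cong[OF open_ball pd[symmetric] CP])
  qed
  then have K2: "C_k_on 2 (ball 0 t) (kernel_conv ?K v1)" by (simp only: Suc_1)
  have H'C: "C_k_on 2 (ball 0 t) H'" unfolding H'_def by (intro C_k_on_diff open_ball R1 K2)
  \<comment> \<open>The formula is known off 0 only, since the singularity may not be the point of
    evaluation; both sides are continuous at 0.\<close>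
  have "c' *\<^sub>R W 0 = H' 0"
  proof (rule continuous_agree_at_point[where S = "ball 0 t" and f = "\<lambda>x. c' *\<^sub>R W x" and g = H'])
    show "continuous_on (ball 0 t) (\<lambda>x. c' *\<^sub>R W x)"
      using t by (intro continuous_intros continuous_on_subset[OF Wc]) auto
  qed (use t rep2 C_k_on_imp_continuous_on[OF H'C] in auto)
  then have W_H': "c' *\<^sub>R W x = H' x" if "x \<in> ball 0 t" for x using rep2[OF that] by (cases "x = 0") auto
  have WH': "(1 / c') *\<^sub>R H' x = W x" if "x \<in> ball 0 t" for x
    unfolding W_H'[OF that, symmetric] using c' by simp
  have W2: "C_k_on 2 (ball 0 t) W"
    by (rule C_k_on_cong[OF open_ball WH' C_k_on_bounded_linear[OF bounded_linear_scaleR_right open_ball H'C]])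
  have W2p: "C_k_on 2 (ball 0 1 - {0}) W"
    by (rule C_k_on_cong[OF o1 _ V]) (simp add: WV)
  have W2b: "C_k_on 2 (ball 0 1) W"
  proof (rule C_k_on_local)
    fix x :: 'a assume x: "x \<in> ball 0 1"
    show "\<exists>T. open T \<and> x \<in> T \<and> C_k_on 2 T W"
    proof (cases "x = 0")
      case True
      then show ?thesis using W2 t by (intro exI[of _ "ball 0 t"]) auto
    next
      case False
      then show ?thesis using W2p o1 x by (intro exI[of _ "ball 0 1 - {0}"]) auto
    qed
  qed
  have eqW: "vlaplacian W x = \<Phi> (W x)" if "x \<in> ball 0 1 - {0}" for x
    using vlaplacian_cong[OF o1 that, of W V] eq[OF that] that by (simp add: WV)
  have cPW: "continuous_on (ball 0 1) (\<lambda>x. \<Phi> (W x))"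
    by (rule continuous_on_compose2[OF Phic C_k_on_imp_continuous_on[OF W2b]]) auto
  have "vlaplacian W 0 = \<Phi> (W 0)"
    by (rule continuous_agree_at_point[where g = "\<lambda>x. \<Phi> (W x)", OF open_ball _ vlaplacian_continuous_on[OF W2b] cPW eqW]) auto
  then have "vlaplacian W x = \<Phi> (W x)" if "x \<in> ball 0 1" for x using eqW that by (cases "x = 0") auto
  with that[OF WV W2b] show thesis by blast
qed

section \<open>The system\<close>

lemma positive_definite_inverse:
  fixes A :: "real^'m^'m"
  assumes "symmetric_positive_definite A"
  shows "matrix_inv A *v (A *v x) = x" "A *v (matrix_inv A *v x) = x"
proof -
  have "x = 0" if "A *v x = 0" for x
    using assms that unfolding symmetric_positive_definite_def by force
  then have "invertible A"
    using matrix_left_invertible_ker[of A] invertible_left_inverse[of A] by blast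
  then have "A ** matrix_inv A = mat 1 \<and> matrix_inv A ** A = mat 1"
    unfolding invertible_def matrix_inv_def by (rule someI_ex)
  then show "matrix_inv A *v (A *v x) = x" "A *v (matrix_inv A *v x) = x"
    by (simp_all add: matrix_vector_mul_assoc)
qed

lemma laplacian_component:
  fixes V :: "real^'n \<Rightarrow> real^'m"
  assumes "open S" "x \<in> S" "C_k_on 2 S V"
  shows "laplacian (\<lambda>y. V y $ j) x = vlaplacian V x $ j"
  using vlaplacian_bounded_linear[OF bounded_linear_vec_nth assms, of j]
  by (simp add: laplacian_def vlaplacian_def)

text \<open>The map \<Phi> of the overview.\<close>

definition solved_rhs :: "real^'m^'m \<Rightarrow> ('m \<Rightarrow> real^'m \<Rightarrow> real) \<Rightarrow> real^'m \<Rightarrow> real^'m" where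
  "solved_rhs A f v = matrix_inv A *v (\<chi> i. f i v)"

lemma solution_on_iff:
  fixes V :: "real^'n \<Rightarrow> real^'m"
  assumes A: "symmetric_positive_definite A" and S: "open S"
  shows "solution_on A f S V \<longleftrightarrow> C_k_on 2 S V \<and> (\<forall>x\<in>S. vlaplacian V x = solved_rhs A f (V x))"
proof -
  have "(\<forall>i. (\<Sum>j\<in>UNIV. A $ i $ j * laplacian (\<lambda>y. V y $ j) x) = f i (V x)) \<longleftrightarrow> vlaplacian V x = solved_rhs A f (V x)"
    if C: "C_k_on 2 S V" and x: "x \<in> S" for x
  proof -
    have "(\<forall>i. (\<Sum>j\<in>UNIV. A $ i $ j * laplacian (\<lambda>y. V y $ j) x) = f i (V x)) \<longleftrightarrow> A *v vlaplacian V x = (\<chi> i. f i (V x))"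
      by (simp add: laplacian_component[OF S x C] vec_eq_iff matrix_vector_mult_def)
    also have "\<dots> \<longleftrightarrow> vlaplacian V x = solved_rhs A f (V x)"
      unfolding solved_rhs_def using positive_definite_inverse[OF A] by metis
    finally show ?thesis .
  qed
  then show ?thesis unfolding solution_on_def by auto
qed

text \<open>With fixed vectors as coefficients of the scalar functions \<open>f i\<close>, bounds,
  derivatives and smoothness follow term by term.\<close>

lemma solved_rhs_sum:
  "solved_rhs A f v = (\<Sum>i\<in>UNIV. f i v *\<^sub>R (matrix_inv A *v axis i 1))"
proof -
  have "(\<chi> i. f i v) = (\<Sum>i\<in>UNIV. f i v *\<^sub>R (axis i 1 :: real^'a))"
    by (simp add: vec_eq_iff axis_def if_distrib[of "\<lambda>t. _ * t"] sum.delta' cong: if_cong)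
  then show ?thesis unfolding solved_rhs_def
    by (simp add: linear_sum[OF matrix_vector_mul_linear] linear_scale[OF matrix_vector_mul_linear])
qed

lemma structure_conditions_solved_rhs:
  fixes A :: "real^'m^'m"
  assumes f: "\<And>i. structure_conditions q C (f i)" and q: "q > 1"
  shows "\<exists>C'\<ge>0. \<forall>v. norm (solved_rhs A f v) \<le> C' * norm v powr q"
    and "solved_rhs A f differentiable (at v)"
    and "\<exists>L. \<forall>v h. norm v \<le> R \<longrightarrow> norm (partial_deriv h (solved_rhs A f) v) \<le> L * norm h"
proof -
  define w where "w i = matrix_inv A *v (axis i 1 :: real^'m)" for i
  have rhs: "solved_rhs A f = (\<lambda>v. \<Sum>i\<in>UNIV. f i v *\<^sub>R w i)" by (rule ext) (simp add: solved_rhs_sum w_def)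
  define W where "W = (\<Sum>i\<in>UNIV. norm (w i))"
  have sumW: "(\<Sum>i\<in>UNIV. K * norm (w i)) = K * W" for K by (simp add: W_def sum_distrib_left)
  \<comment> \<open>Working with |C| spares a separate proof that C is nonnegative.\<close>
  have fb: "\<bar>f i v\<bar> \<le> \<bar>C\<bar> * norm v powr q" for i v
    using f[of i] unfolding structure_conditions_def
    by (meson abs_ge_self mult_right_mono order_trans powr_ge_zero)
  have "\<exists>D. (GDERIV (f i) v :> D) \<and> norm D \<le> C * norm v powr (q - 1)" for i v
    using f[of i] unfolding structure_conditions_def by blast
  then obtain D where D: "\<And>i v. GDERIV (f i) v :> D i v" "\<And>i v. norm (D i v) \<le> C * norm v powr (q - 1)"
    by metis
  have der: "(solved_rhs A f has_derivative (\<lambda>h. \<Sum>i\<in>UNIV. (h \<bullet> D i v) *\<^sub>R w i)) (at v)" for v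
    unfolding rhs using D(1) unfolding gderiv_def
    by (intro has_derivative_sum has_derivative_scaleR_left) auto
  show "solved_rhs A f differentiable (at v)" using der differentiable_def by blast
  show "\<exists>C'\<ge>0. \<forall>v. norm (solved_rhs A f v) \<le> C' * norm v powr q"
  proof (intro exI[of _ "\<bar>C\<bar> * W"] conjI allI)
    show "0 \<le> \<bar>C\<bar> * W" by (simp add: W_def sum_nonneg)
    fix v
    have "norm (solved_rhs A f v) \<le> (\<Sum>i\<in>UNIV. (\<bar>C\<bar> * norm v powr q) * norm (w i))"
      unfolding rhs by (intro sum_norm_le) (auto intro!: mult_right_mono fb)
    then show "norm (solved_rhs A f v) \<le> \<bar>C\<bar> * W * norm v powr q"
      unfolding sumW by (simp only: mult_ac)
  qed
  show "\<exists>L. \<forall>v h. norm v \<le> R \<longrightarrow> norm (partial_deriv h (solved_rhs A f) v) \<le> L * norm h"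
  proof (intro exI[of _ "\<bar>C\<bar> * R powr (q - 1) * W"] allI impI)
    fix v h :: "real^'m" assume v: "norm v \<le> R"
    have "norm (partial_deriv h (solved_rhs A f) v) = norm (\<Sum>i\<in>UNIV. (h \<bullet> D i v) *\<^sub>R w i)"
      by (simp add: partial_deriv_eq[OF der])
    also have "\<dots> \<le> (\<Sum>i\<in>UNIV. (norm h * (\<bar>C\<bar> * R powr (q - 1))) * norm (w i))"
    proof (rule sum_norm_le)
      fix i
      have "norm (D i v) \<le> \<bar>C\<bar> * R powr (q - 1)"
      proof (rule order_trans[OF D(2)])
        have "norm v powr (q - 1) \<le> R powr (q - 1)" using v q by (intro powr_mono2) auto
        then show "C * norm v powr (q - 1) \<le> \<bar>C\<bar> * R powr (q - 1)" by (intro mult_mono) auto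
      qed
      then have "\<bar>h \<bullet> D i v\<bar> \<le> norm h * (\<bar>C\<bar> * R powr (q - 1))"
        using Cauchy_Schwarz_ineq2[of h "D i v"] mult_left_mono[of "norm (D i v)" _ "norm h"] by fastforce
      then show "norm ((h \<bullet> D i v) *\<^sub>R w i) \<le> (norm h * (\<bar>C\<bar> * R powr (q - 1))) * norm (w i)"
        unfolding norm_scaleR by (rule mult_right_mono) simp
    qed
    also have "\<dots> = \<bar>C\<bar> * R powr (q - 1) * W * norm h"
      unfolding sumW by (simp only: mult_ac)
    finally show "norm (partial_deriv h (solved_rhs A f) v) \<le> \<bar>C\<bar> * R powr (q - 1) * W * norm h" .
  qed
qed

lemma solved_rhs_smooth:
  assumes "open \<Omega>" "\<And>i. smooth_on \<Omega> (f i)"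
  shows "smooth_on \<Omega> (solved_rhs A f)"
  unfolding smooth_on_def solved_rhs_sum[abs_def]
  using assms(2) by (auto simp: smooth_on_def intro!: C_k_on_sum C_k_on_scaleR C_k_on_const assms(1))

text \<open>\<open>in_Lp\<close> refers to the completed measure, the integrals above to
  \<open>lborel\<close>. Continuity off z supplies the Borel measurability; the value of V at z is
  arbitrary and is cut out.\<close>

lemma in_Lp_integrable_punctured:
  fixes V :: "'a::euclidean_space \<Rightarrow> 'b::euclidean_space"
  assumes "in_Lp p S V" "open S" "continuous_on (S - {z}) V" "p > 0"
  shows "integrable lborel (\<lambda>x. indicator (S - {z}) x * norm (V x) powr p)"
proof -
  let ?h = "\<lambda>x. indicator (S - {z}) x *\<^sub>R norm (V x) powr p"
  have o: "open (S - {z})" using assms(2) by auto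
  have m: "?h \<in> borel_measurable borel"
    using assms(3,4) o by (intro borel_measurable_continuous_on_indicator continuous_on_powr' continuous_intros) auto
  have "integrable lebesgue (\<lambda>x. indicator S x *\<^sub>R norm (V x) powr p)"
    using assms(1) by (simp add: in_Lp_def set_integrable_def)
  then have "integrable lebesgue ?h"
  proof (rule Bochner_Integration.integrable_bound)
    show "?h \<in> borel_measurable lebesgue" using m by (simp add: measurable_completion)
    show "AE x in lebesgue. norm (?h x) \<le> norm (indicator S x *\<^sub>R norm (V x) powr p)"
      by (rule AE_I2) (auto simp: indicator_def)
  qed
  then show ?thesis using m by (subst (asm) integrable_completion) auto
qed

text \<open>\<open>solution_on\<close> makes W a C^2 solution on the whole ball. Higher smoothness
  depends on that of the \<open>f i\<close>, which are assumed just differentiable and, being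
  homogeneous, may fail to be smooth at 0; so it is asserted on the part of the ball that W maps
  into a region where they are smooth. If all \<open>f i\<close> are smooth everywhere, \<Omega> =
  UNIV gives smoothness on the whole ball.\<close>

theorem corollary1:
  fixes A :: "real^'m^'m"
    and f :: "'m \<Rightarrow> real^'m \<Rightarrow> real"
    and V :: "real^'n \<Rightarrow> real^'m"
    and n q C :: real
  defines "n \<equiv> real CARD('n)"
    and "q \<equiv> (n + 2) / (n - 2)"
  assumes "CARD('n) \<ge> 3"
    and "symmetric_positive_definite A"
    and "\<And>i. homogeneous_of_degree q (f i)"
    and "\<And>i. structure_conditions q C (f i)"
    and "in_Lp (2 * n / (n - 2)) (ball 0 1) V"
    and "solution_on A f (ball 0 1 - {0}) V"
  shows "\<exists>W. (\<forall>x \<in> ball 0 1 - {0}. W x = V x) \<and>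
             solution_on A f (ball 0 1) W \<and>
             (\<forall>\<Omega>. open \<Omega> \<and> (\<forall>i. smooth_on \<Omega> (f i)) \<longrightarrow>
                  smooth_on {x \<in> ball 0 1. W x \<in> \<Omega>} W)"
proof -
  note A = \<open>symmetric_positive_definite A\<close>
  let ?F = "solved_rhs A f"
  have dim: "DIM(real^'n) \<ge> 3" using assms(3) by simp
  have n: "n \<ge> 3" using assms(3) by (simp add: n_def)
  have nd: "real DIM(real^'n) = n" by (simp add: n_def)
  have q: "q > 1" using n by (simp add: q_def field_simps)
  have o1: "open (ball (0::real^'n) 1 - {0})" by auto
  have V: "C_k_on 2 (ball 0 1 - {0}) V" and eq: "\<And>x. x \<in> ball 0 1 - {0} \<Longrightarrow> vlaplacian V x = ?F (V x)"
    using assms(8) unfolding solution_on_iff[OF A o1] by auto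
  note str = structure_conditions_solved_rhs[of q C f, OF assms(6) q]
  obtain C' where C': "C' \<ge> 0" "\<And>v. norm (?F v) \<le> C' * norm v powr q" using str(1) by blast
  obtain r B where rB: "0 < r" "r < 1" "\<And>x. x \<noteq> 0 \<Longrightarrow> norm x \<le> r \<Longrightarrow> norm (V x) \<le> B"
  proof (rule bounded_near_singularity[OF dim V C'(1), unfolded nd])
    show "norm (vlaplacian V x) \<le> C' * norm (V x) powr ((n + 2) / (n - 2))" if "x \<in> ball 0 1 - {0}" for x
      unfolding eq[OF that] using C'(2) by (simp add: q_def)
    show "integrable lborel (\<lambda>x. indicator (ball 0 1 - {0}) x * norm (V x) powr (2 * n / (n - 2)))"
      using n by (intro in_Lp_integrable_punctured assms(7) C_k_on_imp_continuous_on[OF V]) auto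
  qed (rule that)
  obtain W where W: "\<And>x. x \<noteq> 0 \<Longrightarrow> W x = V x" "C_k_on 2 (ball 0 1) W"
    "\<And>x. x \<in> ball 0 1 \<Longrightarrow> vlaplacian W x = ?F (W x)"
    using removable_singularity[OF dim V eq rB str(2,3)] by blast
  have "solution_on A f (ball 0 1) W" unfolding solution_on_iff[OF A open_ball] using W by blast
  moreover have "smooth_on {x \<in> ball 0 1. W x \<in> \<Omega>} W" if Om: "open \<Omega>" "\<forall>i. smooth_on \<Omega> (f i)" for \<Omega>
  proof (rule semilinear_smooth[OF dim, where \<Phi> = ?F and \<Omega> = \<Omega>])
    have "open (ball 0 1 \<inter> W -` \<Omega>)"
      using continuous_open_preimage[OF C_k_on_imp_continuous_on[OF W(2)] open_ball Om(1)] .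
    then show "open {x \<in> ball 0 1. W x \<in> \<Omega>}" by (simp add: vimage_def Int_def)
    show "C_k_on 2 {x \<in> ball 0 1. W x \<in> \<Omega>} W" by (rule C_k_on_subset[OF W(2)]) auto
    show "smooth_on \<Omega> ?F" using Om by (intro solved_rhs_smooth) auto
  qed (use W Om in auto)
  ultimately show ?thesis using W(1) by (intro exI[of _ W]) auto
qed

end
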